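(* Let $\mathcal A$ be a unital $C^*$-algebra and let $A\in\mathcal A^{++}$. Assume that either $$\|A\,\sigma_{ch}\,X\|=\|A\,\sigma_{kah}\,X\|\quad\text{for all }X\in\mathcal A^{++},$$ or $$\|A\,\sigma_{ch}\,X\|=\|A\,\sigma_{w}\,X\|\quad\text{for all }X\in\mathcal A^{++}.$$ Then $A$ is a central element of $\mathcal A$. (Conversely, if $A$ is central in $\mathcal A$, then both of these equalities hold for all $X\in\mathcal A^{++}$.)
   Context: $\mathcal A^{++}$ denotes the set of all positive invertible elements of the unital $C^*$-algebra $\mathcal A$. For $A,B\in\mathcal A^{++}$: the Kubo-Ando geometric mean is $A\# B=A^{1/2}(A^{-1/2}BA^{-1/2})^{1/2}A^{1/2}$; the conventional Heron mean is $A\,\sigma_{ch}\,B=\left(\frac{A^{1/2}+B^{1/2}}{2}\right)^2$; the Kubo-Ando Heron mean is $A\,\sigma_{kah}\,B=\frac14\bigl(A+B+2(A\# B)\bigr)$; the Wasserstein mean is $A\,\sigma_w\,B=\frac14\bigl(A+B+A(A^{-1}\# B)+(A^{-1}\# B)A\bigr)$. $\|\cdot\|$ is the $C^*$-norm. *)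

theory Defs
  imports "HOL-Analysis.Analysis"
begin

text \<open>
  Unital \<open>C\<^sup>*\<close>-algebras over the complex numbers. As usual, a unital algebra has
  \<open>\<parallel>1\<parallel> = 1\<close>, so the zero algebra is not an instance. The real vector space structure
  inherited from the library is the restriction of the complex one.
\<close>

class cstar_algebra = real_normed_algebra_1 + banach +
  fixes scaleC :: "complex \<Rightarrow> 'a \<Rightarrow> 'a"  (infixr "*\<^sub>C" 75)
    and star :: "'a \<Rightarrow> 'a"
  assumes scaleC_add_right: "c *\<^sub>C (x + y) = c *\<^sub>C x + c *\<^sub>C y"
    and scaleC_add_left: "(c + d) *\<^sub>C x = c *\<^sub>C x + d *\<^sub>C x"
    and scaleC_scaleC: "c *\<^sub>C d *\<^sub>C x = (c * d) *\<^sub>C x"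
    and scaleC_of_real: "complex_of_real r *\<^sub>C x = r *\<^sub>R x"
    and mult_scaleC_left: "(c *\<^sub>C x) * y = c *\<^sub>C (x * y)"
    and mult_scaleC_right: "x * (c *\<^sub>C y) = c *\<^sub>C (x * y)"
    and norm_scaleC: "norm (c *\<^sub>C x) = cmod c * norm x"
    and star_star: "star (star x) = x"
    and star_add: "star (x + y) = star x + star y"
    and star_scaleC: "star (c *\<^sub>C x) = cnj c *\<^sub>C star x"
    and star_mult: "star (x * y) = star y * star x"
    and norm_star_mult_self: "norm (star x * x) = (norm x)\<^sup>2"

definition alg_invertible :: "'a::cstar_algebra \<Rightarrow> bool"
  where "alg_invertible x \<longleftrightarrow> (\<exists>y. x * y = 1 \<and> y * x = 1)"

definition alg_inv :: "'a::cstar_algebra \<Rightarrow> 'a"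
  where "alg_inv x = (THE y. x * y = 1 \<and> y * x = 1)"

definition alg_spectrum :: "'a::cstar_algebra \<Rightarrow> complex set"
  where "alg_spectrum x = {c. \<not> alg_invertible (x - c *\<^sub>C 1)}"

definition cstar_positive :: "'a::cstar_algebra \<Rightarrow> bool"
  where "cstar_positive x \<longleftrightarrow> star x = x \<and> (\<forall>c \<in> alg_spectrum x. Im c = 0 \<and> 0 \<le> Re c)"

definition pos_inv :: "'a::cstar_algebra set"
  where "pos_inv = {x. cstar_positive x \<and> alg_invertible x}"

text \<open>\<open>x\<^sup>1\<^sup>/\<^sup>2\<close>, the unique positive square root; only meaningful for positive \<open>x\<close>.\<close>

definition pos_sqrt :: "'a::cstar_algebra \<Rightarrow> 'a"
  where "pos_sqrt x = (THE y. cstar_positive y \<and> y * y = x)"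

definition geo_mean :: "'a::cstar_algebra \<Rightarrow> 'a \<Rightarrow> 'a"
  where "geo_mean A B =
    pos_sqrt A * pos_sqrt (alg_inv (pos_sqrt A) * B * alg_inv (pos_sqrt A)) * pos_sqrt A"

definition conv_heron_mean :: "'a::cstar_algebra \<Rightarrow> 'a \<Rightarrow> 'a"
  where "conv_heron_mean A B = ((1/2) *\<^sub>R (pos_sqrt A + pos_sqrt B))\<^sup>2"

definition ka_heron_mean :: "'a::cstar_algebra \<Rightarrow> 'a \<Rightarrow> 'a"
  where "ka_heron_mean A B = (1/4) *\<^sub>R (A + B + 2 *\<^sub>R geo_mean A B)"

definition wasserstein_mean :: "'a::cstar_algebra \<Rightarrow> 'a \<Rightarrow> 'a"
  where "wasserstein_mean A B =
    (1/4) *\<^sub>R (A + B + A * geo_mean (alg_inv A) B + geo_mean (alg_inv A) B * A)"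

definition central :: "'a::cstar_algebra \<Rightarrow> bool"
  where "central x \<longleftrightarrow> (\<forall>y. x * y = y * x)"

end

theory Submission
  imports Defs "HOL-Computational_Algebra.Fundamental_Theorem_Algebra"
begin

text \<open>
  Put \<open>a = A\<^sup>1\<^sup>/\<^sup>2\<close>. Choosing \<open>X = g A\<^sup>-\<^sup>1 g\<close>, respectively \<open>X = g A g\<close>, makes \<open>g\<close> the geometric mean
  occurring in the Kubo-Ando Heron mean, respectively the Wasserstein mean, and the norm equalities become
  \<open>\<parallel>a + (g A\<^sup>-\<^sup>1 g)\<^sup>1\<^sup>/\<^sup>2\<parallel>\<^sup>2 = \<parallel>A + g A\<^sup>-\<^sup>1 g + 2 g\<parallel>\<close> and \<open>\<parallel>a + (g A g)\<^sup>1\<^sup>/\<^sup>2\<parallel>\<^sup>2 = \<parallel>A + g A g + A g + g A\<parallel>\<close>.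

  If \<open>a\<close> is not central, then there are \<open>l \<noteq> m\<close> in its spectrum and, for every tolerance, a unit
  element \<open>x = f(a) y g(a)\<close> with \<open>x\<^sup>2 = 0\<close>, \<open>a x \<approx> l x\<close> and \<open>x a \<approx> m x\<close>. A function \<open>e\<close> of \<open>x + x\<^sup>*\<close> peaking at
  \<open>1\<close> then behaves like the projection onto \<open>(1, 1)/\<surd>2\<close> in a matrix algebra where \<open>a = diag(l, m)\<close>:
  \<open>e F(a) e \<approx> (F(l) + F(m))/2 \<cdot> e\<^sup>2\<close>. For \<open>g = t e\<close> with \<open>t\<close> large the norm equalities force
  \<open>(l + m)/2 \<ge> ((l\<^sup>2 + m\<^sup>2)/2)\<^sup>1\<^sup>/\<^sup>2\<close> in the Wasserstein case and \<open>(l + m)/2 \<cdot> ((l\<^sup>-\<^sup>2 + m\<^sup>-\<^sup>2)/2)\<^sup>1\<^sup>/\<^sup>2 \<le> 1\<close> in the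
  Kubo-Ando case, and both contradict strict convexity.
\<close>

section \<open>Invertible elements and spectra of self-adjoint elements\<close>

text \<open>No Hilbert space representation is used, so neither vectors nor spectral projections are
  at hand. Continuous functions of self-adjoint elements replace both; the matrix picture then holds
  only up to an error, which is sent to zero at the very end with \<open>t\<close> fixed. As
  \<open>g\<close> has to be invertible, the peaking function keeps a small positive floor.

  A nonzero commutator does not by itself separate two spectral values. The separation comes from a
  converse estimate: if all \<open>f(a) y g(a)\<close> with supports at distance \<open>D\<close>
  vanished, \<open>a y - y a\<close> would have norm of order \<open>sqrt D\<close>.

  The size of \<open>t\<close> matters because, for large \<open>s\<close>, the norm of
  \<open>a + s e\<close> sees essentially only the compression \<open>e a e\<close>: the remaining
  parts of \<open>a\<close> are absorbed by \<open>s (1 - e)\<close>. The leading terms in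
  \<open>t\<close> agree on both sides of each norm equality, so the next order decides: the
  constant term after taking roots in the Wasserstein case, the linear term in the Kubo-Ando
  case.\<close>

lemma scaleC_zero_left [simp]: "0 *\<^sub>C (x::'a::cstar_algebra) = 0"
  by (metis of_real_0 scaleC_of_real scale_zero_left)

lemma scaleC_one [simp]: "1 *\<^sub>C (x::'a::cstar_algebra) = x"
  by (metis of_real_1 scaleC_of_real scaleR_one)

lemma scaleC_zero_right [simp]: "c *\<^sub>C (0::'a::cstar_algebra) = 0"
  by (metis add_cancel_right_right scaleC_add_right)

lemma scaleC_minus_right: "c *\<^sub>C (- x::'a::cstar_algebra) = - (c *\<^sub>C x)"
  by (metis add.right_inverse add_eq_0_iff scaleC_add_right scaleC_zero_right)

lemma scaleC_minus_left: "(- c) *\<^sub>C (x::'a::cstar_algebra) = - (c *\<^sub>C x)"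
  by (metis add.right_inverse add_eq_0_iff scaleC_add_left scaleC_zero_left)

lemma scaleC_diff_left: "(c - d) *\<^sub>C (x::'a::cstar_algebra) = c *\<^sub>C x - d *\<^sub>C x"
  by (metis diff_conv_add_uminus scaleC_add_left scaleC_minus_left)

lemma scaleC_diff_right: "c *\<^sub>C (x - y::'a::cstar_algebra) = c *\<^sub>C x - c *\<^sub>C y"
  by (metis diff_conv_add_uminus scaleC_add_right scaleC_minus_right)

lemma scaleC_power: "(c *\<^sub>C (x::'a::cstar_algebra)) ^ n = c ^ n *\<^sub>C x ^ n"
  by (induction n) (auto simp: mult_scaleC_left mult_scaleC_right scaleC_scaleC mult.commute)

lemma star_zero [simp]: "star (0::'a::cstar_algebra) = 0"
  by (metis add_cancel_right_right star_add)

lemma star_one [simp]: "star (1::'a::cstar_algebra) = 1"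
  by (metis mult_1 mult_1_right star_mult star_star)

lemma star_scaleR: "star (r *\<^sub>R (x::'a::cstar_algebra)) = r *\<^sub>R star x"
  by (metis complex_cnj_complex_of_real scaleC_of_real star_scaleC)

lemma star_minus: "star (- x::'a::cstar_algebra) = - star x"
  by (metis add.right_inverse add_eq_0_iff star_add star_zero)

lemma star_diff: "star (x - y::'a::cstar_algebra) = star x - star y"
  by (metis diff_conv_add_uminus star_add star_minus)

lemmas star_simps = star_add star_diff star_minus star_mult star_scaleR star_scaleC star_star

lemma star_power: "star ((x::'a::cstar_algebra) ^ n) = star x ^ n"
  by (induction n) (auto simp: star_mult power_commutes)

lemma norm_star [simp]: "norm (star (x::'a::cstar_algebra)) = norm x"
proof -
  have le: "norm y \<le> norm (star y)" for y :: 'a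
  proof (cases "y = 0")
    case False
    have "norm y * norm y \<le> norm (star y) * norm y"
      using norm_star_mult_self[of y] norm_mult_ineq[of "star y" y] by (simp add: power2_eq_square)
    then show ?thesis using False by simp
  qed auto
  show ?thesis using le[of x] le[of "star x"] by (simp add: star_star)
qed

lemma bounded_linear_star: "bounded_linear (star :: 'a::cstar_algebra \<Rightarrow> 'a)"
  by (rule bounded_linear_intro[where K = 1]) (auto simp: star_simps)

lemma norm_sa_square: "star x = x \<Longrightarrow> norm ((x::'a::cstar_algebra) * x) = (norm x)\<^sup>2"
  by (metis norm_star_mult_self)

text \<open>Exponents that are powers of two suffice wherever the spectral radius would usually
  enter: there the C*-identity iterates to an exact equality.\<close>

lemma norm_sa_power_two: "star x = x \<Longrightarrow> norm ((x::'a::cstar_algebra) ^ 2 ^ m) = norm x ^ 2 ^ m"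
proof (induction m)
  case (Suc m)
  have "star (x ^ 2 ^ m) = x ^ 2 ^ m" using Suc by (simp add: star_power)
  from norm_sa_square[OF this] show ?case
    using Suc by (simp add: power_mult power2_eq_square mult.commute[of 2])
qed auto

section \<open>Inverses and the Neumann series\<close>

lemma alg_invertibleI: "x * y = 1 \<Longrightarrow> y * x = 1 \<Longrightarrow> alg_invertible x"
  unfolding alg_invertible_def by blast

lemma alg_inv_unique: "x * y = 1 \<Longrightarrow> y * x = 1 \<Longrightarrow> alg_inv x = y"
  unfolding alg_inv_def by (rule the_equality) (auto, metis mult.assoc mult_1 mult_1_right)

lemma alg_inv: assumes "alg_invertible x"
  shows alg_inv_right: "x * alg_inv x = 1" and alg_inv_left: "alg_inv x * x = 1"
  using assms alg_inv_unique unfolding alg_invertible_def by metis+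

lemma alg_inv_cancel: assumes "alg_invertible x"
  shows "x * (alg_inv x * y) = y" "alg_inv x * (x * y) = y"
  using alg_inv[OF assms] by (simp_all flip: mult.assoc)

lemma alg_invertible_mult: "alg_invertible x \<Longrightarrow> alg_invertible y \<Longrightarrow> alg_invertible (x * y)"
  by (rule alg_invertibleI[of _ "alg_inv y * alg_inv x"])
    (simp_all add: mult.assoc alg_inv_cancel alg_inv)

lemma alg_invertible_alg_inv: "alg_invertible x \<Longrightarrow> alg_invertible (alg_inv x)"
  using alg_inv alg_invertibleI by blast

lemma alg_inv_alg_inv: "alg_invertible x \<Longrightarrow> alg_inv (alg_inv x) = x"
  using alg_inv alg_inv_unique by blast

lemma alg_invertible_one [simp]: "alg_invertible 1"
  by (rule alg_invertibleI[of _ 1]) auto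

lemma alg_invertible_scaleC: assumes "c \<noteq> 0" "alg_invertible x" shows "alg_invertible (c *\<^sub>C x)"
  by (rule alg_invertibleI[of _ "inverse c *\<^sub>C alg_inv x"])
    (use assms in \<open>simp_all add: mult_scaleC_left mult_scaleC_right scaleC_scaleC alg_inv\<close>)

lemma alg_invertible_scaleR: "r \<noteq> 0 \<Longrightarrow> alg_invertible x \<Longrightarrow> alg_invertible (r *\<^sub>R x)"
  using alg_invertible_scaleC[of "complex_of_real r" x] by (simp add: scaleC_of_real)

lemma alg_invertible_minus: "alg_invertible x \<Longrightarrow> alg_invertible (- x)"
  using alg_invertible_scaleR[of "-1" x] by simp

lemma star_alg_inv: "alg_invertible x \<Longrightarrow> star (alg_inv x) = alg_inv (star x)"
  by (rule alg_inv_unique[symmetric]) (simp_all add: alg_inv flip: star_mult)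

lemma alg_inv_mult:
  "alg_invertible x \<Longrightarrow> alg_invertible y \<Longrightarrow> alg_inv (x * y) = alg_inv y * alg_inv x"
  by (rule alg_inv_unique) (simp_all add: mult.assoc alg_inv_cancel alg_inv)

lemma alg_inv_commute: assumes "alg_invertible x" "x * y = y * x"
  shows "alg_inv x * y = y * alg_inv x"
proof -
  have "alg_inv x * y = alg_inv x * (y * x) * alg_inv x"
    using assms(1) by (simp add: alg_inv mult.assoc)
  also have "\<dots> = alg_inv x * (x * y) * alg_inv x" by (simp only: assms(2))
  also have "\<dots> = y * alg_inv x" using assms(1) by (simp add: mult.assoc alg_inv_cancel)
  finally show ?thesis .
qed

text \<open>A right inverse is immediate. Since the product commutes with \<open>x\<close>, so does
  its inverse \<open>?r\<close>, which makes the same element a left inverse.\<close>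

lemma alg_invertible_factor_left:
  assumes "x * y = y * x" "alg_invertible (x * y)" shows "alg_invertible x"
proof (rule alg_invertibleI)
  let ?r = "alg_inv (x * y)"
  show "x * (y * ?r) = 1" using alg_inv(1)[OF assms(2)] by (simp add: mult.assoc)
  have "?r * x = x * ?r"
    by (rule alg_inv_commute[OF assms(2)]) (metis assms(1) mult.assoc)
  then have "y * ?r * x = (y * x) * ?r" by (simp add: mult.assoc)
  then show "y * ?r * x = 1" using alg_inv(1)[OF assms(2)] assms(1) by simp
qed

lemma alg_invertible_one_minus:
  assumes "norm (x::'a::cstar_algebra) < 1" shows "alg_invertible (1 - x)"
proof -
  have s: "summable (\<lambda>n. x ^ n)" using assms by (rule complete_algebra_summable_geometric)
  have "(\<Sum>n. x ^ n) = (\<Sum>n. x ^ Suc n) + 1" using suminf_split_head[OF s] by simp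
  moreover have "(\<Sum>n. x ^ Suc n) = x * (\<Sum>n. x ^ n)" using suminf_mult[OF s, of x] by simp
  moreover have "(\<Sum>n. x ^ Suc n) = (\<Sum>n. x ^ n) * x"
    using suminf_mult2[OF s, of x] by (simp add: power_commutes)
  ultimately show ?thesis
    by (intro alg_invertibleI[of _ "\<Sum>n. x ^ n"]) (auto simp: algebra_simps)
qed

lemma alg_invertible_norm_less:
  assumes "norm (x::'a::cstar_algebra) < cmod c" shows "alg_invertible (x - c *\<^sub>C 1)"
proof -
  have c: "c \<noteq> 0" using assms by auto
  have "norm (inverse c *\<^sub>C x) < 1" using assms c
    by (simp add: norm_scaleC norm_inverse inverse_eq_divide norm_divide field_simps)
  then have "alg_invertible ((- c) *\<^sub>C (1 - inverse c *\<^sub>C x))"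
    using c by (intro alg_invertible_scaleC alg_invertible_one_minus) auto
  then show ?thesis using c by (simp add: scaleC_diff_right scaleC_scaleC scaleC_minus_left)
qed

section \<open>Location of the spectrum\<close>

lemma spectrum_norm: "c \<in> alg_spectrum (x::'a::cstar_algebra) \<Longrightarrow> cmod c \<le> norm x"
  using alg_invertible_norm_less[of x c] unfolding alg_spectrum_def by force

text \<open>Shifting by \<open>\<i>t\<close> for large \<open>t\<close> turns an imaginary part in the spectrum into a violation
  of \<open>spectrum_norm\<close>.\<close>

lemma sa_spectrum_real:
  assumes sa: "star x = (x::'a::cstar_algebra)" and c: "c \<in> alg_spectrum x"
  shows "Im c = 0"
proof (rule ccontr)
  assume nz: "Im c \<noteq> 0"
  define b where "b = Im c"
  have bound: "(b + t)\<^sup>2 \<le> (norm x)\<^sup>2 + t\<^sup>2" for t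
  proof -
    let ?d = "\<i> * complex_of_real t"
    define z where "z = x + ?d *\<^sub>C 1"
    have "c + ?d \<in> alg_spectrum z"
      using c unfolding alg_spectrum_def z_def by (simp add: scaleC_add_left)
    then have "cmod (c + ?d) \<le> norm z" by (rule spectrum_norm)
    moreover have "\<bar>Im (c + ?d)\<bar> \<le> cmod (c + ?d)" by (rule abs_Im_le_cmod)
    ultimately have "(b + t)\<^sup>2 \<le> (norm z)\<^sup>2"
      unfolding b_def by (metis Im_i_times Re_complex_of_real abs_ge_zero dual_order.trans
          plus_complex.sel(2) power2_abs power_mono)
    also have "(norm z)\<^sup>2 = norm (star z * z)" by (simp add: norm_star_mult_self)
    also have "star z * z = x * x + (t\<^sup>2) *\<^sub>R 1"
    proof -
      have "star z = x - ?d *\<^sub>C 1" unfolding z_def by (simp add: star_simps sa scaleC_minus_left)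
      then have "star z * z = (x - ?d *\<^sub>C 1) * (x + ?d *\<^sub>C 1)" by (simp add: z_def)
      also have "\<dots> = x * x + (x * (?d *\<^sub>C 1) - (?d *\<^sub>C 1) * x) - (?d *\<^sub>C 1) * (?d *\<^sub>C 1)"
        by (simp add: algebra_simps)
      also have "\<dots> = x * x - (?d * ?d) *\<^sub>C 1"
        by (simp only: mult_scaleC_left mult_scaleC_right scaleC_scaleC mult_1 mult_1_right) simp
      also have "?d * ?d = - complex_of_real (t\<^sup>2)" by (simp add: complex_eq_iff power2_eq_square)
      finally show ?thesis by (simp only: scaleC_minus_left scaleC_of_real) simp
    qed
    also have "norm \<dots> \<le> (norm x)\<^sup>2 + t\<^sup>2"
      using norm_triangle_ineq[of "x * x" "(t\<^sup>2) *\<^sub>R 1"] by (simp add: norm_sa_square sa)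
    finally show ?thesis .
  qed
  have "2 * b * t \<le> (norm x)\<^sup>2" for t
    using bound[of t] zero_le_power2[of b] unfolding power2_sum by linarith
  from this[of "((norm x)\<^sup>2 + 1) / (2 * b)"] show False using nz by (simp add: b_def)
qed

text \<open>Rickart's proof that the spectral radius of a self-adjoint element is its norm, restricted to
  powers of two: the resolvents \<open>(1 - (zh)^n)\<^sup>-\<^sup>1\<close> are averages of rotated resolvents \<open>(1 - zh)\<^sup>-\<^sup>1\<close>,
  so their modulus of continuity does not deteriorate as \<open>n\<close> grows.\<close>

lemma resolvent_continuous:
  fixes h :: "'a::cstar_algebra"
  assumes inv: "\<And>z. cmod z \<le> 1 \<Longrightarrow> alg_invertible (1 - z *\<^sub>C h)"
  shows "continuous_on (cball 0 1) (\<lambda>z. alg_inv (1 - z *\<^sub>C h))"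
proof -
  define G where "G = (\<lambda>z. alg_inv (1 - z *\<^sub>C h))"
  have res: "G z - G w = (z - w) *\<^sub>C (G z * h * G w)" if "cmod z \<le> 1" "cmod w \<le> 1" for z w
  proof -
    have "G z - G w = G z * ((1 - w *\<^sub>C h) - (1 - z *\<^sub>C h)) * G w"
      unfolding G_def right_diff_distrib[of "alg_inv _" "1 - _"] left_diff_distrib[of "alg_inv _ * (1 - _)"]
      using that by (simp only: alg_inv inv mult.assoc mult_1_right mult_1)
    then show ?thesis by (simp add: mult_scaleC_left mult_scaleC_right flip: scaleC_diff_left)
  qed
  have "(G \<longlongrightarrow> G w) (at w within cball 0 1)" if w: "cmod w \<le> 1" for w
  proof -
    define k where "k = norm h * norm (G w)"
    have k: "k \<ge> 0" unfolding k_def by simp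
    \<comment> \<open>No bound on \<open>norm (G z)\<close> is known beforehand. For
      \<open>z\<close> this close to \<open>w\<close> the resolvent identity absorbs it, giving
      \<open>norm (G z) \<le> 2 * norm (G w)\<close>.\<close>
    have est: "norm (G z - G w) \<le> cmod (z - w) * (2 * norm (G w) * k)"
      if z: "cmod z \<le> 1" and small: "cmod (z - w) * k \<le> 1/2" for z
    proof -
      have d: "norm (G z - G w) \<le> cmod (z - w) * (norm (G z) * k)"
        unfolding res[OF z w] norm_scaleC k_def
        by (intro mult_left_mono order_trans[OF norm_mult_ineq])
          (auto simp: mult.assoc[symmetric] intro!: mult_right_mono norm_mult_ineq)
      also have "\<dots> \<le> norm (G z) * (1/2)"
        using mult_left_mono[OF small norm_ge_zero[of "G z"]] by (simp add: mult_ac)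
      finally have "norm (G z) \<le> 2 * norm (G w)"
        using norm_triangle_ineq2[of "G z" "G w"] by linarith
      then show ?thesis using d k
        by (meson mult_left_mono mult_right_mono norm_ge_zero order_trans)
    qed
    have ev: "eventually (\<lambda>z. cmod z \<le> 1 \<and> cmod (z - w) * k \<le> 1/2) (at w within cball 0 1)"
    proof -
      have "((\<lambda>z. cmod (z - w) * k) \<longlongrightarrow> cmod (w - w) * k) (at w within cball 0 1)"
        by (intro tendsto_intros)
      then have "eventually (\<lambda>z. cmod (z - w) * k < 1/2) (at w within cball 0 1)"
        by (rule order_tendstoD) auto
      moreover have "eventually (\<lambda>z. z \<in> cball 0 1) (at w within cball 0 1)"
        by (simp add: eventually_at_filter)
      ultimately show ?thesis by eventually_elim auto
    qed
    have lim: "((\<lambda>z. cmod (z - w) * (2 * norm (G w) * k)) \<longlongrightarrow> cmod (w - w) * (2 * norm (G w) * k))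
        (at w within cball 0 1)"
      by (intro tendsto_intros)
    have "eventually (\<lambda>z. norm (G z - G w) \<le> cmod (z - w) * (2 * norm (G w) * k))
        (at w within cball 0 1)"
      using ev by eventually_elim (use est in blast)
    from Lim_null_comparison[OF this] lim
    have "((\<lambda>z. G z - G w) \<longlongrightarrow> 0) (at w within cball 0 1)" by simp
    then show ?thesis by (rule LIM_zero_cancel)
  qed
  then show ?thesis by (simp add: continuous_on_def G_def)
qed

text \<open>Doubles the exponent in the averaging argument: for \<open>u = (z h) ^ 2 ^ m\<close> the
  second resolvent is the first one at a rotated point, so averaging preserves any bound on
  differences.\<close>

lemma alg_inv_one_minus_square:
  fixes u :: "'a::cstar_algebra"
  assumes "alg_invertible (1 - u)" "alg_invertible (1 + u)"
  shows "alg_invertible (1 - u * u)"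
    and "alg_inv (1 - u * u) = (1/2) *\<^sub>R (alg_inv (1 - u) + alg_inv (1 + u))"
proof -
  have f: "1 - u * u = (1 - u) * (1 + u)" by (simp add: algebra_simps)
  show "alg_invertible (1 - u * u)" unfolding f using assms by (rule alg_invertible_mult)
  let ?p = "alg_inv (1 - u)" and ?q = "alg_inv (1 + u)"
  have "(1 - u) + (1 + u) = 2 *\<^sub>R 1" by (simp add: scaleR_2)
  then have "?q * ((1 - u) + (1 + u)) * ?p = 2 *\<^sub>R (?q * ?p)"
    by (simp only: mult_scaleR_right mult_scaleR_left mult_1_right)
  then have "?q * ?p = (1/2) *\<^sub>R (?q * ((1 - u) + (1 + u)) * ?p)"
    by (simp only: scaleR_scaleR) simp
  also have "?q * ((1 - u) + (1 + u)) * ?p = ?q * ((1 - u) * ?p) + (?q * (1 + u)) * ?p"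
    by (simp only: distrib_left distrib_right mult.assoc)
  also have "\<dots> = ?p + ?q"
    by (simp only: alg_inv assms mult_1 mult_1_right add.commute)
  finally show "alg_inv (1 - u * u) = (1/2) *\<^sub>R (?p + ?q)"
    by (simp only: f alg_inv_mult[OF assms])
qed

text \<open>All powers \<open>h ^ 2 ^ m\<close> have norm one, whereas those of \<open>s h\<close>
  with \<open>s < 1\<close> tend to zero. The common modulus of continuity keeps the two resolvents
  close; the second is near \<open>1\<close>, hence so is the first, which would force
  \<open>h ^ 2 ^ m\<close> to be small.\<close>

lemma unit_disc_not_in_resolvent_set:
  fixes h :: "'a::cstar_algebra"
  assumes sa: "star h = h" and n1: "norm h = 1"
    and inv: "\<And>z. cmod z \<le> 1 \<Longrightarrow> alg_invertible (1 - z *\<^sub>C h)"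
  shows False
proof -
  have "uniformly_continuous_on (cball 0 1) (\<lambda>z. alg_inv (1 - z *\<^sub>C h))"
    using compact_uniformly_continuous[OF resolvent_continuous[OF inv] compact_cball] by simp
  \<comment> \<open>The tolerance \<open>1/10\<close> leaves room: at the end
    \<open>alg_inv (1 - v) - 1\<close> has norm at most \<open>1/10 + 1/9\<close>, and twice this
    must stay below \<open>1\<close>.\<close>
  then obtain d where d: "d > 0" and
    uc: "\<And>z w. z \<in> cball 0 1 \<Longrightarrow> w \<in> cball 0 1 \<Longrightarrow> dist w z < d \<Longrightarrow>
           dist (alg_inv (1 - w *\<^sub>C h)) (alg_inv (1 - z *\<^sub>C h)) < 1/10"
    by (rule uniformly_continuous_onE[of _ _ "1/10"]) auto
  define s where "s = max 0 (1 - d/2)"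
  have s: "0 \<le> s" "s < 1" "1 - s < d" using d unfolding s_def by auto
  define F where "F = (\<lambda>(m::nat) z. alg_inv (1 - (z *\<^sub>C h) ^ 2 ^ m))"
  have P: "\<forall>z::complex. cmod z \<le> 1 \<longrightarrow> alg_invertible (1 - (z *\<^sub>C h) ^ 2 ^ m) \<and>
     norm (F m z - F m (s * z)) \<le> 1/10" for m
  proof (induction m)
    case 0
    have "norm (F 0 z - F 0 (s * z)) \<le> 1/10" if z: "cmod z \<le> 1" for z :: complex
    proof -
      have sz: "cmod (s * z) \<le> 1" using s z by (simp add: norm_mult mult_le_one)
      have "s * z - z = complex_of_real (s - 1) * z" by (simp add: left_diff_distrib)
      then have "dist (s * z) z = \<bar>s - 1\<bar> * cmod z"
        unfolding dist_norm by (simp only: norm_mult norm_of_real)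
      also have "\<dots> \<le> (1 - s) * 1" using s z by (intro mult_mono) auto
      also have "\<dots> < d" using s by simp
      finally have "dist (s * z) z < d" .
      then show ?thesis
        using uc[of z "s * z"] z sz by (simp add: F_def dist_norm norm_minus_commute)
    qed
    then show ?case using inv by simp
  next
    case (Suc m)
    \<comment> \<open>Since \<open>\<zeta> ^ 2 ^ m = -1\<close>, rotating \<open>z\<close> by
      \<open>\<zeta>\<close> turns \<open>1 - u\<close> into \<open>1 + u\<close>, so the induction
      hypothesis covers both factors of \<open>1 - u * u\<close>.\<close>
    define \<zeta> where "\<zeta> = cis (pi / 2 ^ m)"
    have "\<zeta> ^ 2 ^ m = cis (real (2 ^ m) * (pi / 2 ^ m))" unfolding \<zeta>_def by (rule Complex.DeMoivre)
    then have "\<zeta> ^ 2 ^ m = -1" by simp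
    then have rot: "((\<zeta> * z) *\<^sub>C h) ^ 2 ^ m = - ((z *\<^sub>C h) ^ 2 ^ m)" for z
      by (simp add: scaleC_power power_mult_distrib scaleC_minus_left)
    have nz: "cmod (\<zeta> * z) = cmod z" for z by (simp add: norm_mult \<zeta>_def)
    have sq: "u ^ 2 ^ Suc m = u ^ 2 ^ m * u ^ 2 ^ m" for u :: 'a
      by (simp add: power_mult mult.commute[of 2] power2_eq_square)
    have iv: "alg_invertible (1 - (z *\<^sub>C h) ^ 2 ^ m)" "alg_invertible (1 + (z *\<^sub>C h) ^ 2 ^ m)"
      if "cmod z \<le> 1" for z
    proof -
      show i: "alg_invertible (1 - (z *\<^sub>C h) ^ 2 ^ m)" using Suc that by simp
      have "alg_invertible (1 - ((\<zeta> * z) *\<^sub>C h) ^ 2 ^ m)" using Suc that nz[of z] by simp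
      then show "alg_invertible (1 + (z *\<^sub>C h) ^ 2 ^ m)" unfolding rot by simp
    qed
    have inv': "alg_invertible (1 - (z *\<^sub>C h) ^ 2 ^ Suc m)" if "cmod z \<le> 1" for z
      unfolding sq by (rule alg_inv_one_minus_square(1)[OF iv[OF that]])
    have avg: "F (Suc m) z = (1/2) *\<^sub>R (F m z + F m (\<zeta> * z))" if "cmod z \<le> 1" for z
      unfolding F_def sq rot diff_minus_eq_add by (rule alg_inv_one_minus_square(2)[OF iv[OF that]])
    have "norm (F (Suc m) z - F (Suc m) (s * z)) \<le> 1/10" if z: "cmod z \<le> 1" for z :: complex
    proof -
      have sz: "cmod (s * z) \<le> 1" using s z by (simp add: norm_mult mult_le_one)
      have 1: "norm (F m z - F m (s * z)) \<le> 1/10" using Suc z by blast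
      have 2: "norm (F m (\<zeta> * z) - F m (\<zeta> * (s * z))) \<le> 1/10"
        using Suc z nz[of z] by (metis mult.left_commute)
      have "F (Suc m) z - F (Suc m) (s * z)
          = (1/2) *\<^sub>R ((F m z - F m (s * z)) + (F m (\<zeta> * z) - F m (\<zeta> * (s * z))))"
        unfolding avg[OF z] avg[OF sz] by (simp add: algebra_simps)
      also have "norm \<dots> \<le> (1/2) * (1/10 + 1/10)"
        using norm_triangle_ineq[of "F m z - F m (s * z)" "F m (\<zeta> * z) - F m (\<zeta> * (s * z))"] 1 2
        by simp
      finally show ?thesis by simp
    qed
    then show ?case using inv' by blast
  qed
  obtain m0 where "s ^ m0 < 1/10" using s real_arch_pow_inv[of "1/10" s] by auto
  moreover have "s ^ 2 ^ m0 \<le> s ^ m0" using s by (intro power_decreasing) (auto intro: less_imp_le)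
  ultimately have sm: "s ^ 2 ^ m0 < 1/10" by linarith
  define v where "v = h ^ 2 ^ m0"
  define w where "w = s ^ 2 ^ m0 *\<^sub>R v"
  have v: "norm v = 1" unfolding v_def using norm_sa_power_two[OF sa] n1 by simp
  have w: "norm w \<le> 1/10" unfolding w_def using v sm s by simp
  have wv: "(complex_of_real s *\<^sub>C h) ^ 2 ^ m0 = w"
    unfolding w_def v_def scaleC_power by (simp flip: scaleC_of_real)
  have iv: "alg_invertible (1 - v)" and d1: "norm (alg_inv (1 - v) - alg_inv (1 - w)) \<le> 1/10"
    using P[of m0, rule_format, of 1] wv unfolding v_def F_def by auto
  have iw: "alg_invertible (1 - w)" using w by (intro alg_invertible_one_minus) auto
  define R where "R = alg_inv (1 - w)"
  have "R * (1 - w) = 1" unfolding R_def by (rule alg_inv[OF iw])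
  then have Rw: "R - 1 = R * w" by (simp add: algebra_simps)
  then have a: "norm (R - 1) \<le> norm R * (1/10)"
    by (metis norm_mult_ineq mult_left_mono[OF w norm_ge_zero] order_trans)
  moreover have "norm R \<le> norm (R - 1) + 1" using norm_triangle_ineq[of "R - 1" 1] by simp
  ultimately have "norm (R - 1) \<le> 1/9" by linarith
  then have b: "norm (alg_inv (1 - v) - 1) \<le> 1/10 + 1/9"
    using norm_triangle_ineq[of "alg_inv (1 - v) - R" "R - 1"] d1 unfolding R_def by simp
  have "(alg_inv (1 - v) - 1) * (1 - v) = v" by (simp add: left_diff_distrib alg_inv[OF iv])
  then have "1 \<le> norm (alg_inv (1 - v) - 1) * norm (1 - v)" using v norm_mult_ineq by metis
  also have "\<dots> \<le> (1/10 + 1/9) * 2"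
    using b norm_triangle_ineq4[of 1 v] v by (intro mult_mono) auto
  finally show False by simp
qed

text \<open>After scaling to norm one, invertibility of \<open>1 - z k\<close> concerns the point
  \<open>c = r / z\<close>, whose modulus is at least \<open>r\<close>. A spectral point of that
  modulus is real, hence \<open>r\<close> or \<open>- r\<close>; if both were missing, the whole
  closed unit disc would be regular.\<close>

lemma sa_norm_in_spectrum:
  fixes h :: "'a::cstar_algebra"
  assumes sa: "star h = h"
  shows "complex_of_real (norm h) \<in> alg_spectrum h \<or> complex_of_real (- norm h) \<in> alg_spectrum h"
proof (cases "h = 0")
  case True
  then show ?thesis unfolding alg_spectrum_def alg_invertible_def by auto
next
  case False
  define r where "r = norm h"
  have r: "r > 0" using False r_def by simp
  show ?thesis
  proof (rule ccontr)
    assume neg: "\<not> ?thesis"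
    define k where "k = inverse r *\<^sub>R h"
    have k: "star k = k" "norm k = 1" using r sa unfolding k_def r_def by (simp_all add: star_simps)
    have "alg_invertible (1 - z *\<^sub>C k)" if z: "cmod z \<le> 1" for z
    proof (cases "z = 0")
      case z0: False
      define c where "c = complex_of_real r / z"
      have c0: "c \<noteq> 0" using r z0 unfolding c_def by simp
      have cr: "cmod c \<ge> r" using z z0 r unfolding c_def by (simp add: norm_divide field_simps)
      have "alg_invertible (h - c *\<^sub>C 1)"
      proof (rule ccontr)
        assume ni: "\<not> alg_invertible (h - c *\<^sub>C 1)"
        then have cs: "c \<in> alg_spectrum h" unfolding alg_spectrum_def by simp
        then have "Im c = 0" using sa_spectrum_real[OF sa] by simp
        then have c: "c = complex_of_real (Re c)" by (simp add: complex_eq_iff)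
        have "cmod c = r" using spectrum_norm[OF cs] cr r_def by simp
        then have "Re c = r \<or> Re c = - r" by (metis abs_eq_iff' c norm_of_real)
        then show False using neg cs c r_def by metis
      qed
      then have "alg_invertible ((- (1 / c)) *\<^sub>C (h - c *\<^sub>C 1))"
        using c0 by (intro alg_invertible_scaleC) auto
      moreover have "(- (1 / c)) *\<^sub>C (h - c *\<^sub>C 1) = 1 - z *\<^sub>C k"
      proof -
        have "(1 / c) * c = 1" "1 / c = z * complex_of_real (inverse r)"
          using c0 z0 r unfolding c_def by (simp_all add: field_simps)
        then show ?thesis unfolding k_def
          by (simp add: scaleC_diff_right scaleC_scaleC scaleC_minus_left flip: scaleC_of_real)
      qed
      ultimately show ?thesis by simp
    qed auto
    from unit_disc_not_in_resolvent_set[OF k this] show False by simp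
  qed
qed

section \<open>Continuous functional calculus\<close>

text \<open>Horner evaluation, so that induction over \<open>pCons\<close> yields the algebra of
  polynomials. The complex version serves only to split off roots; the calculus itself is built on
  \<open>rpoly_at\<close>.\<close>

definition cpoly_at :: "complex poly \<Rightarrow> 'a::cstar_algebra \<Rightarrow> 'a"
  where "cpoly_at p a = fold_coeffs (\<lambda>c v. c *\<^sub>C 1 + a * v) p 0"

definition rpoly_at :: "real poly \<Rightarrow> 'a::cstar_algebra \<Rightarrow> 'a"
  where "rpoly_at p a = fold_coeffs (\<lambda>c v. c *\<^sub>R 1 + a * v) p 0"

definition rspec :: "'a::cstar_algebra \<Rightarrow> real set"
  where "rspec a = {t. complex_of_real t \<in> alg_spectrum a}"

lemma cpoly_at_0 [simp]: "cpoly_at 0 a = 0" by (simp add: cpoly_at_def)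
lemma rpoly_at_0 [simp]: "rpoly_at 0 a = 0" by (simp add: rpoly_at_def)

lemma cpoly_at_pCons [simp]: "cpoly_at (pCons c p) a = c *\<^sub>C 1 + a * cpoly_at p a"
  by (cases "p = 0 \<and> c = 0") (auto simp: cpoly_at_def)

lemma rpoly_at_pCons [simp]: "rpoly_at (pCons c p) a = c *\<^sub>R 1 + a * rpoly_at p a"
  by (cases "p = 0 \<and> c = 0") (auto simp: rpoly_at_def)

lemma cpoly_at_add: "cpoly_at (p + q) a = cpoly_at p a + cpoly_at q a"
  by (induction p q rule: poly_induct2) (auto simp: algebra_simps scaleC_add_left)

lemma cpoly_at_smult: "cpoly_at (smult c p) a = c *\<^sub>C cpoly_at p a"
  by (induction p) (auto simp: scaleC_add_right scaleC_scaleC mult_scaleC_right)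

lemma rpoly_at_add: "rpoly_at (p + q) a = rpoly_at p a + rpoly_at q a"
  by (induction p q rule: poly_induct2) (auto simp: algebra_simps)

lemma rpoly_at_smult: "rpoly_at (smult c p) a = c *\<^sub>R rpoly_at p a"
  by (induction p) (auto simp: algebra_simps)

lemma rpoly_at_diff: "rpoly_at (p - q) a = rpoly_at p a - rpoly_at q a"
  using rpoly_at_add[of p "smult (-1) q" a] rpoly_at_smult[of "-1" q a] by simp

lemma rpoly_at_mult: "rpoly_at (p * q) a = rpoly_at p a * rpoly_at q a"
  by (induction p) (auto simp: algebra_simps rpoly_at_add rpoly_at_smult)

lemma rpoly_at_pcompose: "rpoly_at (pcompose p q) a = rpoly_at p (rpoly_at q a)"
  by (induction p) (auto simp: pcompose_pCons rpoly_at_add rpoly_at_mult)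

lemma rpoly_at_commute: assumes "y * a = a * y" shows "y * rpoly_at p a = rpoly_at p a * y"
proof (induction p)
  case (pCons c p)
  have "y * (a * rpoly_at p a) = a * (y * rpoly_at p a)" by (metis assms mult.assoc)
  then show ?case using pCons by (simp add: algebra_simps)
qed auto

lemma rpoly_at_self_adjoint:
  assumes "star a = a" shows "star (rpoly_at p a) = rpoly_at p a"
proof (induction p)
  case (pCons c p)
  then show ?case using assms rpoly_at_commute[of a a p] by (simp add: star_simps)
qed auto

lemma cpoly_at_of_real: "cpoly_at (map_poly complex_of_real p) a = rpoly_at p a"
  by (induction p) (auto simp: map_poly_pCons scaleC_of_real)

lemma poly_of_real: "poly (map_poly complex_of_real p) (complex_of_real t) = complex_of_real (poly p t)"
  by (induction p) (auto simp: map_poly_pCons)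

text \<open>One half of the spectral mapping theorem: the polynomial splits into linear factors
  whose roots all lie outside the spectrum, so every factor is invertible.\<close>

lemma cpoly_at_invertible:
  assumes "p \<noteq> 0" "\<And>c. c \<in> alg_spectrum a \<Longrightarrow> poly p c \<noteq> 0"
  shows "alg_invertible (cpoly_at p a)"
  using assms
proof (induction "degree p" arbitrary: p)
  case 0
  then obtain c where "p = [:c:]" using degree_eq_zeroE by metis
  then show ?case using 0 by (auto intro!: alg_invertible_scaleC)
next
  case (Suc n)
  have "\<not> constant (poly p)" using Suc.hyps(2) by (simp add: constant_degree)
  then obtain r where r: "poly p r = 0" using fundamental_theorem_of_algebra by blast
  then obtain q where q: "p = [:- r, 1:] * q" using poly_eq_0_iff_dvd dvdE by metis
  have q0: "q \<noteq> 0" using q Suc.prems(1) by auto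
  have "degree p = Suc (degree q)" using q0 unfolding q by (simp add: degree_mult_eq del: mult_pCons_left)
  then have iq: "alg_invertible (cpoly_at q a)"
    using Suc q q0 by (intro Suc.hyps(1)) auto
  have "r \<notin> alg_spectrum a" using Suc.prems(2) r by blast
  then have ir: "alg_invertible (a - r *\<^sub>C 1)" unfolding alg_spectrum_def by simp
  have "p = smult (- r) q + pCons 0 q" using q by simp
  then have "cpoly_at p a = (a - r *\<^sub>C 1) * cpoly_at q a"
    by (simp only: cpoly_at_add cpoly_at_smult cpoly_at_pCons left_diff_distrib mult_scaleC_left
        scaleC_minus_left) simp
  then show ?case using ir iq by (simp add: alg_invertible_mult)
qed

lemma rspec_norm: "t \<in> rspec a \<Longrightarrow> \<bar>t\<bar> \<le> norm a"
  using spectrum_norm[of "complex_of_real t" a] by (simp add: rspec_def)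

lemma rspec_nonempty: "star a = a \<Longrightarrow> norm a \<in> rspec a \<or> - norm a \<in> rspec a"
  using sa_norm_in_spectrum[of a] by (simp add: rspec_def)

lemma sa_spectrum_rspec:
  assumes "star a = a" "c \<in> alg_spectrum a" obtains t where "c = complex_of_real t" "t \<in> rspec a"
proof
  show *: "c = complex_of_real (Re c)" using sa_spectrum_real[OF assms] by (simp add: complex_eq_iff)
  show "Re c \<in> rspec a" unfolding rspec_def using assms(2) * by simp
qed

text \<open>The norm of the self-adjoint \<open>p(a)\<close> is the modulus of one of its spectral
  values \<open>c\<close>. If it exceeded \<open>B\<close>, then \<open>p - c\<close> would have no
  zero on the spectrum of \<open>a\<close>, and \<open>p(a) - c\<close> would be invertible.\<close>

lemma rpoly_at_norm_le:
  fixes a :: "'a::cstar_algebra"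
  assumes sa: "star a = a" and B: "\<And>t. t \<in> rspec a \<Longrightarrow> \<bar>poly p t\<bar> \<le> B"
  shows "norm (rpoly_at p a) \<le> B"
proof (rule ccontr)
  assume gt: "\<not> norm (rpoly_at p a) \<le> B"
  obtain c where c: "c \<in> rspec (rpoly_at p a)" "\<bar>c\<bar> = norm (rpoly_at p a)"
    using rspec_nonempty[OF rpoly_at_self_adjoint[OF sa, of p]] by force
  define q where "q = p - [:c:]"
  have q: "poly q t \<noteq> 0" if "t \<in> rspec a" for t using B[OF that] c gt unfolding q_def by auto
  have "q \<noteq> 0" using q rspec_nonempty[OF sa] by auto
  then have "map_poly complex_of_real q \<noteq> 0" by (simp add: map_poly_eq_0_iff)
  moreover have "poly (map_poly complex_of_real q) d \<noteq> 0" if "d \<in> alg_spectrum a" for d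
    using sa_spectrum_rspec[OF sa that] q by (metis of_real_eq_0_iff poly_of_real)
  ultimately have "alg_invertible (cpoly_at (map_poly complex_of_real q) a)"
    by (rule cpoly_at_invertible)
  then have "alg_invertible (rpoly_at p a - c *\<^sub>R 1)"
    unfolding cpoly_at_of_real q_def by (simp add: rpoly_at_diff)
  then show False using c(1) by (simp add: rspec_def alg_spectrum_def scaleC_of_real)
qed

text \<open>The other half of spectral mapping: \<open>a - t\<close> is a factor of
  \<open>p(a) - p(t)\<close> that commutes with its cofactor, so invertibility of the product would
  pass to \<open>a - t\<close>.\<close>

lemma rpoly_at_norm_ge:
  fixes a :: "'a::cstar_algebra"
  assumes t: "t \<in> rspec a" shows "\<bar>poly p t\<bar> \<le> norm (rpoly_at p a)"
proof -
  define c where "c = poly p t"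
  have "poly (p - [:c:]) t = 0" by (simp add: c_def)
  then obtain q where q: "p - [:c:] = [:- t, 1:] * q" using poly_eq_0_iff_dvd dvdE by metis
  have "rpoly_at p a - c *\<^sub>R 1 = rpoly_at (p - [:c:]) a" by (simp add: rpoly_at_diff)
  also have "\<dots> = (a - t *\<^sub>R 1) * rpoly_at q a"
    unfolding q rpoly_at_mult by simp
  finally have f: "rpoly_at p a - c *\<^sub>R 1 = (a - t *\<^sub>R 1) * rpoly_at q a" .
  have "(a - t *\<^sub>R 1) * a = a * (a - t *\<^sub>R 1)" by (simp add: algebra_simps)
  then have "(a - t *\<^sub>R 1) * rpoly_at q a = rpoly_at q a * (a - t *\<^sub>R 1)" by (rule rpoly_at_commute)
  then have "\<not> alg_invertible (rpoly_at p a - c *\<^sub>R 1)"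
    using t alg_invertible_factor_left unfolding f
    by (fastforce simp: rspec_def alg_spectrum_def scaleC_of_real)
  then have "c \<in> rspec (rpoly_at p a)" by (simp add: rspec_def alg_spectrum_def scaleC_of_real)
  then show ?thesis unfolding c_def by (rule rspec_norm)
qed

text \<open>The continuous functional calculus of a self-adjoint element, for functions continuous on the
  whole line; only their values on the spectrum matter.\<close>

definition cfc :: "'a::cstar_algebra \<Rightarrow> (real \<Rightarrow> real) \<Rightarrow> 'a"
  where "cfc a f = (THE v. \<exists>p. uniform_limit (rspec a) (\<lambda>n. poly (p n)) f sequentially
                              \<and> (\<lambda>n::nat. rpoly_at (p n) a) \<longlonglongrightarrow> v)"

lemma uniform_limit_real_poly:
  fixes f :: "real \<Rightarrow> real"
  assumes "continuous_on UNIV f"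
  obtains p where "uniform_limit {-R..R} (\<lambda>n::nat. poly (p n)) f sequentially"
proof -
  have "\<exists>p. \<forall>t\<in>{-R..R}. \<bar>f t - poly p t\<bar> < inverse (real (Suc n))" for n
  proof -
    have "continuous_on {-R..R} f" using assms continuous_on_subset by blast
    from Stone_Weierstrass_real_polynomial_function[OF compact_Icc this]
    obtain g where g: "real_polynomial_function g" "\<And>x. x \<in> {-R..R} \<Longrightarrow> \<bar>f x - g x\<bar> < inverse (real (Suc n))"
      by (metis of_nat_0_less_iff positive_imp_inverse_positive zero_less_Suc)
    then obtain c m where "g = (\<lambda>x. \<Sum>i\<le>m. c i * x ^ i)"
      using real_polynomial_function_iff_sum by auto
    then have "g = poly (\<Sum>i\<le>m. monom (c i) i)" by (auto simp: poly_sum poly_monom)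
    then show ?thesis using g by blast
  qed
  then obtain p where p: "\<And>n t. t \<in> {-R..R} \<Longrightarrow> \<bar>f t - poly (p n) t\<bar> < inverse (real (Suc n))"
    by metis
  have "uniform_limit {-R..R} (\<lambda>n::nat. poly (p n)) f sequentially"
  proof (rule uniform_limitI)
    fix e :: real assume "e > 0"
    then have "eventually (\<lambda>n. inverse (real (Suc n)) < e) sequentially"
      by (intro order_tendstoD(2)[OF LIMSEQ_inverse_real_of_nat])
    then show "\<forall>\<^sub>F n in sequentially. \<forall>x\<in>{-R..R}. dist (poly (p n) x) (f x) < e"
    proof eventually_elim
      case (elim n)
      show ?case
      proof
        fix x assume "x \<in> {-R..R}"
        from p[OF this, of n] elim show "dist (poly (p n) x) (f x) < e"
          unfolding dist_real_def abs_minus_commute[of "poly _ _"] by linarith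
      qed
    qed
  qed
  then show ?thesis by (rule that)
qed

text \<open>Makes the definite description in \<open>cfc\<close> independent of the approximating
  sequence.\<close>

lemma rpoly_at_limit_unique:
  fixes a :: "'a::cstar_algebra"
  assumes sa: "star a = a"
    and p: "uniform_limit (rspec a) (\<lambda>n::nat. poly (p n)) f sequentially"
    and q: "uniform_limit (rspec a) (\<lambda>n::nat. poly (q n)) f sequentially"
  shows "(\<lambda>n. rpoly_at (p n) a - rpoly_at (q n) a) \<longlonglongrightarrow> 0"
proof (rule tendstoI)
  fix e :: real assume e: "e > 0"
  from uniform_limitD[OF p, of "e/4"] uniform_limitD[OF q, of "e/4"] e
  have "\<forall>\<^sub>F n in sequentially. (\<forall>x\<in>rspec a. dist (poly (p n) x) (f x) < e/4)
      \<and> (\<forall>x\<in>rspec a. dist (poly (q n) x) (f x) < e/4)" by (simp add: eventually_conj)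
  then show "\<forall>\<^sub>F n in sequentially. dist (rpoly_at (p n) a - rpoly_at (q n) a) 0 < e"
  proof eventually_elim
    case (elim n)
    have "norm (rpoly_at (p n - q n) a) \<le> e/2"
    proof (rule rpoly_at_norm_le[OF sa])
      fix t assume "t \<in> rspec a"
      then have "dist (poly (p n) t) (f t) < e/4" "dist (poly (q n) t) (f t) < e/4" using elim by auto
      then show "\<bar>poly (p n - q n) t\<bar> \<le> e/2" unfolding dist_real_def poly_diff by linarith
    qed
    then show ?case using e by (simp add: rpoly_at_diff)
  qed
qed

lemma rpoly_at_convergent:
  fixes a :: "'a::cstar_algebra"
  assumes sa: "star a = a"
    and p: "uniform_limit (rspec a) (\<lambda>n::nat. poly (p n)) f sequentially"
  shows "convergent (\<lambda>n. rpoly_at (p n) a)"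
proof -
  have "Cauchy (\<lambda>n. rpoly_at (p n) a)"
  proof (rule CauchyI)
    fix e :: real assume e: "e > 0"
    from uniform_limitD[OF p, of "e/4"] e obtain N where
      N: "\<And>n t. n \<ge> N \<Longrightarrow> t \<in> rspec a \<Longrightarrow> dist (poly (p n) t) (f t) < e/4"
      unfolding eventually_sequentially by auto
    have "norm (rpoly_at (p m) a - rpoly_at (p n) a) < e" if mn: "m \<ge> N" "n \<ge> N" for m n
    proof -
      have "norm (rpoly_at (p m - p n) a) \<le> e/2"
      proof (rule rpoly_at_norm_le[OF sa])
        fix t assume "t \<in> rspec a"
        then have "dist (poly (p m) t) (f t) < e/4" "dist (poly (p n) t) (f t) < e/4" using N mn by auto
        then show "\<bar>poly (p m - p n) t\<bar> \<le> e/2" unfolding dist_real_def poly_diff by linarith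
      qed
      then show ?thesis using e by (simp add: rpoly_at_diff)
    qed
    then show "\<exists>M. \<forall>m\<ge>M. \<forall>n\<ge>M. norm (rpoly_at (p m) a - rpoly_at (p n) a) < e" by blast
  qed
  then show ?thesis by (simp add: Cauchy_convergent_iff)
qed

lemma cfc_eqI:
  fixes a :: "'a::cstar_algebra"
  assumes sa: "star a = a"
    and p: "uniform_limit (rspec a) (\<lambda>n::nat. poly (p n)) f sequentially"
    and v: "(\<lambda>n. rpoly_at (p n) a) \<longlonglongrightarrow> v"
  shows "cfc a f = v"
  unfolding cfc_def
proof (rule the_equality)
  show "\<exists>p. uniform_limit (rspec a) (\<lambda>n. poly (p n)) f sequentially \<and> (\<lambda>n. rpoly_at (p n) a) \<longlonglongrightarrow> v"
    using p v by blast
  fix w assume "\<exists>p. uniform_limit (rspec a) (\<lambda>n. poly (p n)) f sequentially \<and> (\<lambda>n. rpoly_at (p n) a) \<longlonglongrightarrow> w"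
  then obtain q where q: "uniform_limit (rspec a) (\<lambda>n::nat. poly (q n)) f sequentially"
    "(\<lambda>n. rpoly_at (q n) a) \<longlonglongrightarrow> w" by blast
  have "(\<lambda>n. rpoly_at (q n) a - rpoly_at (p n) a) \<longlonglongrightarrow> w - v"
    by (intro tendsto_diff q v)
  from LIMSEQ_unique[OF this rpoly_at_limit_unique[OF sa q(1) p]] show "w = v" by simp
qed

lemma cfc_tendsto:
  fixes a :: "'a::cstar_algebra"
  assumes sa: "star a = a"
    and p: "uniform_limit (rspec a) (\<lambda>n::nat. poly (p n)) f sequentially"
  shows "(\<lambda>n. rpoly_at (p n) a) \<longlonglongrightarrow> cfc a f"
proof -
  obtain v where v: "(\<lambda>n. rpoly_at (p n) a) \<longlonglongrightarrow> v"
    using rpoly_at_convergent[OF sa p] unfolding convergent_def by blast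
  then show ?thesis using cfc_eqI[OF sa p v] by simp
qed

lemma rspec_subset: "rspec a \<subseteq> {- norm a..norm a}"
  using rspec_norm[of _ a] by (fastforce simp: abs_le_iff)

lemma cfc_approx:
  fixes a :: "'a::cstar_algebra"
  assumes sa: "star a = a" and f: "continuous_on UNIV f"
  obtains p where "uniform_limit (rspec a) (\<lambda>n::nat. poly (p n)) f sequentially"
    "(\<lambda>n. rpoly_at (p n) a) \<longlonglongrightarrow> cfc a f"
  using uniform_limit_real_poly[OF f] uniform_limit_on_subset[OF _ rspec_subset] cfc_tendsto[OF sa]
  by metis

lemma bounded_image_rspec: "continuous_on UNIV f \<Longrightarrow> bounded ((f::real \<Rightarrow> real) ` rspec a)"
  by (meson bounded_subset compact_Icc compact_continuous_image compact_imp_bounded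
      continuous_on_subset image_mono rspec_subset subset_UNIV)

lemma cfc_cong: "(\<And>t. t \<in> rspec a \<Longrightarrow> f t = g t) \<Longrightarrow> cfc a f = cfc a g"
  unfolding cfc_def by (simp add: uniform_limit_iff cong: ball_cong)

lemma cfc_poly: "star a = a \<Longrightarrow> cfc a (poly p) = rpoly_at p a"
  by (rule cfc_eqI[where p = "\<lambda>_. p"]) (auto simp: uniform_limit_iff)

lemma cfc_id: "star a = a \<Longrightarrow> cfc a (\<lambda>t. t) = a"
  using cfc_poly[of a "[:0, 1:]"] cfc_cong[of a "poly [:0, 1:]" "\<lambda>t. t"] by simp

lemma cfc_const: "star a = a \<Longrightarrow> cfc a (\<lambda>t. c) = c *\<^sub>R 1"
  using cfc_poly[of a "[:c:]"] cfc_cong[of a "poly [:c:]" "\<lambda>t. c"] by simp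

lemma cfc_add:
  assumes "star a = a" "continuous_on UNIV f" "continuous_on UNIV g"
  shows "cfc a (\<lambda>t. f t + g t) = cfc a f + cfc a g"
proof -
  obtain p where p: "uniform_limit (rspec a) (\<lambda>n::nat. poly (p n)) f sequentially"
    "(\<lambda>n. rpoly_at (p n) a) \<longlonglongrightarrow> cfc a f" using cfc_approx assms by metis
  obtain q where q: "uniform_limit (rspec a) (\<lambda>n::nat. poly (q n)) g sequentially"
    "(\<lambda>n. rpoly_at (q n) a) \<longlonglongrightarrow> cfc a g" using cfc_approx assms by metis
  show ?thesis
  proof (rule cfc_eqI[OF assms(1), where p = "\<lambda>n. p n + q n"])
    show "uniform_limit (rspec a) (\<lambda>n. poly (p n + q n)) (\<lambda>t. f t + g t) sequentially"
      using uniform_limit_add[OF p(1) q(1)] by (simp add: poly_add[abs_def])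
    show "(\<lambda>n. rpoly_at (p n + q n) a) \<longlonglongrightarrow> cfc a f + cfc a g"
      unfolding rpoly_at_add by (intro tendsto_add p q)
  qed
qed

lemma cfc_mult:
  assumes "star a = a" "continuous_on UNIV f" "continuous_on UNIV g"
  shows "cfc a (\<lambda>t. f t * g t) = cfc a f * cfc a g"
proof -
  obtain p where p: "uniform_limit (rspec a) (\<lambda>n::nat. poly (p n)) f sequentially"
    "(\<lambda>n. rpoly_at (p n) a) \<longlonglongrightarrow> cfc a f" using cfc_approx assms by metis
  obtain q where q: "uniform_limit (rspec a) (\<lambda>n::nat. poly (q n)) g sequentially"
    "(\<lambda>n. rpoly_at (q n) a) \<longlonglongrightarrow> cfc a g" using cfc_approx assms by metis
  show ?thesis
  proof (rule cfc_eqI[OF assms(1), where p = "\<lambda>n. p n * q n"])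
    show "uniform_limit (rspec a) (\<lambda>n. poly (p n * q n)) (\<lambda>t. f t * g t) sequentially"
      using uniform_lim_mult[OF p(1) q(1) bounded_image_rspec[OF assms(2)] bounded_image_rspec[OF assms(3)]]
      by (simp add: poly_mult[abs_def])
    show "(\<lambda>n. rpoly_at (p n * q n) a) \<longlonglongrightarrow> cfc a f * cfc a g"
      unfolding rpoly_at_mult by (intro tendsto_mult p q)
  qed
qed

lemma cfc_scaleR:
  assumes "star a = a" "continuous_on UNIV f" shows "cfc a (\<lambda>t. c * f t) = c *\<^sub>R cfc a f"
  using cfc_mult[OF assms(1) continuous_on_const assms(2), of c] assms(1) by (simp add: cfc_const)

lemma cfc_diff:
  assumes "star a = a" "continuous_on UNIV f" "continuous_on UNIV g"
  shows "cfc a (\<lambda>t. f t - g t) = cfc a f - cfc a g"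
  using cfc_add[OF assms(1,2), of "\<lambda>t. (-1) * g t"] cfc_scaleR[OF assms(1,3), of "-1"] assms
  by (simp add: continuous_intros)

lemma cfc_sum:
  assumes "star a = a" "finite I" "\<And>i. i \<in> I \<Longrightarrow> continuous_on UNIV (f i)"
  shows "cfc a (\<lambda>t. \<Sum>i\<in>I. f i t) = (\<Sum>i\<in>I. cfc a (f i))"
  using assms(2,3)
proof (induction I rule: finite_induct)
  case empty
  then show ?case using cfc_const[OF assms(1), of 0] by simp
next
  case (insert i I)
  then show ?case
    using cfc_add[OF assms(1), of "f i" "\<lambda>t. \<Sum>i\<in>I. f i t"] by (simp add: continuous_on_sum)
qed

lemma cfc_norm_le:
  fixes a :: "'a::cstar_algebra"
  assumes sa: "star a = a" and f: "continuous_on UNIV f" and B: "\<And>t. t \<in> rspec a \<Longrightarrow> \<bar>f t\<bar> \<le> B"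
  shows "norm (cfc a f) \<le> B"
proof (rule field_le_epsilon)
  fix e :: real assume e: "e > 0"
  obtain p where p: "uniform_limit (rspec a) (\<lambda>n::nat. poly (p n)) f sequentially"
    "(\<lambda>n. rpoly_at (p n) a) \<longlonglongrightarrow> cfc a f" using cfc_approx[OF sa f] by metis
  have "\<forall>\<^sub>F n in sequentially. norm (rpoly_at (p n) a) \<le> B + e"
    using uniform_limitD[OF p(1) e]
  proof eventually_elim
    case (elim n)
    show ?case
    proof (rule rpoly_at_norm_le[OF sa])
      fix t assume t: "t \<in> rspec a"
      then show "\<bar>poly (p n) t\<bar> \<le> B + e" using elim B[OF t] unfolding dist_real_def by force
    qed
  qed
  with tendsto_norm[OF p(2)] show "norm (cfc a f) \<le> B + e"
    by (rule tendsto_upperbound) simp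
qed

lemma cfc_norm_ge:
  fixes a :: "'a::cstar_algebra"
  assumes sa: "star a = a" and f: "continuous_on UNIV f" and t: "t \<in> rspec a"
  shows "\<bar>f t\<bar> \<le> norm (cfc a f)"
proof -
  obtain p where p: "uniform_limit (rspec a) (\<lambda>n::nat. poly (p n)) f sequentially"
    "(\<lambda>n. rpoly_at (p n) a) \<longlonglongrightarrow> cfc a f" using cfc_approx[OF sa f] by metis
  have "(\<lambda>n. \<bar>poly (p n) t\<bar>) \<longlonglongrightarrow> \<bar>f t\<bar>"
    using tendsto_uniform_limitI[OF p(1) t] by (rule tendsto_rabs)
  from LIMSEQ_le[OF this tendsto_norm[OF p(2)]] show ?thesis using rpoly_at_norm_ge[OF t] by blast
qed

lemma cfc_self_adjoint:
  fixes a :: "'a::cstar_algebra"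
  assumes sa: "star a = a" and f: "continuous_on UNIV f" shows "star (cfc a f) = cfc a f"
proof -
  obtain p where p: "(\<lambda>n. rpoly_at (p n) a) \<longlonglongrightarrow> cfc a f" using cfc_approx[OF sa f] by metis
  from bounded_linear.tendsto[OF bounded_linear_star this]
  have "(\<lambda>n. rpoly_at (p n) a) \<longlonglongrightarrow> star (cfc a f)" by (simp add: rpoly_at_self_adjoint[OF sa])
  then show ?thesis using p LIMSEQ_unique by blast
qed

lemma cfc_commute:
  fixes a :: "'a::cstar_algebra"
  assumes sa: "star a = a" and f: "continuous_on UNIV f" and y: "y * a = a * y"
  shows "y * cfc a f = cfc a f * y"
proof -
  obtain p where p: "(\<lambda>n. rpoly_at (p n) a) \<longlonglongrightarrow> cfc a f" using cfc_approx[OF sa f] by metis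
  have "(\<lambda>n. y * rpoly_at (p n) a) \<longlonglongrightarrow> y * cfc a f" by (intro tendsto_intros p)
  moreover have "(\<lambda>n. rpoly_at (p n) a * y) \<longlonglongrightarrow> cfc a f * y" by (intro tendsto_intros p)
  ultimately show ?thesis unfolding rpoly_at_commute[OF y] using LIMSEQ_unique by blast
qed

section \<open>Positive elements and square roots\<close>

lemma rspec_iff: "t \<in> rspec a \<longleftrightarrow> \<not> alg_invertible (a - t *\<^sub>R 1)"
  by (simp add: rspec_def alg_spectrum_def scaleC_of_real)

lemma rspec_minus: "t \<in> rspec a \<Longrightarrow> - t \<in> rspec (- a)"
  using alg_invertible_minus[of "- a - (- t) *\<^sub>R 1"] by (auto simp: rspec_iff)

lemma rspec_const_diff: "t \<in> rspec a \<Longrightarrow> c - t \<in> rspec (c *\<^sub>R 1 - a)"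
  using alg_invertible_minus[of "c *\<^sub>R 1 - a - (c - t) *\<^sub>R 1"] by (auto simp: rspec_iff algebra_simps)

text \<open>The inverse \<open>1 + y * r * x\<close> comes from the formal series
  \<open>1 + y x + y x y x + ... = 1 + y (1 + x y + ...) x\<close>; its verification needs no
  convergence.\<close>

lemma alg_invertible_one_minus_swap:
  assumes "alg_invertible (1 - x * y)" shows "alg_invertible (1 - y * x)"
proof -
  define r where "r = alg_inv (1 - x * y)"
  have "(1 - x * y) * r = 1" "r * (1 - x * y) = 1" unfolding r_def using assms by (simp_all add: alg_inv)
  then have r: "x * y * r = r - 1" "r * x * y = r - 1" by (simp_all add: algebra_simps)
  have "(1 - y * x) * (1 + y * r * x) = 1 - y * x + y * r * x - y * (x * y * r) * x"
    by (simp add: algebra_simps)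
  also have "\<dots> = 1" unfolding r by (simp add: algebra_simps)
  finally have 1: "(1 - y * x) * (1 + y * r * x) = 1" .
  have "(1 + y * r * x) * (1 - y * x) = 1 - y * x + y * r * x - y * (r * x * y) * x"
    by (simp add: algebra_simps)
  also have "\<dots> = 1" unfolding r by (simp add: algebra_simps)
  finally have "(1 + y * r * x) * (1 - y * x) = 1" .
  with 1 show ?thesis by (rule alg_invertibleI)
qed

lemma rspec_mult_swap:
  assumes "t \<noteq> 0" "t \<in> rspec (x * y)" shows "t \<in> rspec (y * x)"
proof (rule ccontr)
  assume "t \<notin> rspec (y * x)"
  then have "alg_invertible ((- inverse t) *\<^sub>R (y * x - t *\<^sub>R 1))"
    using assms(1) by (intro alg_invertible_scaleR) (auto simp: rspec_iff)
  also have "(- inverse t) *\<^sub>R (y * x - t *\<^sub>R 1) = 1 - y * (inverse t *\<^sub>R x)"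
    using assms(1) by (simp add: algebra_simps)
  finally have "alg_invertible (1 - (inverse t *\<^sub>R x) * y)" by (rule alg_invertible_one_minus_swap)
  then have "alg_invertible ((- t) *\<^sub>R (1 - (inverse t *\<^sub>R x) * y))"
    using assms(1) by (intro alg_invertible_scaleR) auto
  also have "(- t) *\<^sub>R (1 - (inverse t *\<^sub>R x) * y) = x * y - t *\<^sub>R 1"
    using assms(1) by (simp add: algebra_simps)
  finally show False using assms(2) by (simp add: rspec_iff)
qed

lemma pos_sa: "cstar_positive x \<Longrightarrow> star x = x" by (simp add: cstar_positive_def)

lemma pos_rspec: "cstar_positive x \<Longrightarrow> t \<in> rspec x \<Longrightarrow> 0 \<le> t"
  by (force simp: cstar_positive_def rspec_def)

lemma cstar_positiveI: "star x = x \<Longrightarrow> (\<And>t. t \<in> rspec x \<Longrightarrow> 0 \<le> t) \<Longrightarrow> cstar_positive x"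
  unfolding cstar_positive_def by (metis Im_complex_of_real Re_complex_of_real sa_spectrum_rspec)

text \<open>A possibly complex root \<open>w\<close> of \<open>t\<close> factors
  \<open>y * y - t\<close> as \<open>(y - w) (y + w)\<close>. One factor is singular, so
  \<open>w\<close> is real by \<open>sa_spectrum_real\<close>, and \<open>t\<close> is a real
  square.\<close>

lemma pos_square: assumes sa: "star y = y" shows "cstar_positive (y * y)"
proof (rule cstar_positiveI)
  fix t assume t: "t \<in> rspec (y * y)"
  define w where "w = csqrt (complex_of_real t)"
  have ww: "w * w = complex_of_real t" unfolding w_def by (metis power2_csqrt power2_eq_square)
  have f: "y * y - complex_of_real t *\<^sub>C 1 = (y - w *\<^sub>C 1) * (y - (- w) *\<^sub>C 1)"
    by (simp add: algebra_simps scaleC_minus_left mult_scaleC_left mult_scaleC_right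
        scaleC_diff_right scaleC_scaleC ww)
  have "\<not> alg_invertible (y - w *\<^sub>C 1) \<or> \<not> alg_invertible (y - (- w) *\<^sub>C 1)"
    using t alg_invertible_mult unfolding rspec_def alg_spectrum_def f[symmetric]
    by (metis f mem_Collect_eq)
  then have "Im w = 0" using sa_spectrum_real[OF sa, of w] sa_spectrum_real[OF sa, of "- w"]
    by (auto simp: alg_spectrum_def)
  then have "t = Re w * Re w" using ww by (metis Re_complex_of_real diff_zero mult_zero_left times_complex.sel(1))
  then show "0 \<le> t" by simp
qed (use sa in \<open>simp add: star_simps\<close>)

lemma cfc_pos:
  assumes sa: "star a = a" and f: "continuous_on UNIV f" and nn: "\<And>t. t \<in> rspec a \<Longrightarrow> 0 \<le> f t"
  shows "cstar_positive (cfc a f)"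
proof -
  define g where "g = (\<lambda>t. sqrt \<bar>f t\<bar>)"
  have g: "continuous_on UNIV g" unfolding g_def using f by (intro continuous_intros)
  have "cfc a f = cfc a (\<lambda>t. g t * g t)" by (rule cfc_cong) (use nn in \<open>simp add: g_def\<close>)
  also have "\<dots> = cfc a g * cfc a g" by (rule cfc_mult[OF sa g g])
  finally show ?thesis using pos_square[OF cfc_self_adjoint[OF sa g]] by simp
qed

lemma cfc_affine: assumes "star a = a" shows "cfc a (\<lambda>t. c - t) = c *\<^sub>R 1 - a"
  using cfc_diff[OF assms continuous_on_const continuous_on_id, of c] assms by (simp add: cfc_const cfc_id)

text \<open>Together with its converse \<open>pos_if_norm_const_diff\<close> this expresses
  positivity by a norm inequality, which reduces \<open>pos_add\<close> to the triangle
  inequality.\<close>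

lemma pos_norm_const_diff:
  assumes "cstar_positive x" "norm x \<le> s" shows "norm (s *\<^sub>R 1 - x) \<le> s"
proof -
  note sa = pos_sa[OF assms(1)]
  have "norm (cfc x (\<lambda>t. s - t)) \<le> s"
  proof (rule cfc_norm_le[OF sa])
    fix t assume "t \<in> rspec x"
    then show "\<bar>s - t\<bar> \<le> s" using pos_rspec[OF assms(1)] rspec_norm[of t x] assms(2) by fastforce
  qed (intro continuous_intros)
  then show ?thesis by (simp add: cfc_affine[OF sa])
qed

lemma pos_if_norm_const_diff:
  assumes "star x = x" "norm (s *\<^sub>R 1 - x) \<le> s" shows "cstar_positive x"
proof (rule cstar_positiveI[OF assms(1)])
  fix t assume "t \<in> rspec x"
  then show "0 \<le> t" using rspec_norm[OF rspec_const_diff[of t x s]] assms(2) by linarith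
qed

lemma pos_add: assumes "cstar_positive x" "cstar_positive y" shows "cstar_positive (x + y)"
proof (rule pos_if_norm_const_diff)
  show "star (x + y) = x + y" using assms by (simp add: star_simps pos_sa)
  show "norm ((norm x + norm y) *\<^sub>R 1 - (x + y)) \<le> norm x + norm y"
    using norm_triangle_ineq[of "norm x *\<^sub>R 1 - x" "norm y *\<^sub>R 1 - y"]
      pos_norm_const_diff[OF assms(1) order_refl] pos_norm_const_diff[OF assms(2) order_refl]
    by (simp add: algebra_simps)
qed

lemma pos_const [simp]: "0 \<le> c \<Longrightarrow> cstar_positive (c *\<^sub>R 1)"
  using pos_square[of "sqrt c *\<^sub>R 1"] by (simp add: star_scaleR)

lemma pos_scaleR: assumes "cstar_positive x" "0 \<le> c" shows "cstar_positive (c *\<^sub>R x)"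
proof (rule pos_if_norm_const_diff)
  show "star (c *\<^sub>R x) = c *\<^sub>R x" using assms by (simp add: star_simps pos_sa)
  have "(c * norm x) *\<^sub>R 1 - c *\<^sub>R x = c *\<^sub>R (norm x *\<^sub>R 1 - x)" by (simp add: algebra_simps)
  then show "norm ((c * norm x) *\<^sub>R 1 - c *\<^sub>R x) \<le> c * norm x"
    using assms(2) pos_norm_const_diff[OF assms(1) order_refl] by (simp add: mult_left_mono)
qed

lemma pos_norm_in_rspec: assumes "cstar_positive x" shows "norm x \<in> rspec x"
proof (cases "norm x \<in> rspec x")
  case False
  then have "- norm x \<in> rspec x" using rspec_nonempty[OF pos_sa[OF assms]] by blast
  then have "norm x = 0" using pos_rspec[OF assms, of "- norm x"] norm_ge_zero[of x] by linarith
  then show ?thesis using \<open>- norm x \<in> rspec x\<close> by simp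
qed

lemma pos_antisym: assumes "cstar_positive x" "cstar_positive (- x)" shows "x = 0"
  using pos_rspec[OF assms(2) rspec_minus[OF pos_norm_in_rspec[OF assms(1)]]] by simp

lemma pos_const_diff_norm: assumes "star x = x" "norm x \<le> c" shows "cstar_positive (c *\<^sub>R 1 - x)"
proof -
  have "cstar_positive (cfc x (\<lambda>t. c - t))"
  proof (rule cfc_pos[OF assms(1)])
    fix t assume "t \<in> rspec x"
    then show "0 \<le> c - t" using rspec_norm[of t x] assms(2) by force
  qed (intro continuous_intros)
  then show ?thesis by (simp add: cfc_affine[OF assms(1)])
qed

lemma pos_norm_le_const:
  assumes "cstar_positive x" "cstar_positive (c *\<^sub>R 1 - x)" shows "norm x \<le> c"
  using pos_rspec[OF assms(2) rspec_const_diff[OF pos_norm_in_rspec[OF assms(1)]]] by simp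

text \<open>The negative part of \<open>x\<^sup>*x\<close> is removed by \<open>c = x (x\<^sup>*x)\<^sub>-\<close>: both \<open>-c\<^sup>*c\<close> and hence \<open>-cc\<^sup>*\<close> are
  positive, while \<open>c\<^sup>*c + cc\<^sup>*\<close> is a sum of two squares of self-adjoint elements.\<close>

lemma pos_star_mult: "cstar_positive (star x * (x::'a::cstar_algebra))"
proof -
  define b where "b = star x * x"
  have sa: "star b = b" unfolding b_def by (simp add: star_simps)
  define f where "f = (\<lambda>t::real. max 0 (- t))"
  have f: "continuous_on UNIV f" unfolding f_def by (intro continuous_intros)
  define n where "n = cfc b f"
  have sn: "star n = n" unfolding n_def by (rule cfc_self_adjoint[OF sa f])
  define c where "c = x * n"
  have f3: "continuous_on UNIV (\<lambda>t. f t * (f t * f t))" using f by (intro continuous_intros)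
  have nbn: "n * b * n = - cfc b (\<lambda>t. f t * (f t * f t))"
  proof -
    have "n * b * n = cfc b (\<lambda>t. (f t * t) * f t)"
      unfolding n_def using f sa
      by (simp add: cfc_mult[of b "\<lambda>t. f t * t" f] cfc_mult[of b f "\<lambda>t. t"] cfc_id continuous_intros)
    also have "\<dots> = cfc b (\<lambda>t. (-1) * (f t * (f t * f t)))"
      by (rule cfc_cong) (auto simp: f_def max_def)
    also have "\<dots> = - cfc b (\<lambda>t. f t * (f t * f t))" using cfc_scaleR[OF sa f3, of "-1"] by simp
    finally show ?thesis .
  qed
  have cc: "star c * c = n * b * n" unfolding c_def b_def by (simp add: star_simps sn mult.assoc)
  have neg: "cstar_positive (- (star c * c))"
    unfolding cc nbn using cfc_pos[OF sa f3] by (simp add: f_def)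
  have neg': "cstar_positive (- (c * star c))"
  proof (rule cstar_positiveI)
    fix t assume t: "t \<in> rspec (- (c * star c))"
    show "0 \<le> t"
    proof (cases "t = 0")
      case False
      from rspec_mult_swap[OF this, of "- c" "star c"] t have "t \<in> rspec (- (star c * c))" by simp
      then show ?thesis by (rule pos_rspec[OF neg])
    qed auto
  qed (simp add: star_simps)
  define u where "u = c + star c"
  define w where "w = \<i> *\<^sub>C (c - star c)"
  have "star u = u" "star w = w"
    unfolding u_def w_def by (simp_all add: star_simps scaleC_minus_left scaleC_diff_right)
  then have "cstar_positive (u * u + w * w)" by (intro pos_add pos_square)
  also have "u * u + w * w = 2 *\<^sub>R (star c * c + c * star c)"
    unfolding u_def w_def
    by (simp only: mult_scaleC_left mult_scaleC_right scaleC_scaleC)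
      (simp add: scaleC_minus_left scaleR_2 algebra_simps)
  finally have "cstar_positive ((1/2) *\<^sub>R (2 *\<^sub>R (star c * c + c * star c)))"
    by (rule pos_scaleR) simp
  then have "cstar_positive (star c * c + c * star c)" unfolding scaleR_scaleR by simp
  from pos_add[OF this neg'] have "cstar_positive (star c * c)" by simp
  \<comment> \<open>Being both positive and negative, \<open>star c * c\<close> is zero. Thus the
    cube of \<open>f\<close> vanishes at \<open>b\<close>, and \<open>cfc_norm_ge\<close> makes
    \<open>f\<close> zero on the spectrum.\<close>
  from pos_antisym[OF this neg] have z: "cfc b (\<lambda>t. f t * (f t * f t)) = 0" unfolding cc nbn by simp
  show ?thesis unfolding b_def[symmetric]
  proof (rule cstar_positiveI[OF sa])
    fix t assume "t \<in> rspec b"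
    from cfc_norm_ge[OF sa f3 this] z have "f t = 0" by simp
    then show "0 \<le> t" unfolding f_def by linarith
  qed
qed

section \<open>Existence and uniqueness of positive square roots\<close>

lemma cfc_sqrt:
  assumes "cstar_positive x"
  shows "cstar_positive (cfc x sqrt)" "cfc x sqrt * cfc x sqrt = x"
proof -
  note sa = pos_sa[OF assms]
  have c: "continuous_on UNIV sqrt" by (intro continuous_intros)
  show "cstar_positive (cfc x sqrt)" by (rule cfc_pos[OF sa c]) (use pos_rspec[OF assms] in auto)
  have "cfc x sqrt * cfc x sqrt = cfc x (\<lambda>t. sqrt t * sqrt t)" by (rule cfc_mult[OF sa c c, symmetric])
  also have "\<dots> = cfc x (\<lambda>t. t)" by (rule cfc_cong) (use pos_rspec[OF assms] in simp)
  finally show "cfc x sqrt * cfc x sqrt = x" by (simp add: cfc_id sa)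
qed

text \<open>Gives uniqueness of the positive root. A polynomial \<open>p\<close> approximating the
  root, taken at \<open>y * y\<close>, is the polynomial \<open>p(t^2)\<close> at \<open>y\<close>;
  on the nonnegative spectrum of \<open>y\<close> these converge uniformly to
  \<open>t\<close>.\<close>

lemma cfc_sqrt_square: assumes y: "cstar_positive y" shows "cfc (y * y) sqrt = y"
proof -
  note sa = pos_sa[OF y]
  have sa2: "star (y * y) = y * y" by (simp add: star_simps sa)
  define R where "R = norm (y * y)"
  have "continuous_on UNIV sqrt" by (intro continuous_intros)
  then obtain p where p: "uniform_limit {-R..R} (\<lambda>n::nat. poly (p n)) sqrt sequentially"
    by (rule uniform_limit_real_poly)
  let ?q = "[:0, 0, 1:] :: real poly"
  have yy: "rpoly_at ?q y = y * y" by simp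
  have sq: "t * t \<in> {-R..R}" if "t \<in> rspec y" for t
  proof -
    have "\<bar>t\<bar> * \<bar>t\<bar> \<le> norm y * norm y" using rspec_norm[OF that] by (intro mult_mono) auto
    also have "\<dots> = R" unfolding R_def norm_sa_square[OF sa] by (simp add: power2_eq_square)
    finally have "\<bar>t * t\<bar> \<le> R" by (simp add: abs_mult)
    then show ?thesis unfolding abs_le_iff by auto
  qed
  have lim: "(\<lambda>n. rpoly_at (p n) (y * y)) \<longlonglongrightarrow> cfc (y * y) sqrt"
    by (rule cfc_tendsto[OF sa2 uniform_limit_on_subset[OF p]]) (simp add: R_def rspec_subset)
  have "uniform_limit (rspec y) (\<lambda>n. poly (pcompose (p n) ?q)) (\<lambda>t. t) sequentially"
  proof (rule uniform_limitI)
    fix e :: real assume "e > 0"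
    from uniform_limitD[OF p this]
    show "\<forall>\<^sub>F n in sequentially. \<forall>t\<in>rspec y. dist (poly (pcompose (p n) ?q) t) t < e"
    proof eventually_elim
      case (elim n)
      show ?case
      proof
        fix t assume t: "t \<in> rspec y"
        have "poly (pcompose (p n) ?q) t = poly (p n) (t * t)" by (simp add: poly_pcompose)
        moreover have "sqrt (t * t) = t" using pos_rspec[OF y t] by simp
        ultimately show "dist (poly (pcompose (p n) ?q) t) t < e" using elim sq[OF t] by metis
      qed
    qed
  qed
  from cfc_tendsto[OF sa this] have "(\<lambda>n. rpoly_at (p n) (y * y)) \<longlonglongrightarrow> y"
    unfolding rpoly_at_pcompose yy cfc_id[OF sa] .
  from LIMSEQ_unique[OF lim this] show ?thesis .
qed

lemma pos_sqrt_eq_cfc: assumes "cstar_positive x" shows "pos_sqrt x = cfc x sqrt"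
  unfolding pos_sqrt_def
  by (rule the_equality) (use cfc_sqrt[OF assms] cfc_sqrt_square in \<open>metis+\<close>)

lemma pos_sqrt_square: "cstar_positive y \<Longrightarrow> pos_sqrt (y * y) = y"
  by (simp add: pos_sqrt_eq_cfc pos_square pos_sa cfc_sqrt_square)

lemma pos_sqrt_pos: "cstar_positive x \<Longrightarrow> cstar_positive (pos_sqrt x)"
  and pos_sqrt_mult_self: "cstar_positive x \<Longrightarrow> pos_sqrt x * pos_sqrt x = x"
  by (simp_all add: pos_sqrt_eq_cfc cfc_sqrt)

lemma pos_sqrt_commute:
  assumes "cstar_positive x" "y * x = x * y" shows "y * pos_sqrt x = pos_sqrt x * y"
  unfolding pos_sqrt_eq_cfc[OF assms(1)]
  by (rule cfc_commute[OF pos_sa[OF assms(1)] _ assms(2)]) (intro continuous_intros)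

lemma pos_conj: assumes "cstar_positive b" shows "cstar_positive (star y * b * y)"
proof -
  have "star y * b * y = star (pos_sqrt b * y) * (pos_sqrt b * y)"
    using pos_sa[OF pos_sqrt_pos[OF assms]] pos_sqrt_mult_self[OF assms]
    by (simp add: star_simps mult.assoc) (metis mult.assoc)
  then show ?thesis by (metis pos_star_mult)
qed

lemma pos_conj_sa: "cstar_positive b \<Longrightarrow> star y = y \<Longrightarrow> cstar_positive (y * b * y)"
  using pos_conj[of b y] by simp

lemma pos_mult_commute:
  assumes "cstar_positive x" "cstar_positive y" "x * y = y * x" shows "cstar_positive (x * y)"
proof -
  have "y * pos_sqrt x = pos_sqrt x * y" using assms by (intro pos_sqrt_commute) auto
  then have "pos_sqrt x * y * pos_sqrt x = x * y"
    by (metis assms(1,3) mult.assoc pos_sqrt_mult_self)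
  then show ?thesis using pos_conj_sa[OF assms(2) pos_sa[OF pos_sqrt_pos[OF assms(1)]]] by simp
qed

text \<open>A stand-in for the spectral projection of \<open>h\<close> at \<open>t0\<close>: a tent
  of height one at \<open>t0\<close> vanishing at distance \<open>\<epsilon>\<close>, raised to a
  positive floor \<open>\<kappa>\<close> so that \<open>e\<close> is invertible.\<close>

lemma peak_element:
  fixes h :: "'a::cstar_algebra"
  assumes sa: "star h = h" and t0: "t0 \<in> rspec h" and eps: "0 < \<epsilon>"
  obtains e where "cstar_positive e" "alg_invertible e" "norm e = 1" "cstar_positive (1 - e)"
    "h * e = e * h" "norm ((h - t0 *\<^sub>R 1) * e) \<le> \<epsilon>"
proof -
  \<comment> \<open>Where the floor is active, \<open>t\<close> can be as far as
    \<open>2 * norm h\<close> from \<open>t0\<close>, so \<open>\<kappa> * (2 * norm h)\<close> has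
    to be at most \<open>\<epsilon>\<close>. The added \<open>1\<close> covers
    \<open>h = 0\<close>.\<close>
  define \<kappa> where "\<kappa> = min 1 (\<epsilon> / (2 * norm h + 1))"
  have "2 * norm h + 1 > 0" using norm_ge_zero[of h] by linarith
  then have \<kappa>: "0 < \<kappa>" "\<kappa> \<le> 1" unfolding \<kappa>_def using eps by simp_all
  have "\<kappa> * (2 * norm h + 1) \<le> (\<epsilon> / (2 * norm h + 1)) * (2 * norm h + 1)"
    unfolding \<kappa>_def by (intro mult_right_mono) auto
  also have "\<dots> = \<epsilon>" using norm_ge_zero[of h] by (simp add: add_nonneg_eq_0_iff)
  finally have "\<kappa> * (2 * norm h) \<le> \<epsilon>" using \<kappa> by (simp add: algebra_simps)
  define \<phi> where "\<phi> = (\<lambda>t. max \<kappa> (1 - \<bar>t - t0\<bar> / \<epsilon>))"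
  have c: "continuous_on UNIV \<phi>" unfolding \<phi>_def using eps by (intro continuous_intros) auto
  have ge: "\<kappa> \<le> \<phi> t" and le: "\<phi> t \<le> 1" for t unfolding \<phi>_def using \<kappa> eps by auto
  have nz: "\<phi> t \<noteq> 0" for t using ge[of t] \<kappa> by linarith
  have one: "\<phi> t0 = 1" unfolding \<phi>_def using \<kappa> by simp
  define e where "e = cfc h \<phi>"
  show thesis
  proof
    show pe: "cstar_positive e" unfolding e_def
      by (rule cfc_pos[OF sa c]) (use ge \<kappa> in \<open>auto intro: order_trans less_imp_le\<close>)
    have ci: "continuous_on UNIV (\<lambda>t. inverse (\<phi> t))"
      using c nz by (intro continuous_intros) auto
    have "cfc h (\<lambda>t. \<phi> t * inverse (\<phi> t)) = 1" "cfc h (\<lambda>t. inverse (\<phi> t) * \<phi> t) = 1"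
      using cfc_const[OF sa, of 1] nz by simp_all
    then show "alg_invertible e"
      unfolding e_def by (intro alg_invertibleI[of _ "cfc h (\<lambda>t. inverse (\<phi> t))"])
        (simp_all add: cfc_mult[OF sa c ci] cfc_mult[OF sa ci c])
    show "norm e = 1"
    proof (rule antisym)
      show "norm e \<le> 1" unfolding e_def
        by (rule cfc_norm_le[OF sa c]) (use ge le \<kappa> in \<open>smt (verit)\<close>)
      show "1 \<le> norm e" using cfc_norm_ge[OF sa c t0] one unfolding e_def by simp
    qed
    then show "cstar_positive (1 - e)" using pos_const_diff_norm[OF pos_sa[OF pe], of 1] by simp
    show "h * e = e * h" unfolding e_def by (rule cfc_commute[OF sa c refl])
    have cd: "continuous_on UNIV (\<lambda>t. t - t0)" by (intro continuous_intros)
    have "(h - t0 *\<^sub>R 1) * e = cfc h (\<lambda>t. (t - t0) * \<phi> t)"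
      unfolding cfc_mult[OF sa cd c] e_def
      using cfc_diff[OF sa continuous_on_id continuous_on_const, of t0] by (simp add: cfc_id cfc_const sa)
    also have "norm \<dots> \<le> \<epsilon>"
    proof (rule cfc_norm_le[OF sa])
      fix t assume t: "t \<in> rspec h"
      have a: "\<bar>t - t0\<bar> \<le> 2 * norm h" using rspec_norm[OF t] rspec_norm[OF t0] by linarith
      show "\<bar>(t - t0) * \<phi> t\<bar> \<le> \<epsilon>"
      proof (cases "\<phi> t = \<kappa>")
        case True
        have "\<bar>t - t0\<bar> * \<kappa> \<le> 2 * norm h * \<kappa>" using a \<kappa> by (intro mult_right_mono) auto
        also have "\<dots> \<le> \<epsilon>" using \<open>\<kappa> * (2 * norm h) \<le> \<epsilon>\<close> by (simp add: mult_ac)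
        finally show ?thesis using True \<kappa> by (simp add: abs_mult)
      next
        case False
        then have "1 - \<bar>t - t0\<bar> / \<epsilon> > 0" using \<kappa> unfolding \<phi>_def by (smt (verit))
        then have "\<bar>t - t0\<bar> \<le> \<epsilon>" using eps by (simp add: field_simps)
        then have "\<bar>t - t0\<bar> * \<bar>\<phi> t\<bar> \<le> \<epsilon> * 1" using le[of t] ge[of t] \<kappa> eps by (intro mult_mono) auto
        then show ?thesis by (simp add: abs_mult)
      qed
    qed (intro continuous_intros c)
    finally show "norm ((h - t0 *\<^sub>R 1) * e) \<le> \<epsilon>" .
  qed
qed

section \<open>Continuity of the square root in norm\<close>

lemma norm_mult3_le: "norm (x * y * z) \<le> norm x * norm y * norm (z::'a::cstar_algebra)"
  by (meson mult_right_mono norm_ge_zero norm_mult_ineq order_trans)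

text \<open>With \<open>s = S + T\<close> and \<open>d = S - T\<close>, twice
  \<open>S * S - T * T\<close> is \<open>s d + d s\<close>. On a unit vector with
  \<open>d v = \<nu> v\<close> the quadratic form of \<open>S * S - T * T\<close> is therefore
  \<open>\<nu>\<close> times that of \<open>s\<close>, and the latter is at least
  \<open>\<nu>\<close> because \<open>s - d = 2 T\<close>. A peak element of \<open>d\<close> takes
  the place of the eigenvector.\<close>

lemma norm_diff_sq_le_if_top:
  fixes S T :: "'a::cstar_algebra"
  assumes S: "cstar_positive S" and T: "cstar_positive T" and top: "norm (S - T) \<in> rspec (S - T)"
  shows "(norm (S - T))\<^sup>2 \<le> norm (S * S - T * T)"
proof -
  define d where "d = S - T"
  define s where "s = S + T"
  define \<nu> where "\<nu> = norm d"
  define D where "D = S * S - T * T"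
  have sd: "star d = d" and ss: "star s = s" unfolding d_def s_def using S T by (simp_all add: star_simps pos_sa)
  have bound: "\<nu>\<^sup>2 \<le> norm D + \<epsilon> * (norm s + \<nu>)" if eps: "0 < \<epsilon>" for \<epsilon>
  proof -
    obtain v where v: "cstar_positive v" "norm v = 1" "norm ((d - \<nu> *\<^sub>R 1) * v) \<le> \<epsilon>"
      using peak_element[OF sd _ eps, of \<nu>] top unfolding \<nu>_def d_def by metis
    note sv = pos_sa[OF v(1)]
    define r where "r = (d - \<nu> *\<^sub>R 1) * v"
    have dv: "d * v = \<nu> *\<^sub>R v + r" unfolding r_def by (simp add: algebra_simps)
    have vd: "v * d = \<nu> *\<^sub>R v + star r"
      using arg_cong[OF dv, of star] by (simp add: star_simps sv sd)
    have nr: "norm r \<le> \<epsilon>" using v(3) unfolding r_def .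
    have "2 *\<^sub>R D = s * d + d * s" unfolding D_def s_def d_def by (simp add: algebra_simps scaleR_2)
    then have "v * (2 *\<^sub>R D) * v = v * (s * d + d * s) * v" by simp
    then have "2 *\<^sub>R (v * D * v) = v * s * (d * v) + (v * d) * s * v"
      by (simp add: distrib_left distrib_right mult.assoc)
    also have "\<dots> = 2 *\<^sub>R (\<nu> *\<^sub>R (v * s * v)) + (v * s * r + star r * s * v)"
      unfolding dv vd by (simp add: distrib_left distrib_right mult.assoc scaleR_2 del: scaleR_scaleR)
    finally have E: "2 *\<^sub>R (\<nu> *\<^sub>R (v * s * v)) = 2 *\<^sub>R (v * D * v) - (v * s * r + star r * s * v)" by simp
    have "norm (2 *\<^sub>R (\<nu> *\<^sub>R (v * s * v))) \<le> norm (2 *\<^sub>R (v * D * v)) + (norm (v * s * r) + norm (star r * s * v))"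
      unfolding E using norm_triangle_ineq4[of "2 *\<^sub>R (v * D * v)" "v * s * r + star r * s * v"]
        norm_triangle_ineq[of "v * s * r" "star r * s * v"] by linarith
    also have "norm (v * s * r) \<le> norm s * \<epsilon>" using norm_mult3_le[of v s r] nr v(2) mult_left_mono[OF nr norm_ge_zero[of s]] by simp
    also have "norm (star r * s * v) \<le> \<epsilon> * norm s"
      using norm_mult3_le[of "star r" s v] v(2) mult_right_mono[OF nr norm_ge_zero[of s]] by simp
    also have "norm (2 *\<^sub>R (v * D * v)) \<le> 2 * norm D" using norm_mult3_le[of v D v] v(2) by simp
    finally have 1: "\<nu> * norm (v * s * v) \<le> norm D + \<epsilon> * norm s"
      unfolding \<nu>_def by (simp add: algebra_simps)
    define N where "N = norm (v * s * v)"
    have p1: "cstar_positive (N *\<^sub>R 1 - v * s * v)"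
      unfolding N_def by (rule pos_const_diff_norm) (simp_all add: star_simps sv ss mult.assoc)
    \<comment> \<open>Positivity of \<open>T\<close> makes \<open>v * s * v\<close> dominate
      \<open>v * d * v\<close>, which is \<open>\<nu> *\<^sub>R (v * v)\<close> up to
      \<open>\<epsilon>\<close>; hence \<open>N\<close> is at least
      \<open>\<nu> - \<epsilon>\<close>.\<close>
    have "cstar_positive (2 *\<^sub>R (v * T * v))" by (intro pos_scaleR pos_conj_sa T sv) auto
    also have "2 *\<^sub>R (v * T * v) = v * s * v - v * d * v"
      unfolding s_def d_def by (simp add: algebra_simps scaleR_2)
    finally have p2: "cstar_positive (v * s * v - v * d * v)" .
    have vr: "v * r = v * d * v - \<nu> *\<^sub>R (v * v)" unfolding r_def by (simp add: algebra_simps)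
    have "star (v * r) = v * r" unfolding vr by (simp add: star_simps sv sd mult.assoc)
    moreover have "norm (v * r) \<le> \<epsilon>" using norm_mult_ineq[of v r] v(2) nr by simp
    ultimately have "cstar_positive (\<epsilon> *\<^sub>R 1 - (- (v * r)))"
      by (intro pos_const_diff_norm) (simp_all add: star_minus)
    from pos_add[OF pos_add[OF p1 p2] this]
    have "cstar_positive ((N + \<epsilon>) *\<^sub>R 1 - \<nu> *\<^sub>R (v * v))" unfolding vr by (simp add: algebra_simps)
    then have "norm (\<nu> *\<^sub>R (v * v)) \<le> N + \<epsilon>"
      by (intro pos_norm_le_const pos_scaleR pos_square sv) (simp add: \<nu>_def)
    then have "\<nu> \<le> N + \<epsilon>" using norm_sa_square[OF sv] v(2) by (simp add: \<nu>_def)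
    then have "\<nu>\<^sup>2 \<le> \<nu> * (N + \<epsilon>)" unfolding power2_eq_square by (intro mult_left_mono) (auto simp: \<nu>_def)
    then show ?thesis using 1 unfolding N_def by (simp add: algebra_simps)
  qed
  have "\<nu>\<^sup>2 \<le> norm D + e" if "0 < e" for e
  proof -
    have p: "norm s + \<nu> + 1 > 0" unfolding \<nu>_def by (simp add: add_nonneg_pos)
    have "e / (norm s + \<nu> + 1) * (norm s + \<nu>) \<le> e / (norm s + \<nu> + 1) * (norm s + \<nu> + 1)"
      using that p by (intro mult_left_mono) auto
    also have "\<dots> = e" using p by simp
    finally show ?thesis using bound[of "e / (norm s + \<nu> + 1)"] that p by (smt (verit) divide_pos_pos)
  qed
  then show ?thesis unfolding \<nu>_def D_def d_def by (rule field_le_epsilon)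
qed

text \<open>Hoelder continuity of the square root with exponent \<open>1/2\<close>. If the norm of
  \<open>S - T\<close> sits at the bottom of its spectrum, exchanging \<open>S\<close> and
  \<open>T\<close> moves it to the top.\<close>

lemma norm_diff_sq_le:
  fixes S T :: "'a::cstar_algebra"
  assumes S: "cstar_positive S" and T: "cstar_positive T"
  shows "(norm (S - T))\<^sup>2 \<le> norm (S * S - T * T)"
proof -
  have "star (S - T) = S - T" using S T by (simp add: star_simps pos_sa)
  from rspec_nonempty[OF this] show ?thesis
  proof
    assume "- norm (S - T) \<in> rspec (S - T)"
    from rspec_minus[OF this] have "norm (T - S) \<in> rspec (T - S)" by (simp add: norm_minus_commute)
    from norm_diff_sq_le_if_top[OF T S this] show ?thesis by (simp add: norm_minus_commute)
  qed (rule norm_diff_sq_le_if_top[OF S T])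
qed

section \<open>Separating two spectral values of a noncentral element\<close>

definition ramp :: "real \<Rightarrow> real" where "ramp s = max 0 (min 1 s)"

text \<open>The tent of half-width \<open>d\<close> centred at \<open>j * d\<close>, written as a
  difference of ramps so that sums over \<open>j\<close> telescope.\<close>

definition bump :: "real \<Rightarrow> nat \<Rightarrow> real \<Rightarrow> real"
  where "bump d j t = ramp (t / d - real j + 1) - ramp (t / d - real j)"

lemma continuous_on_ramp [continuous_intros]:
  "continuous_on S f \<Longrightarrow> continuous_on S (\<lambda>t. ramp (f t))"
  unfolding ramp_def by (intro continuous_intros)

lemma continuous_on_bump: "d > 0 \<Longrightarrow> continuous_on S (bump d j)"
  unfolding bump_def[abs_def] by (intro continuous_intros) auto

lemma bump_le_1: "\<bar>bump d j t\<bar> \<le> 1"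
  unfolding bump_def ramp_def by (simp add: max_def min_def)

lemma bump_support: assumes "d > 0" "bump d j t \<noteq> 0" shows "\<bar>t - real j * d\<bar> \<le> d"
proof -
  have "- 1 \<le> t / d - real j" "t / d - real j \<le> 1"
    using assms(2) unfolding bump_def ramp_def by (auto simp: max_def min_def split: if_splits)
  then have "- 1 * d \<le> (t / d - real j) * d" "(t / d - real j) * d \<le> 1 * d"
    using assms(1) by (intro mult_right_mono; simp)+
  then show ?thesis using assms(1) by (simp add: algebra_simps abs_le_iff)
qed

lemma sum_bump: assumes "d > 0" "0 \<le> t" "t \<le> real N * d" shows "(\<Sum>j\<le>N. bump d j t) = 1"
proof -
  have "(\<Sum>j\<le>N. bump d j t) = ramp (t / d + 1) - ramp (t / d - real N)" for N
    by (induction N) (auto simp: bump_def algebra_simps)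
  moreover have "ramp (t / d + 1) = 1" using assms unfolding ramp_def by simp
  moreover have "ramp (t / d - real N) = 0" using assms unfolding ramp_def by (simp add: field_simps)
  ultimately show ?thesis by simp
qed

text \<open>\<open>local_up_to a D\<close>: multiplication by elements of the algebra does not connect parts of the
  spectrum of \<open>a\<close> at distance at least \<open>D\<close>.\<close>

definition local_up_to :: "'a::cstar_algebra \<Rightarrow> real \<Rightarrow> bool"
  where "local_up_to a D \<longleftrightarrow> (\<forall>f g y. continuous_on UNIV f \<longrightarrow> continuous_on UNIV g \<longrightarrow>
     (\<forall>s t. f s \<noteq> 0 \<longrightarrow> g t \<noteq> 0 \<longrightarrow> D \<le> \<bar>s - t\<bar>) \<longrightarrow> cfc a f * y * cfc a g = 0)"

text \<open>A cutoff equal to \<open>1\<close> up to distance \<open>r + D\<close> from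
  \<open>c\<close> and \<open>0\<close> from distance \<open>r + 2 * D\<close> on. The margin
  \<open>D\<close> before the slope is the range over which \<open>local_up_to a D\<close> gives no
  control.\<close>

definition plateau :: "real \<Rightarrow> real \<Rightarrow> real \<Rightarrow> real \<Rightarrow> real"
  where "plateau D c r t = ramp ((r + 2 * D - \<bar>t - c\<bar>) / D)"

lemma continuous_on_plateau: "D > 0 \<Longrightarrow> continuous_on S (plateau D c r)"
  unfolding plateau_def[abs_def] by (intro continuous_intros) auto

lemma plateau_le_1: "\<bar>plateau D c r t\<bar> \<le> 1" unfolding plateau_def ramp_def by simp

lemma plateau_support: "D > 0 \<Longrightarrow> plateau D c r t \<noteq> 0 \<Longrightarrow> \<bar>t - c\<bar> \<le> r + 2 * D"
  unfolding plateau_def ramp_def by (auto simp: max_def min_def field_simps split: if_splits)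

lemma plateau_eq_1: "D > 0 \<Longrightarrow> \<bar>t - c\<bar> \<le> r + D \<Longrightarrow> plateau D c r t = 1"
  unfolding plateau_def ramp_def by (auto simp: max_def min_def field_simps split: if_splits)

lemma cfc_diff_const_mult:
  assumes sa: "star a = a" and f: "continuous_on UNIV f"
  shows "(a - c *\<^sub>R 1) * cfc a f = cfc a (\<lambda>t. (t - c) * f t)"
proof -
  have cd: "continuous_on UNIV (\<lambda>t::real. t - c)" by (intro continuous_intros)
  show ?thesis unfolding cfc_mult[OF sa cd f]
    using cfc_diff[OF sa continuous_on_id continuous_on_const, of c] by (simp add: cfc_id cfc_const sa)
qed

lemma cfc_diff_const_mult_norm:
  assumes sa: "star a = a" and f: "continuous_on UNIV f" and r: "r \<ge> 0"
    and le: "\<And>t. \<bar>f t\<bar> \<le> 1" and supp: "\<And>t. f t \<noteq> 0 \<Longrightarrow> \<bar>t - c\<bar> \<le> r"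
  shows "norm ((a - c *\<^sub>R 1) * cfc a f) \<le> r"
  unfolding cfc_diff_const_mult[OF sa f]
proof (rule cfc_norm_le[OF sa])
  fix t show "\<bar>(t - c) * f t\<bar> \<le> r"
  proof (cases "f t = 0")
    case False
    have "\<bar>t - c\<bar> * \<bar>f t\<bar> \<le> r * 1" using le[of t] supp[OF False] r by (intro mult_mono) auto
    then show ?thesis by (simp add: abs_mult)
  qed (use r in auto)
qed (intro continuous_intros f)

text \<open>Locality kills \<open>(1 - G(a)) y f(a)\<close>, since \<open>1 - G\<close> lives
  farther than \<open>r + D\<close> from \<open>c\<close>. Hence
  \<open>y f(a) = G(a) y f(a)\<close>, and in the commutator \<open>a\<close> can be shifted by the
  scalar \<open>c\<close>, at a cost of \<open>r + 2 * D\<close> on the left and \<open>r\<close> on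
  the right.\<close>

lemma local_commutator:
  fixes a :: "'a::cstar_algebra"
  assumes sa: "star a = a" and D: "D > 0" and loc: "local_up_to a D"
    and f: "continuous_on UNIV f" and r: "r \<ge> 0"
    and le: "\<And>t. \<bar>f t\<bar> \<le> 1" and supp: "\<And>t. f t \<noteq> 0 \<Longrightarrow> \<bar>t - c\<bar> \<le> r"
  defines "G \<equiv> plateau D c r"
  shows "(a * y - y * a) * cfc a f = cfc a G * ((a * y - y * a) * cfc a f)"
    and "norm ((a * y - y * a) * cfc a f) \<le> (2 * r + 2 * D) * norm y"
proof -
  let ?f = "cfc a f" and ?G = "cfc a G"
  have G: "continuous_on UNIV G" unfolding G_def by (rule continuous_on_plateau[OF D])
  have cf: "a * ?f = ?f * a" and cG: "a * ?G = ?G * a"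
    by (rule cfc_commute[OF sa f refl], rule cfc_commute[OF sa G refl])
  have "cfc a (\<lambda>t. 1 - G t) * y * ?f = 0"
  proof (rule loc[unfolded local_up_to_def, rule_format])
    fix s t assume st: "1 - G s \<noteq> 0" "f t \<noteq> 0"
    have "\<not> \<bar>s - c\<bar> \<le> r + D" using plateau_eq_1[OF D, of s c r] st(1) unfolding G_def by auto
    then show "D \<le> \<bar>s - t\<bar>" using supp[OF st(2)] by linarith
  qed (intro continuous_intros G f)+
  also have "cfc a (\<lambda>t. 1 - G t) = 1 - ?G"
    using cfc_diff[OF sa continuous_on_const G, of 1] by (simp add: cfc_const sa)
  finally have yf: "y * ?f = ?G * (y * ?f)" by (simp add: algebra_simps)
  have zf: "(a * y - y * a) * ?f = a * (y * ?f) - (y * ?f) * a"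
    using cf by (simp add: left_diff_distrib mult.assoc)
  also have "\<dots> = a * (?G * (y * ?f)) - (?G * (y * ?f)) * a" using yf by simp
  also have "\<dots> = ?G * (a * (y * ?f) - (y * ?f) * a)"
    unfolding right_diff_distrib mult.assoc[symmetric] cG ..
  finally show "(a * y - y * a) * ?f = ?G * ((a * y - y * a) * ?f)" by (simp only: zf)
  let ?c = "c *\<^sub>R (1::'a)"
  have "(a * y - y * a) * ?f = a * (?G * (y * ?f)) - (?G * (y * ?f)) * a" using zf yf by simp
  also have "\<dots> = ((a - ?c) * ?G) * (y * ?f) - ?G * y * (?f * (a - ?c))"
    by (simp add: algebra_simps)
  also have "?f * (a - ?c) = (a - ?c) * ?f" using cf by (simp add: algebra_simps)
  also have "norm (((a - ?c) * ?G) * (y * ?f) - ?G * y * ((a - ?c) * ?f))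
      \<le> norm (((a - ?c) * ?G) * (y * ?f)) + norm (?G * y * ((a - ?c) * ?f))" by (rule norm_triangle_ineq4)
  also have "norm (((a - ?c) * ?G) * (y * ?f)) \<le> (r + 2 * D) * (norm y * 1)"
  proof (rule order_trans[OF norm_mult_ineq mult_mono])
    show "norm ((a - ?c) * ?G) \<le> r + 2 * D" using r D G plateau_le_1 plateau_support[OF D] unfolding G_def
      by (intro cfc_diff_const_mult_norm[OF sa]) auto
    have "norm ?f \<le> 1" by (rule cfc_norm_le[OF sa f le])
    then show "norm (y * ?f) \<le> norm y * 1"
      by (rule order_trans[OF norm_mult_ineq mult_left_mono]) auto
  qed (use r D in auto)
  also have "norm (?G * y * ((a - ?c) * ?f)) \<le> (1 * norm y) * r"
  proof (rule order_trans[OF norm_mult_ineq mult_mono])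
    show "norm ((a - ?c) * ?f) \<le> r" by (rule cfc_diff_const_mult_norm[OF sa f r le supp])
    have "norm ?G \<le> 1" by (rule cfc_norm_le[OF sa G]) (simp add: G_def plateau_le_1)
    then show "norm (?G * y) \<le> 1 * norm y"
      by (rule order_trans[OF norm_mult_ineq mult_right_mono]) auto
  qed auto
  finally show "norm ((a * y - y * a) * ?f) \<le> (2 * r + 2 * D) * norm y"
    by (simp add: algebra_simps)
qed

lemma cfc_bump_sum:
  fixes a :: "'a::cstar_algebra"
  assumes a: "cstar_positive a" and d: "d > 0"
  shows "(\<Sum>j\<le>nat \<lceil>norm a / d\<rceil>. cfc a (bump d j)) = 1"
proof -
  note sa = pos_sa[OF a]
  let ?N = "nat \<lceil>norm a / d\<rceil>"
  have "norm a / d \<le> real ?N" by (rule real_nat_ceiling_ge)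
  then have "norm a / d * d \<le> real ?N * d" using d by (intro mult_right_mono) auto
  then have N: "norm a \<le> real ?N * d" using d by simp
  have "(\<Sum>j\<le>?N. cfc a (bump d j)) = cfc a (\<lambda>t. \<Sum>j\<le>?N. bump d j t)"
    by (rule cfc_sum[OF sa, symmetric]) (auto intro: continuous_on_bump[OF d])
  also have "\<dots> = cfc a (\<lambda>t. 1)"
  proof (rule cfc_cong)
    fix t assume t: "t \<in> rspec a"
    then show "(\<Sum>j\<le>?N. bump d j t) = 1"
      using pos_rspec[OF a t] rspec_norm[OF t] N by (intro sum_bump[OF d]) auto
  qed
  finally show ?thesis by (simp add: cfc_const sa)
qed

text \<open>With \<open>z = [a, y]\<close> and a partition of unity of mesh \<open>D\<close>, each of the \<open>O(1/D)\<close> pieces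
  \<open>z\<^sup>*z f\<^sub>j = (z\<^sup>*G\<^sub>j)(z f\<^sub>j)\<close> is \<open>O(D\<^sup>2)\<close>.\<close>

lemma local_up_to_commutator_norm:
  fixes a :: "'a::cstar_algebra"
  assumes a: "cstar_positive a" and D: "D > 0" and loc: "local_up_to a D"
  shows "(norm (a * y - y * a))\<^sup>2 \<le> 32 * (norm y)\<^sup>2 * (norm a + 2 * D) * D"
proof -
  note sa = pos_sa[OF a]
  define z where "z = a * y - y * a"
  define N where "N = nat \<lceil>norm a / D\<rceil>"
  have sz: "star z = - (a * star y - star y * a)" unfolding z_def by (simp add: star_simps sa)
  have piece: "norm (star z * z * cfc a (bump D j)) \<le> 32 * D * D * (norm y)\<^sup>2" for j
  proof -
    let ?f = "cfc a (bump D j)" and ?G = "plateau D (real j * D) D"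
    note fb = continuous_on_bump[OF D] less_imp_le[OF D] bump_le_1 bump_support[OF D]
    note fg = continuous_on_plateau[OF D] _ plateau_le_1 plateau_support[OF D]
    have 1: "z * ?f = cfc a ?G * (z * ?f)"
      unfolding z_def by (rule local_commutator(1)[OF sa D loc fb]) auto
    have "norm (z * ?f) \<le> (2 * D + 2 * D) * norm y"
      unfolding z_def by (rule local_commutator(2)[OF sa D loc fb]) auto
    then have 2: "norm (z * ?f) \<le> 4 * D * norm y" by simp
    \<comment> \<open>Up to sign \<open>star z\<close> is the commutator with \<open>star y\<close>.
      The plateau has support radius \<open>D + 2 * D\<close>, which yields \<open>8 * D\<close>;
      with the factor \<open>4 * D\<close> above this gives the constant \<open>32\<close>.\<close>
    have "norm ((a * star y - star y * a) * cfc a ?G) \<le> (2 * (D + 2 * D) + 2 * D) * norm (star y)"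
      by (rule local_commutator(2)[OF sa D loc fg]) (use D in auto)
    then have 3: "norm (star z * cfc a ?G) \<le> 8 * D * norm y"
      unfolding sz mult_minus_left norm_minus_cancel by simp
    have "star z * z * ?f = (star z * cfc a ?G) * (z * ?f)" using 1 by (metis mult.assoc)
    also have "norm \<dots> \<le> (8 * D * norm y) * (4 * D * norm y)"
      by (rule order_trans[OF norm_mult_ineq mult_mono[OF 3 2]]) (use D in auto)
    finally show ?thesis by (simp add: power2_eq_square mult_ac)
  qed
  have "(norm z)\<^sup>2 = norm (star z * z * (\<Sum>j\<le>N. cfc a (bump D j)))"
    using cfc_bump_sum[OF a D] unfolding N_def by (simp add: norm_star_mult_self)
  also have "\<dots> \<le> (\<Sum>j\<le>N. norm (star z * z * cfc a (bump D j)))"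
    unfolding sum_distrib_left by (rule norm_sum)
  also have "\<dots> \<le> (\<Sum>j\<le>N. 32 * D * D * (norm y)\<^sup>2)" by (intro sum_mono piece)
  also have "\<dots> = 32 * (norm y)\<^sup>2 * ((real N + 1) * D) * D" by (simp add: algebra_simps)
  also have "\<dots> \<le> 32 * (norm y)\<^sup>2 * (norm a + 2 * D) * D"
  proof -
    have "real N \<le> norm a / D + 1" unfolding N_def
      using of_int_ceiling_le_add_one[of "norm a / D"] D by simp
    then have "(real N + 1) * D \<le> (norm a / D + 2) * D" using D by (intro mult_right_mono) auto
    also have "\<dots> = norm a + 2 * D" using D by (simp add: field_simps)
    finally show ?thesis using D by (intro mult_right_mono mult_left_mono) auto
  qed
  finally show ?thesis unfolding z_def .
qed

lemma not_central_not_local: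
  fixes a :: "'a::cstar_algebra"
  assumes a: "cstar_positive a" and nc: "\<not> central a"
  obtains D where "D > 0" "\<not> local_up_to a D"
proof -
  obtain y where y: "a * y - y * a \<noteq> 0" using nc by (auto simp: central_def)
  define K where "K = 32 * (norm y)\<^sup>2 * (norm a + 2)"
  have K: "K \<ge> 0" unfolding K_def by simp
  define n where "n = (norm (a * y - y * a))\<^sup>2"
  have n: "n > 0" unfolding n_def using y by simp
  \<comment> \<open>The cap at \<open>1\<close> bounds \<open>norm a + 2 * D\<close> by the constant
    used in \<open>K\<close>; the other term pushes the commutator bound below
    \<open>n\<close>.\<close>
  define D where "D = min 1 (n / (2 * (K + 1)))"
  have D: "D > 0" "D \<le> 1" "D \<le> n / (2 * (K + 1))" unfolding D_def using n K by auto
  have "K * D \<le> K * (n / (2 * (K + 1)))" using D K by (intro mult_left_mono) auto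
  also have "\<dots> < n" using n K mult_nonneg_nonneg[of K n] by (simp add: field_simps add_nonneg_pos)
  finally have KD: "K * D < n" .
  have "\<not> local_up_to a D"
  proof
    assume "local_up_to a D"
    from local_up_to_commutator_norm[OF a D(1) this, of y]
    have "n \<le> 32 * (norm y)\<^sup>2 * (norm a + 2 * D) * D" unfolding n_def .
    also have "\<dots> \<le> K * D" unfolding K_def using D by (intro mult_right_mono mult_left_mono) auto
    finally show False using KD by simp
  qed
  with D(1) show ?thesis by (rule that)
qed

text \<open>A partition of unity of mesh \<open>\<delta>\<close> on both sides of a nonzero
  \<open>f(a) y g(a)\<close> leaves a nonzero piece \<open>w\<close>, localised near
  \<open>l\<close> on the left and near \<open>m\<close> on the right. Its square vanishes because
  the supports of \<open>f\<close> and \<open>g\<close> are disjoint. Each centre is within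
  \<open>\<delta>\<close> of these supports, whence the loss \<open>2 * \<delta>\<close>.\<close>

lemma off_diagonal_element:
  fixes a :: "'a::cstar_algebra"
  assumes a: "cstar_positive a" and D: "D > 0" "\<not> local_up_to a D" and \<delta>: "\<delta> > 0"
  obtains l m x where "norm x = 1" "x * x = 0" "norm ((a - l *\<^sub>R 1) * x) \<le> \<delta>"
    "norm (x * (a - m *\<^sub>R 1)) \<le> \<delta>" "D - 2 * \<delta> \<le> \<bar>l - m\<bar>"
proof -
  note sa = pos_sa[OF a]
  obtain f g y where f: "continuous_on UNIV f" and g: "continuous_on UNIV g"
    and gap: "\<And>s t. f s \<noteq> 0 \<Longrightarrow> g t \<noteq> 0 \<Longrightarrow> D \<le> \<bar>s - t\<bar>"
    and nz: "cfc a f * y * cfc a g \<noteq> 0" using D(2) unfolding local_up_to_def by blast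
  note b = continuous_on_bump[OF \<delta>]
  let ?b = "\<lambda>j. cfc a (bump \<delta> j)" and ?I = "{..nat \<lceil>norm a / \<delta>\<rceil>}"
  have "cfc a f * y * cfc a g = (\<Sum>i\<in>?I. ?b i) * (cfc a f * y * cfc a g) * (\<Sum>j\<in>?I. ?b j)"
    using cfc_bump_sum[OF a \<delta>] by simp
  also have "\<dots> = (\<Sum>i\<in>?I. \<Sum>j\<in>?I. ?b i * (cfc a f * y * cfc a g) * ?b j)"
    unfolding sum_distrib_right unfolding sum_distrib_left ..
  finally have "(\<Sum>i\<in>?I. \<Sum>j\<in>?I. ?b i * (cfc a f * y * cfc a g) * ?b j) \<noteq> 0" using nz by simp
  then obtain i j where ij: "?b i * (cfc a f * y * cfc a g) * ?b j \<noteq> 0"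
    by (meson sum.neutral)
  define w where "w = ?b i * (cfc a f * y * cfc a g) * ?b j"
  define l where "l = real i * \<delta>"
  define m where "m = real j * \<delta>"
  define x where "x = inverse (norm w) *\<^sub>R w"
  have w0: "w \<noteq> 0" using ij unfolding w_def .
  have fb: "?b i * cfc a f = cfc a (\<lambda>t. bump \<delta> i t * f t)" by (rule cfc_mult[OF sa b f, symmetric])
  have gb: "cfc a g * ?b j = cfc a (\<lambda>t. g t * bump \<delta> j t)" by (rule cfc_mult[OF sa g b, symmetric])
  have w: "w = cfc a (\<lambda>t. bump \<delta> i t * f t) * y * cfc a (\<lambda>t. g t * bump \<delta> j t)"
    unfolding w_def fb[symmetric] gb[symmetric] by (simp add: mult.assoc)
  have cz: "cfc a (\<lambda>t. 0) = 0" using cfc_const[OF sa, of 0] by simp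
  have "\<exists>s. bump \<delta> i s * f s \<noteq> 0"
  proof (rule ccontr)
    assume "\<not> (\<exists>s. bump \<delta> i s * f s \<noteq> 0)"
    then have "(\<lambda>t. bump \<delta> i t * f t) = (\<lambda>t. 0)" by auto
    then show False using w0 cz unfolding w by simp
  qed
  moreover have "\<exists>t. g t * bump \<delta> j t \<noteq> 0"
  proof (rule ccontr)
    assume "\<not> (\<exists>t. g t * bump \<delta> j t \<noteq> 0)"
    then have "(\<lambda>t. g t * bump \<delta> j t) = (\<lambda>t. 0)" by auto
    then show False using w0 cz unfolding w by simp
  qed
  ultimately obtain s t where st: "bump \<delta> i s \<noteq> 0" "f s \<noteq> 0" "g t \<noteq> 0" "bump \<delta> j t \<noteq> 0" by auto
  have lm: "D - 2 * \<delta> \<le> \<bar>l - m\<bar>"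
    using bump_support[OF \<delta> st(1)] bump_support[OF \<delta> st(4)] gap[OF st(2,3)]
    unfolding l_def m_def by linarith
  \<comment> \<open>Truncating \<open>t - k * \<delta>\<close> changes nothing on the support of the
    bump but bounds the function everywhere. The factor \<open>cfc a (c k)\<close> then acts on all
    of \<open>w\<close>, so normalising costs nothing, however small \<open>norm w\<close>
    is.\<close>
  define c where "c = (\<lambda>k t. max (- \<delta>) (min \<delta> (t - real k * \<delta>)))"
  have c: "continuous_on UNIV (c k)" "norm (cfc a (c k)) \<le> \<delta>" for k
  proof -
    show c: "continuous_on UNIV (c k)" unfolding c_def by (intro continuous_intros)
    show "norm (cfc a (c k)) \<le> \<delta>" by (rule cfc_norm_le[OF sa c]) (use \<delta> in \<open>auto simp: c_def\<close>)
  qed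
  have cb: "(a - (real k * \<delta>) *\<^sub>R 1) * ?b k = cfc a (c k) * ?b k" for k
    unfolding cfc_diff_const_mult[OF sa b] cfc_mult[OF sa c(1) b, symmetric]
  proof (rule cfc_cong)
    fix t show "(t - real k * \<delta>) * bump \<delta> k t = c k t * bump \<delta> k t"
      using bump_support[OF \<delta>, of k t] unfolding c_def by (cases "bump \<delta> k t = 0") auto
  qed
  have bc: "?b k * (a - (real k * \<delta>) *\<^sub>R 1) = ?b k * cfc a (c k)" for k
    using arg_cong[OF cb[of k], of star]
    by (simp add: star_simps cfc_self_adjoint[OF sa] b c(1) sa)
  have "(a - l *\<^sub>R 1) * w = cfc a (c i) * w"
    unfolding w_def l_def by (simp only: mult.assoc[symmetric] cb)
  then have "(a - l *\<^sub>R 1) * x = cfc a (c i) * x" unfolding x_def by simp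
  moreover have "w * (a - m *\<^sub>R 1) = w * cfc a (c j)"
    unfolding w_def m_def by (simp only: mult.assoc bc)
  then have "x * (a - m *\<^sub>R 1) = x * cfc a (c j)" unfolding x_def by simp
  moreover have nx: "norm x = 1" unfolding x_def using w0 by simp
  ultimately have "norm ((a - l *\<^sub>R 1) * x) \<le> \<delta>" "norm (x * (a - m *\<^sub>R 1)) \<le> \<delta>"
    using norm_mult_ineq[of "cfc a (c i)" x] norm_mult_ineq[of x "cfc a (c j)"] c(2)[of i] c(2)[of j]
    by auto
  moreover have "w * w = 0"
  proof -
    have c1: "continuous_on UNIV (\<lambda>t. g t * bump \<delta> j t)" "continuous_on UNIV (\<lambda>t. bump \<delta> i t * f t)"
      by (intro continuous_intros f g b)+
    have "cfc a (\<lambda>t. g t * bump \<delta> j t) * cfc a (\<lambda>t. bump \<delta> i t * f t) = cfc a (\<lambda>t. 0)"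
      unfolding cfc_mult[OF sa c1, symmetric] by (rule cfc_cong) (use gap D(1) in fastforce)
    then show ?thesis unfolding w by (simp add: mult.assoc cz) (simp flip: mult.assoc add: cz)
  qed
  then have "x * x = 0" unfolding x_def by simp
  ultimately show ?thesis using that nx lm by blast
qed

lemma norm_scalar_le: "norm (x::'a::cstar_algebra) = 1 \<Longrightarrow> norm ((a - l *\<^sub>R 1) * x) \<le> d \<Longrightarrow> \<bar>l\<bar> \<le> norm a + d"
proof -
  assume *: "norm x = 1" "norm ((a - l *\<^sub>R 1) * x) \<le> d"
  have "l *\<^sub>R x = a * x - (a - l *\<^sub>R 1) * x" by (simp add: algebra_simps)
  then have "norm (l *\<^sub>R x) \<le> norm (a * x) + norm ((a - l *\<^sub>R 1) * x)" by (metis norm_triangle_ineq4)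
  then show "\<bar>l\<bar> \<le> norm a + d" using * norm_mult_ineq[of a x] by simp
qed

text \<open>The scalars found by \<open>off_diagonal_element\<close> depend on the tolerance. They
  stay in a compact interval, so a subsequence converges; its limits serve every tolerance and
  remain at least \<open>D\<close> apart.\<close>

lemma not_central_off_diagonal:
  fixes a :: "'a::cstar_algebra"
  assumes a: "cstar_positive a" and nc: "\<not> central a"
  obtains l m where "l \<noteq> m" "\<And>\<delta>. \<delta> > 0 \<Longrightarrow> \<exists>x. norm x = 1 \<and> x * x = 0 \<and>
    norm ((a - l *\<^sub>R 1) * x) \<le> \<delta> \<and> norm (x * (a - m *\<^sub>R 1)) \<le> \<delta>"
proof -
  obtain D where D: "D > 0" "\<not> local_up_to a D" using not_central_not_local[OF a nc] by metis
  have "\<exists>l m x. norm x = 1 \<and> x * x = 0 \<and> norm ((a - l *\<^sub>R 1) * x) \<le> inverse (real (Suc n)) \<and>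
     norm (x * (a - m *\<^sub>R 1)) \<le> inverse (real (Suc n)) \<and> D - 2 * inverse (real (Suc n)) \<le> \<bar>l - m\<bar>" for n
    using off_diagonal_element[OF a D, of "inverse (real (Suc n))"]
    by (metis inverse_positive_iff_positive of_nat_0_less_iff zero_less_Suc)
  then obtain l m x where *: "\<And>n. norm (x n) = 1" "\<And>n. x n * x n = 0"
    "\<And>n. norm ((a - l n *\<^sub>R 1) * x n) \<le> inverse (real (Suc n))"
    "\<And>n. norm (x n * (a - m n *\<^sub>R 1)) \<le> inverse (real (Suc n))"
    "\<And>n. D - 2 * inverse (real (Suc n)) \<le> \<bar>l n - m n\<bar>" by metis
  have i1: "inverse (real (Suc n)) \<le> 1" for n by (simp add: field_simps)
  have bl: "\<bar>l n\<bar> \<le> norm a + 1" for n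
    using norm_scalar_le[OF *(1) *(3), of n] i1[of n] by linarith
  have bm: "\<bar>m n\<bar> \<le> norm a + 1" for n
  proof -
    have "norm ((a - m n *\<^sub>R 1) * star (x n)) \<le> inverse (real (Suc n))"
      using *(4)[of n] norm_star[of "x n * (a - m n *\<^sub>R 1)"] by (simp add: star_simps pos_sa[OF a])
    from norm_scalar_le[OF _ this] *(1) i1[of n] show ?thesis by force
  qed
  let ?K = "{- (norm a + 1)..norm a + 1}"
  have "seq_compact (?K \<times> ?K)" by (intro compact_imp_seq_compact compact_Times compact_Icc)
  moreover have "\<forall>n. (l n, m n) \<in> ?K \<times> ?K"
  proof
    fix n show "(l n, m n) \<in> ?K \<times> ?K" using bl[of n] bm[of n] by (simp add: abs_le_iff)
  qed
  ultimately obtain lm r where r: "strict_mono r" and lim: "((\<lambda>n. (l n, m n)) \<circ> r) \<longlonglongrightarrow> lm"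
    by (rule seq_compactE) metis
  define L where "L = fst lm"
  define M where "M = snd lm"
  have lL: "(\<lambda>n. l (r n)) \<longlonglongrightarrow> L" and mM: "(\<lambda>n. m (r n)) \<longlonglongrightarrow> M"
    using tendsto_fst[OF lim] tendsto_snd[OF lim] unfolding L_def M_def by (simp_all add: o_def)
  have ir: "(\<lambda>n. inverse (real (Suc (r n)))) \<longlonglongrightarrow> 0"
    using LIMSEQ_subseq_LIMSEQ[OF LIMSEQ_inverse_real_of_nat r] by (simp add: o_def)
  show thesis
  proof
    have "(\<lambda>n. D - 2 * inverse (real (Suc (r n)))) \<longlonglongrightarrow> D - 2 * 0" by (intro tendsto_intros ir)
    moreover have "(\<lambda>n. \<bar>l (r n) - m (r n)\<bar>) \<longlonglongrightarrow> \<bar>L - M\<bar>" by (intro tendsto_intros lL mM)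
    ultimately have "D - 2 * 0 \<le> \<bar>L - M\<bar>" by (rule LIMSEQ_le) (use *(5) in blast)
    then show "L \<noteq> M" using D by auto
    fix \<delta> :: real assume \<delta>: "\<delta> > 0"
    have "\<forall>\<^sub>F n in sequentially. inverse (real (Suc (r n))) < \<delta>/2 \<and> dist (l (r n)) L < \<delta>/2
        \<and> dist (m (r n)) M < \<delta>/2"
      using order_tendstoD(2)[OF ir, of "\<delta>/2"] tendstoD[OF lL, of "\<delta>/2"] tendstoD[OF mM, of "\<delta>/2"] \<delta>
      by (simp add: eventually_conj)
    then obtain n where n: "inverse (real (Suc (r n))) < \<delta>/2" "\<bar>l (r n) - L\<bar> < \<delta>/2" "\<bar>m (r n) - M\<bar> < \<delta>/2"
      unfolding dist_real_def using eventually_happens' trivial_limit_sequentially by blast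
    let ?x = "x (r n)"
    have "(a - L *\<^sub>R 1) * ?x = (a - l (r n) *\<^sub>R 1) * ?x + (l (r n) - L) *\<^sub>R ?x" by (simp add: algebra_simps)
    then have "norm ((a - L *\<^sub>R 1) * ?x) \<le> norm ((a - l (r n) *\<^sub>R 1) * ?x) + norm ((l (r n) - L) *\<^sub>R ?x)"
      by (metis norm_triangle_ineq)
    then have 1: "norm ((a - L *\<^sub>R 1) * ?x) \<le> \<delta>" using n *(1,3)[of "r n"] by simp
    have "?x * (a - M *\<^sub>R 1) = ?x * (a - m (r n) *\<^sub>R 1) + (m (r n) - M) *\<^sub>R ?x" by (simp add: algebra_simps)
    then have "norm (?x * (a - M *\<^sub>R 1)) \<le> norm (?x * (a - m (r n) *\<^sub>R 1)) + norm ((m (r n) - M) *\<^sub>R ?x)"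
      by (metis norm_triangle_ineq)
    then have "norm (?x * (a - M *\<^sub>R 1)) \<le> \<delta>" using n *(1,4)[of "r n"] by simp
    with 1 show "\<exists>x. norm x = 1 \<and> x * x = 0 \<and>
      norm ((a - L *\<^sub>R 1) * x) \<le> \<delta> \<and> norm (x * (a - M *\<^sub>R 1)) \<le> \<delta>" using *(1,2) by blast
  qed
qed

section \<open>Compressions and the norm equalities\<close>

text \<open>The square of \<open>x + star x\<close> is \<open>p + q\<close> with
  \<open>p q = q p = 0\<close>. Powers of \<open>p + q\<close> thus split and have norm at most
  \<open>2\<close>, which forces the norm down to one. Conversely, compressing \<open>p + q\<close>
  by \<open>p\<close> removes \<open>q\<close> and recovers a power of \<open>p\<close>, of norm
  one.\<close>

lemma norm_add_star_nilpotent: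
  fixes x :: "'a::cstar_algebra"
  assumes x: "norm x = 1" and xx: "x * x = 0"
  shows "norm (x + star x) = 1"
proof -
  define p where "p = x * star x"
  define q where "q = star x * x"
  have ss: "star x * star x = 0" using arg_cong[OF xx, of star] by (simp add: star_simps)
  have pq: "p * q = 0" "q * p = 0"
    using ss xx unfolding p_def q_def by (metis mult.assoc mult_zero_left mult_zero_right)+
  have sp: "star p = p" unfolding p_def by (simp add: star_simps)
  have np: "norm p = 1" "norm q = 1" unfolding p_def q_def
    using norm_star_mult_self[of "star x"] norm_star_mult_self[of x] x by (simp_all add: star_star)
  have pow: "(p + q) ^ Suc m = p ^ Suc m + q ^ Suc m" for m
  proof (induction m)
    case (Suc m)
    have z: "p * q ^ Suc m = 0" "q * p ^ Suc m = 0" using pq by (simp_all flip: mult.assoc)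
    have "(p + q) ^ Suc (Suc m) = (p + q) * (p ^ Suc m + q ^ Suc m)"
      by (simp only: power_Suc[of _ "Suc m"] Suc)
    also have "\<dots> = p * p ^ Suc m + q * q ^ Suc m"
      by (simp only: distrib_left distrib_right z add_0_left add_0_right)
    finally show ?case by (simp only: power_Suc[of _ "Suc m"])
  qed auto
  have h: "(x + star x) * (x + star x) = p + q"
    unfolding p_def q_def using xx ss by (simp add: distrib_left distrib_right)
  have sh: "star (x + star x) = x + star x" by (simp add: star_simps add.commute)
  define c where "c = norm (x + star x)"
  have c2: "c\<^sup>2 = norm (p + q)" unfolding c_def norm_sa_square[OF sh, symmetric] h ..
  have bound: "c ^ 2 ^ Suc n \<le> 2" for n
  proof -
    have "c ^ 2 ^ Suc n = norm ((x + star x) ^ 2 ^ Suc n)"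
      unfolding c_def by (rule norm_sa_power_two[OF sh, symmetric])
    also have "(x + star x) ^ 2 ^ Suc n = (p + q) ^ 2 ^ n"
      by (simp add: power_mult power2_eq_square h)
    also have "\<dots> = p ^ 2 ^ n + q ^ 2 ^ n" using pow[of "2 ^ n - 1"] by simp
    also have "norm \<dots> \<le> norm (p ^ 2 ^ n) + norm (q ^ 2 ^ n)" by (rule norm_triangle_ineq)
    also have "\<dots> \<le> norm p ^ 2 ^ n + norm q ^ 2 ^ n" by (intro add_mono norm_power_ineq)
    finally show ?thesis using np by simp
  qed
  have "c \<le> 1"
  proof (rule ccontr)
    assume c1: "\<not> c \<le> 1"
    then obtain n where n: "2 < c ^ n" using real_arch_pow[of c 2] by auto
    have "n \<le> 2 ^ Suc n" using less_exp[of "Suc n"] by linarith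
    then have "c ^ n \<le> c ^ 2 ^ Suc n" using c1 by (intro power_increasing) auto
    then show False using n bound[of n] by linarith
  qed
  moreover have "1 \<le> c"
  proof -
    have "norm (p ^ 2 ^ 2) = 1" using norm_sa_power_two[OF sp, of 2] np by simp
    also have "p ^ 2 ^ 2 = p * (p + q) * p * p" using pq
      by (simp add: distrib_left distrib_right numeral_eq_Suc mult.assoc)
    finally have "1 \<le> norm (p * (p + q) * p * p)" by simp
    also have "\<dots> \<le> norm (p * (p + q) * p) * norm p" by (rule norm_mult_ineq)
    also have "\<dots> \<le> norm p * norm (p + q) * norm p * norm p"
      by (intro mult_right_mono norm_mult3_le) auto
    finally have "1 \<le> c\<^sup>2" unfolding c2 using np by simp
    then show ?thesis by (simp add: c_def abs_square_le_1[symmetric] power2_nonneg_ge_1_iff)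
  qed
  ultimately show ?thesis unfolding c_def by simp
qed

text \<open>\<open>e\<close> plays the role of a unit vector \<open>v = v\<^sub>1 + v\<^sub>2\<close> with \<open>x v\<^sub>2 = v\<^sub>1\<close> and \<open>x\<^sup>* v\<^sub>1 = v\<^sub>2\<close>, where \<open>b\<close>
  acts on \<open>v\<^sub>1\<close> and \<open>v\<^sub>2\<close> as the scalars \<open>\<beta>\<^sub>1\<close> and \<open>\<beta>\<^sub>2\<close>, all up to small errors.\<close>

lemma compression_estimate:
  fixes x e b :: "'a::cstar_algebra"
  assumes x: "norm x = 1" "x * x = 0" and e: "star e = e" "norm e = 1"
    and he: "norm ((x + star x) * e - e) \<le> \<epsilon>"
    and b1: "norm (b * x - \<beta>1 *\<^sub>R x) \<le> \<delta>" and b2: "norm (b * star x - \<beta>2 *\<^sub>R star x) \<le> \<delta>"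
  shows "norm (e * b * e - ((\<beta>1 + \<beta>2) / 2) *\<^sub>R (e * e)) \<le> 3 * \<epsilon> * (norm b + \<bar>\<beta>1\<bar> + \<bar>\<beta>2\<bar>) + 2 * \<delta>"
proof -
  define p where "p = x * star x"
  define q where "q = star x * x"
  have ss: "star x * star x = 0" using arg_cong[OF x(2), of star] by (simp add: star_simps)
  have n1: "norm (u * v) \<le> d" if "norm u = 1" "norm v \<le> d" for u v :: 'a and d
    using norm_mult_ineq[of u v] that by simp
  have n1': "norm (v * u) \<le> d" if "norm u = 1" "norm v \<le> d" for u v :: 'a and d
    using norm_mult_ineq[of v u] that by simp
  have ep0: "\<epsilon> \<ge> 0" using he norm_ge_zero order_trans by blast
  \<comment> \<open>Multiplying \<open>(x + star x) e = e\<close> by \<open>x\<close> and using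
    \<open>x * x = 0\<close> identifies \<open>p e\<close> with \<open>x e\<close>; likewise
    \<open>q e\<close> with \<open>star x * e\<close>.\<close>
  have "x * ((x + star x) * e - e) = p * e - x * e"
    unfolding p_def by (simp add: distrib_left distrib_right right_diff_distrib x(2) flip: mult.assoc)
  then have pe: "norm (p * e - x * e) \<le> \<epsilon>" using n1[OF x(1) he] by simp
  have "star x * ((x + star x) * e - e) = q * e - star x * e"
    unfolding q_def by (simp add: distrib_left distrib_right right_diff_distrib ss flip: mult.assoc)
  then have qe: "norm (q * e - star x * e) \<le> \<epsilon>" using n1[OF _ he, of "star x"] x(1) by simp
  have epe: "norm (e * p * e - e * x * e) \<le> \<epsilon>" using n1[OF e(2) pe] by (simp add: right_diff_distrib mult.assoc)
  have eqe: "norm (e * q * e - e * star x * e) \<le> \<epsilon>" using n1[OF e(2) qe] by (simp add: right_diff_distrib mult.assoc)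
  have "star (e * p * e - e * x * e) = e * p * e - e * star x * e"
    unfolding p_def by (simp add: star_simps e mult.assoc)
  then have epe': "norm (e * p * e - e * star x * e) \<le> \<epsilon>" using epe norm_star by metis
  have ehe: "norm (e * x * e + e * star x * e - e * e) \<le> \<epsilon>"
    using n1[OF e(2) he] by (simp add: right_diff_distrib distrib_left distrib_right mult.assoc)
  \<comment> \<open>As \<open>e p e\<close> is self-adjoint, it is close to both
    \<open>e x e\<close> and \<open>e (star x) e\<close>, whose sum is close to
    \<open>e * e\<close>.\<close>
  have half_p: "norm (e * p * e - (1/2) *\<^sub>R (e * e)) \<le> 3 * \<epsilon>"
  proof -
    have "2 *\<^sub>R (e * p * e - (1/2) *\<^sub>R (e * e)) = (e * p * e - e * x * e) + (e * p * e - e * star x * e)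
       + (e * x * e + e * star x * e - e * e)"
      by (simp add: scaleR_right_diff_distrib) (simp add: scaleR_2)
    also have "norm \<dots> \<le> \<epsilon> + \<epsilon> + \<epsilon>" by (intro norm_triangle_mono epe epe' ehe)
    finally show ?thesis using ep0 by simp
  qed
  have half_q: "norm (e * q * e - (1/2) *\<^sub>R (e * e)) \<le> 3 * \<epsilon>"
  proof -
    have "2 *\<^sub>R (e * q * e - (1/2) *\<^sub>R (e * e)) = (e * q * e - e * star x * e) + (e * q * e - e * star x * e)
       - (e * p * e - e * star x * e) + (e * p * e - e * x * e)
       + (e * x * e + e * star x * e - e * e)"
      by (simp add: scaleR_right_diff_distrib) (simp add: scaleR_2)
    also have "norm \<dots> \<le> ((\<epsilon> + \<epsilon>) + \<epsilon>) + \<epsilon> + \<epsilon>"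
      by (intro norm_triangle_mono order_trans[OF norm_triangle_ineq4 add_mono] epe epe' ehe eqe)
    finally show ?thesis using ep0 by simp
  qed
  have hh: "norm (p * e + q * e - e) \<le> 3 * \<epsilon>"
  proof -
    have "p * e + q * e - e = (p * e - x * e) + (q * e - star x * e) + ((x + star x) * e - e)"
      by (simp add: distrib_right)
    also have "norm \<dots> \<le> \<epsilon> + \<epsilon> + \<epsilon>" by (intro norm_triangle_mono pe qe he)
    finally show ?thesis by simp
  qed
  \<comment> \<open>Near \<open>e\<close>, \<open>1\<close> may be replaced by \<open>p + q\<close>;
    since \<open>p\<close> begins with \<open>x\<close> and \<open>q\<close> with
    \<open>star x\<close>, \<open>b p\<close> is about \<open>\<beta>1 p\<close> and
    \<open>b q\<close> about \<open>\<beta>2 q\<close>.\<close>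
  have eq: "e * b * e - ((\<beta>1 + \<beta>2) / 2) *\<^sub>R (e * e) =
      e * (b * x - \<beta>1 *\<^sub>R x) * (star x * e) + e * (b * star x - \<beta>2 *\<^sub>R star x) * (x * e)
      + \<beta>1 *\<^sub>R (e * p * e - (1/2) *\<^sub>R (e * e)) + \<beta>2 *\<^sub>R (e * q * e - (1/2) *\<^sub>R (e * e))
      - e * b * (p * e + q * e - e)"
    unfolding p_def q_def
    by (simp add: algebra_simps add_divide_distrib)
  have e1: "norm (e * (b * x - \<beta>1 *\<^sub>R x) * (star x * e)) \<le> \<delta>"
    using norm_mult3_le[of e "b * x - \<beta>1 *\<^sub>R x" "star x * e"] n1[of "star x" e 1] x e b1
      mult_mono[of "norm (b * x - \<beta>1 *\<^sub>R x)" \<delta> "norm (star x * e)" 1] order_trans[OF norm_ge_zero b1] by simp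
  have e2: "norm (e * (b * star x - \<beta>2 *\<^sub>R star x) * (x * e)) \<le> \<delta>"
    using norm_mult3_le[of e "b * star x - \<beta>2 *\<^sub>R star x" "x * e"] n1[of x e 1] x e b2
      mult_mono[of "norm (b * star x - \<beta>2 *\<^sub>R star x)" \<delta> "norm (x * e)" 1] order_trans[OF norm_ge_zero b2] by simp
  have e3: "norm (\<beta>1 *\<^sub>R (e * p * e - (1/2) *\<^sub>R (e * e))) \<le> \<bar>\<beta>1\<bar> * (3 * \<epsilon>)"
    using half_p by (simp add: mult_left_mono)
  have e4: "norm (\<beta>2 *\<^sub>R (e * q * e - (1/2) *\<^sub>R (e * e))) \<le> \<bar>\<beta>2\<bar> * (3 * \<epsilon>)"
    using half_q by (simp add: mult_left_mono)
  have e5: "norm (e * b * (p * e + q * e - e)) \<le> norm b * (3 * \<epsilon>)"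
    using norm_mult3_le[of e b "p * e + q * e - e"] mult_left_mono[OF hh norm_ge_zero[of b]] e by simp
  have "norm (e * b * e - ((\<beta>1 + \<beta>2) / 2) *\<^sub>R (e * e)) \<le>
     \<delta> + \<delta> + \<bar>\<beta>1\<bar> * (3 * \<epsilon>) + \<bar>\<beta>2\<bar> * (3 * \<epsilon>) + norm b * (3 * \<epsilon>)"
    unfolding eq by (intro order_trans[OF norm_triangle_ineq4 add_mono] norm_triangle_mono e1 e2 e3 e4 e5)
  then show ?thesis by (simp add: algebra_simps)
qed

lemma rspec_if_approx_eigen:
  fixes a :: "'a::cstar_algebra"
  assumes "\<And>\<delta>. \<delta> > 0 \<Longrightarrow> \<exists>x. norm x = 1 \<and> norm ((a - l *\<^sub>R 1) * x) \<le> \<delta>"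
  shows "l \<in> rspec a"
proof (rule ccontr)
  assume "l \<notin> rspec a"
  then have inv: "alg_invertible (a - l *\<^sub>R 1)" by (simp add: rspec_iff)
  define R where "R = alg_inv (a - l *\<^sub>R 1)"
  have R0: "norm R + 1 > 0" by (simp add: add_nonneg_pos)
  then obtain x where x: "norm x = 1" "norm ((a - l *\<^sub>R 1) * x) \<le> 1 / (2 * (norm R + 1))"
    using assms[of "1 / (2 * (norm R + 1))"] by auto
  have "x = R * ((a - l *\<^sub>R 1) * x)" unfolding R_def by (simp add: alg_inv_cancel[OF inv])
  then have "1 \<le> norm R * (1 / (2 * (norm R + 1)))"
    using x norm_mult_ineq[of R "(a - l *\<^sub>R 1) * x"] by (metis mult_left_mono norm_ge_zero order_trans)
  also have "\<dots> < 1" using R0 by (simp add: field_simps)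
  finally show False by simp
qed

text \<open>The compressions of \<open>a\<close>, \<open>a\<^sup>2\<close> and \<open>a\<^sup>-\<^sup>2\<close> are as if \<open>a\<close> were the diagonal matrix with entries \<open>l\<close>
  and \<open>m\<close>, and \<open>e\<close> the projection onto the diagonal vector.\<close>

lemma not_central_compression:
  fixes a :: "'a::cstar_algebra"
  assumes a: "cstar_positive a" "alg_invertible a" and nc: "\<not> central a"
  obtains l m where "l \<noteq> m" "0 < l" "0 < m"
    "\<And>\<epsilon>. \<epsilon> > 0 \<Longrightarrow> \<exists>e. cstar_positive e \<and> alg_invertible e \<and> norm e = 1 \<and> cstar_positive (1 - e) \<and>
       norm (e * a * e - ((l + m) / 2) *\<^sub>R (e * e)) \<le> \<epsilon> \<and>
       norm (e * (a * a) * e - ((l\<^sup>2 + m\<^sup>2) / 2) *\<^sub>R (e * e)) \<le> \<epsilon> \<and>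
       norm (e * alg_inv (a * a) * e - ((inverse (l\<^sup>2) + inverse (m\<^sup>2)) / 2) *\<^sub>R (e * e)) \<le> \<epsilon>"
proof -
  note sa = pos_sa[OF a(1)]
  have i2: "alg_invertible (a * a)" using a(2) by (intro alg_invertible_mult)
  define r where "r = alg_inv (a * a)"
  obtain l m where lm: "l \<noteq> m" and off: "\<And>\<delta>. \<delta> > 0 \<Longrightarrow> \<exists>x. norm x = 1 \<and> x * x = 0 \<and>
    norm ((a - l *\<^sub>R 1) * x) \<le> \<delta> \<and> norm (x * (a - m *\<^sub>R 1)) \<le> \<delta>"
    using not_central_off_diagonal[OF a(1) nc] by blast
  have st: "norm ((a - m *\<^sub>R 1) * star x) = norm (x * (a - m *\<^sub>R 1))" for x
    using norm_star[of "x * (a - m *\<^sub>R 1)"] by (simp add: star_simps sa)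
  have pos: "0 < t" if "t \<in> rspec a" for t
  proof -
    have "t \<noteq> 0" using that a(2) by (auto simp: rspec_iff)
    then show ?thesis using pos_rspec[OF a(1) that] by simp
  qed
  have "l \<in> rspec a" by (rule rspec_if_approx_eigen) (use off in blast)
  then have l: "0 < l" by (rule pos)
  have "m \<in> rspec a"
  proof (rule rspec_if_approx_eigen)
    fix \<delta> :: real assume "\<delta> > 0"
    from off[OF this] obtain x where "norm x = 1" "norm (x * (a - m *\<^sub>R 1)) \<le> \<delta>" by blast
    then show "\<exists>x. norm x = 1 \<and> norm ((a - m *\<^sub>R 1) * x) \<le> \<delta>" using st[of x] norm_star[of x] by metis
  qed
  then have m: "0 < m" by (rule pos)
  define B where "B = norm a + l + m"
  define C where "C = B * norm r * (inverse (l\<^sup>2) + inverse (m\<^sup>2))"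
  have B: "B \<ge> 0" unfolding B_def using l m by simp
  have C: "C \<ge> 0" unfolding C_def using B l m by simp
  have sq: "norm (a * a * x - t\<^sup>2 *\<^sub>R x) \<le> B * \<delta>"
    if d: "norm ((a - t *\<^sub>R 1) * x) \<le> \<delta>" and t: "0 < t" "t \<le> l + m" for x t \<delta>
  proof -
    have "a * a * x - t\<^sup>2 *\<^sub>R x = (a + t *\<^sub>R 1) * ((a - t *\<^sub>R 1) * x)"
      by (simp add: algebra_simps power2_eq_square)
    also have "norm \<dots> \<le> norm (a + t *\<^sub>R 1) * norm ((a - t *\<^sub>R 1) * x)" by (rule norm_mult_ineq)
    also have "\<dots> \<le> B * \<delta>"
      using norm_triangle_ineq[of a "t *\<^sub>R 1"] t l m unfolding B_def by (intro mult_mono d) auto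
    finally show ?thesis .
  qed
  have iv: "norm (r * x - inverse (t\<^sup>2) *\<^sub>R x) \<le> C * \<delta>"
    if d: "norm ((a - t *\<^sub>R 1) * x) \<le> \<delta>" and t: "0 < t" "t = l \<or> t = m" for x t \<delta>
  proof -
    have d0: "\<delta> \<ge> 0" using d norm_ge_zero order_trans by blast
    have "r * (a * a * x) = x" unfolding r_def using alg_inv_cancel(2)[OF i2] by (simp add: mult.assoc)
    \<comment> \<open>The error of \<open>r\<close> at \<open>x\<close> is \<open>- r / t^2\<close>
      applied to the error of \<open>a * a\<close>.\<close>
    then have "r * x - inverse (t\<^sup>2) *\<^sub>R x = (- inverse (t\<^sup>2)) *\<^sub>R (r * (a * a * x - t\<^sup>2 *\<^sub>R x))"
      using t by (simp add: right_diff_distrib scaleR_right_diff_distrib)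
    also have "norm \<dots> \<le> inverse (t\<^sup>2) * (norm r * (B * \<delta>))"
      using norm_mult_ineq[of r "a * a * x - t\<^sup>2 *\<^sub>R x"] mult_left_mono[OF sq[OF d t(1)] norm_ge_zero[of r]] t l m
      by (auto intro!: mult_left_mono)
    also have "\<dots> \<le> (inverse (l\<^sup>2) + inverse (m\<^sup>2)) * (norm r * (B * \<delta>))"
      using t B d0 by (intro mult_right_mono) auto
    finally show ?thesis unfolding C_def by (simp add: mult_ac)
  qed
  have "\<exists>e. cstar_positive e \<and> alg_invertible e \<and> norm e = 1 \<and> cstar_positive (1 - e) \<and>
       norm (e * a * e - ((l + m) / 2) *\<^sub>R (e * e)) \<le> \<epsilon> \<and>
       norm (e * (a * a) * e - ((l\<^sup>2 + m\<^sup>2) / 2) *\<^sub>R (e * e)) \<le> \<epsilon> \<and>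
       norm (e * r * e - ((inverse (l\<^sup>2) + inverse (m\<^sup>2)) / 2) *\<^sub>R (e * e)) \<le> \<epsilon>"
    if \<epsilon>: "\<epsilon> > 0" for \<epsilon>
  proof -
    define K where "K = 3 * (norm a + l + m) + 3 * (norm (a * a) + l\<^sup>2 + m\<^sup>2)
       + 3 * (norm r + inverse (l\<^sup>2) + inverse (m\<^sup>2)) + 2 * (1 + B + C)"
    have K: "3 * (norm a + l + m) + 2 * 1 \<le> K" "3 * (norm (a * a) + l\<^sup>2 + m\<^sup>2) + 2 * B \<le> K"
      "3 * (norm r + inverse (l\<^sup>2) + inverse (m\<^sup>2)) + 2 * C \<le> K"
      unfolding K_def using l m B C by (auto simp: add_nonneg_nonneg)
    have "0 < 3 * (norm a + l + m) + 2 * 1" using l m by (simp add: add_nonneg_pos)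
    then have "K > 0" using K(1) by (rule less_le_trans)
    define \<delta> where "\<delta> = \<epsilon> / K"
    have \<delta>: "\<delta> > 0" "K * \<delta> = \<epsilon>" unfolding \<delta>_def using \<epsilon> \<open>K > 0\<close> by auto
    obtain x0 where x0: "norm x0 = 1" "x0 * x0 = 0" "norm ((a - l *\<^sub>R 1) * x0) \<le> \<delta>"
      "norm (x0 * (a - m *\<^sub>R 1)) \<le> \<delta>" using off[OF \<delta>(1)] by blast
    define h0 where "h0 = x0 + star x0"
    have sh0: "star h0 = h0" unfolding h0_def by (simp add: star_simps add.commute)
    have nh0: "norm h0 = 1" unfolding h0_def by (rule norm_add_star_nilpotent[OF x0(1,2)])
    \<comment> \<open>Norm one only puts \<open>1\<close> or \<open>-1\<close> into the spectrum. In
      the second case \<open>- x0\<close> works: none of the other requirements depends on the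
      sign.\<close>
    obtain x where x: "norm x = 1" "x * x = 0" "norm ((a - l *\<^sub>R 1) * x) \<le> \<delta>"
      "norm (x * (a - m *\<^sub>R 1)) \<le> \<delta>" "1 \<in> rspec (x + star x)"
    proof (cases "1 \<in> rspec h0")
      case True
      then show ?thesis using that x0 unfolding h0_def by blast
    next
      case False
      then have "- 1 \<in> rspec h0" using rspec_nonempty[OF sh0] nh0 by simp
      from rspec_minus[OF this] have "1 \<in> rspec (- x0 + star (- x0))"
        unfolding h0_def by (simp add: star_minus add.commute)
      then show ?thesis using x0 by (intro that[of "- x0"]) simp_all
    qed
    have sh: "star (x + star x) = x + star x" by (simp add: star_simps add.commute)
    from peak_element[OF sh x(5) \<delta>(1)] obtain e where e: "cstar_positive e" "alg_invertible e" "norm e = 1"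
      "cstar_positive (1 - e)" "norm ((x + star x - 1 *\<^sub>R 1) * e) \<le> \<delta>" by metis
    have he: "norm ((x + star x) * e - e) \<le> \<delta>" using e(5) by (simp add: left_diff_distrib)
    note ce = compression_estimate[OF x(1,2) pos_sa[OF e(1)] e(3) he]
    have xs: "norm ((a - m *\<^sub>R 1) * star x) \<le> \<delta>" using x(4) st by simp
    have d1: "norm (a * x - l *\<^sub>R x) \<le> \<delta>" "norm (a * star x - m *\<^sub>R star x) \<le> \<delta>"
      using x(3) xs by (simp_all add: left_diff_distrib)
    have d2: "norm (a * a * x - l\<^sup>2 *\<^sub>R x) \<le> B * \<delta>" "norm (a * a * star x - m\<^sup>2 *\<^sub>R star x) \<le> B * \<delta>"
      using sq[OF x(3)] sq[OF xs] l m by auto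
    have d3: "norm (r * x - inverse (l\<^sup>2) *\<^sub>R x) \<le> C * \<delta>" "norm (r * star x - inverse (m\<^sup>2) *\<^sub>R star x) \<le> C * \<delta>"
      using iv[OF x(3)] iv[OF xs] l m by auto
    have "norm (e * a * e - ((l + m) / 2) *\<^sub>R (e * e)) \<le> (3 * (norm a + l + m) + 2 * 1) * \<delta>"
      using ce[OF d1] l m by (simp add: algebra_simps)
    moreover have "norm (e * (a * a) * e - ((l\<^sup>2 + m\<^sup>2) / 2) *\<^sub>R (e * e)) \<le> (3 * (norm (a * a) + l\<^sup>2 + m\<^sup>2) + 2 * B) * \<delta>"
      using ce[OF d2] by (simp add: algebra_simps)
    moreover have "norm (e * r * e - ((inverse (l\<^sup>2) + inverse (m\<^sup>2)) / 2) *\<^sub>R (e * e))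
        \<le> (3 * (norm r + inverse (l\<^sup>2) + inverse (m\<^sup>2)) + 2 * C) * \<delta>"
      using ce[OF d3] by (simp add: algebra_simps)
    ultimately have "norm (e * a * e - ((l + m) / 2) *\<^sub>R (e * e)) \<le> \<epsilon>"
      "norm (e * (a * a) * e - ((l\<^sup>2 + m\<^sup>2) / 2) *\<^sub>R (e * e)) \<le> \<epsilon>"
      "norm (e * r * e - ((inverse (l\<^sup>2) + inverse (m\<^sup>2)) / 2) *\<^sub>R (e * e)) \<le> \<epsilon>"
      using mult_right_mono[OF K(1), of \<delta>] mult_right_mono[OF K(2), of \<delta>]
        mult_right_mono[OF K(3), of \<delta>] \<delta> by linarith+
    then show ?thesis using e(1-4) by blast
  qed
  then show thesis using that[OF lm l m] unfolding r_def by blast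
qed

text \<open>With \<open>f = 1 - e\<close>, a weighted Cauchy-Schwarz argument bounds
  \<open>b\<close> by \<open>(1 + \<eta>) e b e + (1 + 1 / \<eta>) f b f\<close>. The first part is
  controlled by \<open>c\<close>; the second is at most \<open>s f\<close> and completes
  \<open>s e\<close> to \<open>s\<close>.\<close>

lemma compression_upper_bound:
  fixes b e :: "'a::cstar_algebra"
  assumes b: "cstar_positive b" and e: "cstar_positive e" "cstar_positive (1 - e)"
    and ebe: "norm (e * b * e - c *\<^sub>R (e * e)) \<le> \<epsilon>"
    and \<eta>: "\<eta> > 0" and c: "c \<ge> 0" and r: "r \<ge> 0" and s: "(1 + 1 / \<eta>) * norm b \<le> s"
  shows "norm (b + s *\<^sub>R e + r *\<^sub>R (e * e)) \<le> (1 + \<eta>) * (c + \<epsilon>) + s + r"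
proof (rule pos_norm_le_const)
  note se = pos_sa[OF e(1)] and sb = pos_sa[OF b]
  have k0: "0 \<le> (1 + 1 / \<eta>) * norm b" using \<eta> by simp
  then have s0: "s \<ge> 0" using s by linarith
  show "cstar_positive (b + s *\<^sub>R e + r *\<^sub>R (e * e))"
    by (intro pos_add pos_scaleR b e(1) pos_square se s0 r)
  define f where "f = 1 - e"
  have sf: "star f = f" unfolding f_def by (simp add: star_simps se)
  have pf: "cstar_positive f" unfolding f_def by (rule e(2))
  have ef: "cstar_positive (e * f)"
    by (rule pos_mult_commute[OF e(1) pf]) (simp add: f_def algebra_simps)
  have one_ee: "1 - e * e = f + e * f" unfolding f_def by (simp add: algebra_simps)
  then have pee: "cstar_positive (1 - e * e)" using pos_add[OF pf ef] by simp
  define P Q R S where "P = e * b * e" and "Q = e * b * f" and "R = f * b * e" and "S = f * b * f"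
  have b_eq: "b = P + Q + R + S" unfolding P_def Q_def R_def S_def f_def by (simp add: algebra_simps)
  \<comment> \<open>Conjugating \<open>b\<close> by this combination isolates the cross terms
    \<open>Q + R\<close> with weights \<open>\<eta>\<close> on \<open>P\<close> and
    \<open>1 / \<eta>\<close> on \<open>S\<close>.\<close>
  define g where "g = sqrt \<eta> *\<^sub>R e - (1 / sqrt \<eta>) *\<^sub>R f"
  have sg: "star g = g" unfolding g_def by (simp add: star_simps se sf)
  have T1: "cstar_positive (\<eta> *\<^sub>R P - Q - R + (1 / \<eta>) *\<^sub>R S)"
  proof -
    have "g * b * g = \<eta> *\<^sub>R P - Q - R + (1 / \<eta>) *\<^sub>R S"
      unfolding g_def P_def Q_def R_def S_def using \<eta>
      by (simp add: algebra_simps power2_eq_square[symmetric] power_divide)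
    then show ?thesis using pos_conj_sa[OF b sg] by simp
  qed
  have T2: "cstar_positive ((1 + \<eta>) *\<^sub>R (\<epsilon> *\<^sub>R 1 - (P - c *\<^sub>R (e * e))))"
    using \<eta> ebe unfolding P_def
    by (intro pos_scaleR pos_const_diff_norm) (simp_all add: star_simps se sb mult.assoc)
  have T3: "cstar_positive (((1 + \<eta>) * c) *\<^sub>R (1 - e * e))" using \<eta> c by (intro pos_scaleR pee) auto
  have T4: "cstar_positive ((1 + 1 / \<eta>) *\<^sub>R (norm b *\<^sub>R (f * f) - S))"
  proof -
    have "cstar_positive (f * (norm b *\<^sub>R 1 - b) * f)"
      by (intro pos_conj_sa pos_const_diff_norm sb sf) simp
    also have "f * (norm b *\<^sub>R 1 - b) * f = norm b *\<^sub>R (f * f) - S"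
      unfolding S_def by (simp add: algebra_simps)
    finally show ?thesis using \<eta> by (intro pos_scaleR) auto
  qed
  have T5: "cstar_positive ((s - (1 + 1 / \<eta>) * norm b) *\<^sub>R f + ((1 + 1 / \<eta>) * norm b) *\<^sub>R (e * f))"
    using s k0 by (intro pos_add pos_scaleR pf ef) auto
  have T6: "cstar_positive (r *\<^sub>R (1 - e * e))" by (intro pos_scaleR pee r)
  have fe: "e * f = f - f * f" unfolding f_def by (simp add: algebra_simps)
  have e_eq: "e = 1 - f" unfolding f_def by simp
  \<comment> \<open>In order: the cross terms are traded for \<open>P\<close> and \<open>S\<close>;
    two terms bound \<open>(1 + \<eta>) P\<close>; two dominate \<open>(1 + 1 / \<eta>) S\<close> by
    \<open>s f\<close>, using \<open>f * f + e * f = f\<close>; the last bounds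
    \<open>r (e * e)\<close>.\<close>
  have "((1 + \<eta>) * (c + \<epsilon>) + s + r) *\<^sub>R 1 - (b + s *\<^sub>R e + r *\<^sub>R (e * e)) =
    (\<eta> *\<^sub>R P - Q - R + (1 / \<eta>) *\<^sub>R S) + (1 + \<eta>) *\<^sub>R (\<epsilon> *\<^sub>R 1 - (P - c *\<^sub>R (e * e)))
    + ((1 + \<eta>) * c) *\<^sub>R (1 - e * e) + (1 + 1 / \<eta>) *\<^sub>R (norm b *\<^sub>R (f * f) - S)
    + ((s - (1 + 1 / \<eta>) * norm b) *\<^sub>R f + ((1 + 1 / \<eta>) * norm b) *\<^sub>R (e * f)) + r *\<^sub>R (1 - e * e)"
  proof -
    define n where "n = norm b"
    define k where "k = 1 / \<eta>"
    define E where "E = e * e"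
    define F where "F = f * f"
    show ?thesis unfolding n_def[symmetric] fe k_def[symmetric] E_def[symmetric] F_def[symmetric]
      unfolding b_eq e_eq[unfolded f_def, symmetric] by (subst (1) e_eq) (simp add: algebra_simps)
  qed
  then show "cstar_positive (((1 + \<eta>) * (c + \<epsilon>) + s + r) *\<^sub>R 1 - (b + s *\<^sub>R e + r *\<^sub>R (e * e)))"
    using pos_add[OF pos_add[OF pos_add[OF pos_add[OF pos_add[OF T1 T2] T3] T4] T5] T6] by simp
qed

text \<open>The square in the hypothesis on \<open>\<epsilon>\<close> is the price of
  \<open>norm_diff_sq_le\<close>, and the reason why compressions are later requested with tolerance
  \<open>\<epsilon>\<^sup>2\<close>.\<close>

lemma pos_sqrt_approx:
  fixes e b :: "'a::cstar_algebra"
  assumes e: "cstar_positive e" and b: "cstar_positive b" and t: "t \<ge> 0" and k: "k \<ge> 0" and \<epsilon>: "\<epsilon> \<ge> 0"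
    and est: "norm (e * b * e - k\<^sup>2 *\<^sub>R (e * e)) \<le> \<epsilon>\<^sup>2"
  shows "norm (pos_sqrt ((t *\<^sub>R e) * b * (t *\<^sub>R e)) - (t * k) *\<^sub>R e) \<le> t * \<epsilon>"
proof (rule power2_le_imp_le)
  have te: "cstar_positive ((t *\<^sub>R e) * b * (t *\<^sub>R e))"
    by (intro pos_conj_sa b) (simp add: star_simps pos_sa[OF e])
  let ?Y = "pos_sqrt ((t *\<^sub>R e) * b * (t *\<^sub>R e))" and ?T = "(t * k) *\<^sub>R e"
  have "(norm (?Y - ?T))\<^sup>2 \<le> norm (?Y * ?Y - ?T * ?T)"
    using t k by (intro norm_diff_sq_le pos_sqrt_pos te pos_scaleR e) auto
  also have "?Y * ?Y - ?T * ?T = t\<^sup>2 *\<^sub>R (e * b * e - k\<^sup>2 *\<^sub>R (e * e))"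
    unfolding pos_sqrt_mult_self[OF te] by (simp add: algebra_simps power2_eq_square)
  also have "norm \<dots> \<le> (t * \<epsilon>)\<^sup>2" using est by (simp add: power_mult_distrib mult_left_mono)
  finally show "(norm (?Y - ?T))\<^sup>2 \<le> (t * \<epsilon>)\<^sup>2" .
qed (use t \<epsilon> in simp)

lemma norm_sandwich_le: "norm e = 1 \<Longrightarrow> norm (e * z * e) \<le> norm (z::'a::cstar_algebra)"
  using norm_mult3_le[of e z e] by simp

text \<open>The left norm is bounded above through the compression of \<open>a\<close>, the right
  one below by evaluation at the spectral value \<open>1\<close> of \<open>e\<close>. After taking
  roots both are \<open>t * \<alpha>\<close> plus a constant, and the constants
  \<open>(1 + \<eta>) * \<beta>\<close> and \<open>\<alpha>\<close> are in the wrong order.\<close>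

lemma central_if_wasserstein_eq:
  fixes a :: "'a::cstar_algebra"
  assumes a: "cstar_positive a" "alg_invertible a"
    and eq: "\<And>g. g \<in> pos_inv \<Longrightarrow>
      (norm (a + pos_sqrt (g * (a * a) * g)))\<^sup>2 = norm (a * a + g * (a * a) * g + a * a * g + g * (a * a))"
  shows "central a"
proof (rule ccontr)
  assume "\<not> central a"
  from not_central_compression[OF a this] obtain l m where lm: "l \<noteq> m" "0 < l" "0 < m" and
    comp: "\<And>\<epsilon>. \<epsilon> > 0 \<Longrightarrow> \<exists>e. cstar_positive e \<and> alg_invertible e \<and> norm e = 1 \<and> cstar_positive (1 - e) \<and>
       norm (e * a * e - ((l + m) / 2) *\<^sub>R (e * e)) \<le> \<epsilon> \<and>
       norm (e * (a * a) * e - ((l\<^sup>2 + m\<^sup>2) / 2) *\<^sub>R (e * e)) \<le> \<epsilon>" by metis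
  define \<beta> where "\<beta> = (l + m) / 2"
  define \<alpha> where "\<alpha> = sqrt ((l\<^sup>2 + m\<^sup>2) / 2)"
  have \<beta>: "\<beta> > 0" unfolding \<beta>_def using lm by simp
  have \<alpha>2: "\<alpha>\<^sup>2 = (l\<^sup>2 + m\<^sup>2) / 2" unfolding \<alpha>_def by simp
  have "0 < (l - m)\<^sup>2" using lm by simp
  then have "\<beta>\<^sup>2 < \<alpha>\<^sup>2" unfolding \<alpha>2 \<beta>_def by (simp add: power2_eq_square field_simps)
  then have \<beta>\<alpha>: "\<beta> < \<alpha>" by (rule power2_less_imp_less) (simp add: \<alpha>_def)
  \<comment> \<open>This makes \<open>(1 + \<eta>) * \<beta>\<close> the midpoint of
    \<open>\<beta>\<close> and \<open>\<alpha>\<close>.\<close>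
  define \<eta> where "\<eta> = (\<alpha> - \<beta>) / (2 * \<beta>)"
  have \<eta>: "\<eta> > 0" "(1 + \<eta>) * \<beta> < \<alpha>" unfolding \<eta>_def using \<beta> \<beta>\<alpha> by (simp_all add: field_simps)
  \<comment> \<open>Chosen so that \<open>s = t * \<alpha>\<close> meets the threshold of
    \<open>compression_upper_bound\<close> for \<open>b = a\<close>.\<close>
  define t where "t = (1 + 1 / \<eta>) * norm a / \<alpha>"
  have t: "t \<ge> 0" "(1 + 1 / \<eta>) * norm a \<le> t * \<alpha>" unfolding t_def using \<beta> \<beta>\<alpha> \<eta> by simp_all
  have main: "(\<alpha>\<^sup>2 - \<epsilon>) * (1 + t)\<^sup>2 \<le> ((1 + \<eta>) * (\<beta> + \<epsilon>) + t * \<alpha> + t * \<epsilon>)\<^sup>2" if \<epsilon>: "0 < \<epsilon>" "\<epsilon> \<le> 1" for \<epsilon>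
  proof -
    have "\<epsilon>\<^sup>2 \<le> \<epsilon>" using \<epsilon> by (simp add: power2_eq_square mult_left_le)
    with comp[of "\<epsilon>\<^sup>2"] \<epsilon> obtain e where e: "cstar_positive e" "alg_invertible e" "norm e = 1" "cstar_positive (1 - e)"
      and e1: "norm (e * a * e - \<beta> *\<^sub>R (e * e)) \<le> \<epsilon>"
      and e2: "norm (e * (a * a) * e - \<alpha>\<^sup>2 *\<^sub>R (e * e)) \<le> \<epsilon>\<^sup>2"
      and e2': "norm (e * (a * a) * e - \<alpha>\<^sup>2 *\<^sub>R (e * e)) \<le> \<epsilon>"
      unfolding \<beta>_def \<alpha>2 by (meson order_trans zero_less_power)
    note se = pos_sa[OF e(1)]
    have aa: "cstar_positive (a * a)" by (rule pos_square[OF pos_sa[OF a(1)]])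
    show ?thesis
    proof (cases "t = 0")
      case True
      have "norm a = 0" using True \<beta> \<beta>\<alpha> \<eta> unfolding t_def by (simp add: add_nonneg_eq_0_iff)
      then have "a = 0" by simp
      then show ?thesis using a(2) by (simp add: alg_invertible_def)
    next
      case False
      then have t0: "t > 0" using t by simp
      define g where "g = t *\<^sub>R e"
      have g: "g \<in> pos_inv" unfolding g_def pos_inv_def using e t0 by (simp add: pos_scaleR alg_invertible_scaleR)
      define Y where "Y = pos_sqrt (g * (a * a) * g)"
      define Z where "Z = a * a + g * (a * a) * g + a * a * g + g * (a * a)"
      have "norm (Y - (t * \<alpha>) *\<^sub>R e) \<le> t * \<epsilon>" unfolding Y_def g_def
        using \<epsilon> \<beta> \<beta>\<alpha> by (intro pos_sqrt_approx e aa t e2) auto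
      moreover have "norm (a + (t * \<alpha>) *\<^sub>R e + 0 *\<^sub>R (e * e)) \<le> (1 + \<eta>) * (\<beta> + \<epsilon>) + t * \<alpha> + 0"
        using \<beta> by (intro compression_upper_bound a e e1 \<eta> t) auto
      ultimately have up: "norm (a + Y) \<le> (1 + \<eta>) * (\<beta> + \<epsilon>) + t * \<alpha> + t * \<epsilon>"
        using norm_triangle_ineq[of "a + (t * \<alpha>) *\<^sub>R e" "Y - (t * \<alpha>) *\<^sub>R e"] by simp
      define R where "R = e * (a * a) * e - \<alpha>\<^sup>2 *\<^sub>R (e * e)"
      have nR: "norm R \<le> \<epsilon>" unfolding R_def by (rule e2')
      have eaae: "e * (a * a) * e = \<alpha>\<^sup>2 *\<^sub>R (e * e) + R" unfolding R_def by simp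
      \<comment> \<open>Here \<open>Z = (1 + g) * (a * a) * (1 + g)\<close> and \<open>g\<close>
        commutes with \<open>e\<close>, so \<open>e * Z * e\<close> is close to
        \<open>\<alpha>\<^sup>2 *\<^sub>R (w * w)\<close> with
        \<open>w = (1 + g) * e\<close>.\<close>
      define w where "w = e + t *\<^sub>R (e * e)"
      have sw: "star w = w" unfolding w_def by (simp add: star_simps se)
      have nw: "norm w \<ge> 1 + t"
      proof -
        have "1 \<in> rspec e" using pos_norm_in_rspec[OF e(1)] e(3) by simp
        from rpoly_at_norm_ge[OF this, of "[:0, 1, t:]"] t show ?thesis
          by (simp add: w_def distrib_left)
      qed
      define T where "T = e * (a * a) * e"
      have "e * Z * e = T + t\<^sup>2 *\<^sub>R (e * T * e) + t *\<^sub>R (T * e) + t *\<^sub>R (e * T)"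
        unfolding Z_def g_def T_def by (simp add: algebra_simps power2_eq_square)
      also have "\<dots> = \<alpha>\<^sup>2 *\<^sub>R (w * w) + (R + t\<^sup>2 *\<^sub>R (e * R * e) + t *\<^sub>R (R * e) + t *\<^sub>R (e * R))"
        unfolding T_def eaae w_def by (simp add: algebra_simps power2_eq_square)
      finally have eZe: "\<alpha>\<^sup>2 *\<^sub>R (w * w) = e * Z * e - (R + t\<^sup>2 *\<^sub>R (e * R * e) + t *\<^sub>R (R * e) + t *\<^sub>R (e * R))"
        by simp
      have "\<alpha>\<^sup>2 * (1 + t)\<^sup>2 \<le> \<alpha>\<^sup>2 * (norm w)\<^sup>2" using nw t by (intro mult_left_mono power_mono) auto
      also have "\<dots> = norm (\<alpha>\<^sup>2 *\<^sub>R (w * w))" by (simp add: norm_sa_square[OF sw])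
      also have "\<dots> \<le> norm Z + (\<epsilon> + t\<^sup>2 * \<epsilon> + t * \<epsilon> + t * \<epsilon>)"
        unfolding eZe
      proof (intro order_trans[OF norm_triangle_ineq4 add_mono] norm_triangle_mono nR)
        show "norm (e * Z * e) \<le> norm Z" by (rule norm_sandwich_le[OF e(3)])
        show "norm (t\<^sup>2 *\<^sub>R (e * R * e)) \<le> t\<^sup>2 * \<epsilon>"
          using norm_sandwich_le[OF e(3), of R] nR by (simp add: mult_left_mono)
        show "norm (t *\<^sub>R (R * e)) \<le> t * \<epsilon>"
          using norm_mult_ineq[of R e] nR e(3) t by (simp add: mult_left_mono)
        show "norm (t *\<^sub>R (e * R)) \<le> t * \<epsilon>"
          using norm_mult_ineq[of e R] nR e(3) t by (simp add: mult_left_mono)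
      qed
      also have "norm Z = (norm (a + Y))\<^sup>2" unfolding Z_def Y_def eq[OF g] ..
      finally have "(\<alpha>\<^sup>2 - \<epsilon>) * (1 + t)\<^sup>2 \<le> (norm (a + Y))\<^sup>2"
        by (simp add: algebra_simps power2_eq_square)
      also have "\<dots> \<le> ((1 + \<eta>) * (\<beta> + \<epsilon>) + t * \<alpha> + t * \<epsilon>)\<^sup>2" using up by (intro power_mono) auto
      finally show ?thesis .
    qed
  qed
  have "(\<lambda>n. (\<alpha>\<^sup>2 - inverse (real (Suc n))) * (1 + t)\<^sup>2) \<longlonglongrightarrow> (\<alpha>\<^sup>2 - 0) * (1 + t)\<^sup>2"
    by (intro tendsto_intros LIMSEQ_inverse_real_of_nat)
  moreover have "(\<lambda>n. ((1 + \<eta>) * (\<beta> + inverse (real (Suc n))) + t * \<alpha> + t * inverse (real (Suc n)))\<^sup>2)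
      \<longlonglongrightarrow> ((1 + \<eta>) * (\<beta> + 0) + t * \<alpha> + t * 0)\<^sup>2"
    by (intro tendsto_intros LIMSEQ_inverse_real_of_nat)
  ultimately have "(\<alpha>\<^sup>2 - 0) * (1 + t)\<^sup>2 \<le> ((1 + \<eta>) * (\<beta> + 0) + t * \<alpha> + t * 0)\<^sup>2"
    by (rule LIMSEQ_le) (intro exI[of _ 0] allI impI main; simp add: inverse_le_1_iff)
  then have "(\<alpha> * (1 + t))\<^sup>2 \<le> ((1 + \<eta>) * \<beta> + t * \<alpha>)\<^sup>2" by (simp add: power_mult_distrib)
  then have "\<alpha> * (1 + t) \<le> (1 + \<eta>) * \<beta> + t * \<alpha>"
    by (rule power2_le_imp_le) (use \<beta> \<beta>\<alpha> \<eta> t in simp)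
  then show False using \<eta>(2) by (simp add: algebra_simps)
qed

text \<open>Here the left norm is bounded below and the right one above. The terms
  \<open>(t * \<gamma>) ^ 2\<close> cancel and the linear terms compare
  \<open>\<beta> * \<gamma>\<close> with \<open>1\<close>, so the crude weight
  \<open>\<eta> = 1\<close> in \<open>compression_upper_bound\<close> is enough.\<close>

lemma central_if_kubo_ando_eq:
  fixes a :: "'a::cstar_algebra"
  assumes a: "cstar_positive a" "alg_invertible a"
    and eq: "\<And>g. g \<in> pos_inv \<Longrightarrow>
      (norm (a + pos_sqrt (g * alg_inv (a * a) * g)))\<^sup>2 = norm (a * a + g * alg_inv (a * a) * g + 2 *\<^sub>R g)"
  shows "central a"
proof (rule ccontr)
  assume "\<not> central a"
  from not_central_compression[OF a this] obtain l m where lm: "l \<noteq> m" "0 < l" "0 < m" and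
    comp: "\<And>\<epsilon>. \<epsilon> > 0 \<Longrightarrow> \<exists>e. cstar_positive e \<and> alg_invertible e \<and> norm e = 1 \<and> cstar_positive (1 - e) \<and>
       norm (e * a * e - ((l + m) / 2) *\<^sub>R (e * e)) \<le> \<epsilon> \<and>
       norm (e * (a * a) * e - ((l\<^sup>2 + m\<^sup>2) / 2) *\<^sub>R (e * e)) \<le> \<epsilon> \<and>
       norm (e * alg_inv (a * a) * e - ((inverse (l\<^sup>2) + inverse (m\<^sup>2)) / 2) *\<^sub>R (e * e)) \<le> \<epsilon>" by metis
  have sa: "star a = a" by (rule pos_sa[OF a(1)])
  have i2: "alg_invertible (a * a)" using a(2) by (intro alg_invertible_mult)
  define r where "r = alg_inv (a * a)"
  have pr: "cstar_positive r"
  proof -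
    have "star (alg_inv a) = alg_inv a" by (simp add: star_alg_inv a sa)
    then show ?thesis unfolding r_def alg_inv_mult[OF a(2) a(2)] by (rule pos_square)
  qed
  define \<beta> where "\<beta> = (l + m) / 2"
  define \<alpha> where "\<alpha> = (l\<^sup>2 + m\<^sup>2) / 2"
  define \<gamma> where "\<gamma> = sqrt ((inverse (l\<^sup>2) + inverse (m\<^sup>2)) / 2)"
  have \<beta>: "\<beta> > 0" and \<alpha>: "\<alpha> > 0" unfolding \<beta>_def \<alpha>_def using lm by (simp_all add: add_pos_pos)
  have \<gamma>2: "\<gamma>\<^sup>2 = (inverse (l\<^sup>2) + inverse (m\<^sup>2)) / 2" unfolding \<gamma>_def by simp
  have \<gamma>: "\<gamma> > 0" unfolding \<gamma>_def using lm by (simp add: add_pos_pos)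
  have \<beta>\<gamma>: "1 < \<beta> * \<gamma>"
  proof -
    have d: "0 < (l - m)\<^sup>2" using lm by simp
    have "(\<beta> * \<gamma>)\<^sup>2 = (l + m)\<^sup>2 * (l\<^sup>2 + m\<^sup>2) / (8 * (l * m)\<^sup>2)"
      unfolding power_mult_distrib \<gamma>2 \<beta>_def using lm by (simp add: field_simps)
    \<comment> \<open>Written in \<open>(l - m) ^ 2\<close> and \<open>l * m\<close>, the excess
      over the value at \<open>l = m\<close> is visibly positive.\<close>
    moreover have "(l + m)\<^sup>2 * (l\<^sup>2 + m\<^sup>2) = 8 * (l * m)\<^sup>2 + (l - m)\<^sup>2 * ((l - m)\<^sup>2 + 6 * (l * m))"
      by (simp add: power2_eq_square algebra_simps)
    moreover have "0 < (l - m)\<^sup>2 * ((l - m)\<^sup>2 + 6 * (l * m))" using d lm by (intro mult_pos_pos add_pos_pos) auto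
    ultimately have "1 < (\<beta> * \<gamma>)\<^sup>2" using lm by simp
    then have "1\<^sup>2 < (\<beta> * \<gamma>)\<^sup>2" by simp
    then show ?thesis by (rule power2_less_imp_less) (use \<beta> \<gamma> in simp)
  qed
  \<comment> \<open>The first summand meets the compression threshold with \<open>s = 2 * t\<close>;
    the second makes \<open>t * (\<beta> * \<gamma> - 1)\<close> at least \<open>\<alpha>\<close>,
    which the final inequality contradicts.\<close>
  define t where "t = norm (a * a) + \<alpha> / (\<beta> * \<gamma> - 1)"
  have t: "t > 0" "norm (a * a) \<le> t" "\<alpha> / (\<beta> * \<gamma> - 1) \<le> t"
    unfolding t_def using \<alpha> \<beta>\<gamma> by (auto intro: add_nonneg_pos)
  have main: "\<beta> + t * \<gamma> - \<epsilon> - t * \<epsilon> \<le> sqrt (2 * (\<alpha> + \<epsilon>) + 2 * t + (t * \<gamma>)\<^sup>2 + t\<^sup>2 * \<epsilon>)"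
    if \<epsilon>: "0 < \<epsilon>" "\<epsilon> \<le> 1" for \<epsilon>
  proof -
    have "\<epsilon>\<^sup>2 \<le> \<epsilon>" using \<epsilon> by (simp add: power2_eq_square mult_left_le)
    with comp[of "\<epsilon>\<^sup>2"] \<epsilon> obtain e where e: "cstar_positive e" "alg_invertible e" "norm e = 1" "cstar_positive (1 - e)"
      and e1: "norm (e * a * e - \<beta> *\<^sub>R (e * e)) \<le> \<epsilon>"
      and e2: "norm (e * (a * a) * e - \<alpha> *\<^sub>R (e * e)) \<le> \<epsilon>"
      and e3: "norm (e * r * e - \<gamma>\<^sup>2 *\<^sub>R (e * e)) \<le> \<epsilon>\<^sup>2"
      and e3': "norm (e * r * e - \<gamma>\<^sup>2 *\<^sub>R (e * e)) \<le> \<epsilon>"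
      unfolding \<beta>_def \<alpha>_def \<gamma>2 r_def by (meson order_trans zero_less_power)
    have aa: "cstar_positive (a * a)" by (rule pos_square[OF sa])
    define g where "g = t *\<^sub>R e"
    have g: "g \<in> pos_inv" unfolding g_def pos_inv_def using e t by (simp add: pos_scaleR alg_invertible_scaleR)
    define Y where "Y = pos_sqrt (g * r * g)"
    define Z where "Z = a * a + g * r * g + 2 *\<^sub>R g"
    have Ye: "norm (Y - (t * \<gamma>) *\<^sub>R e) \<le> t * \<epsilon>" unfolding Y_def g_def
      using \<epsilon> \<gamma> t by (intro pos_sqrt_approx e pr e3) auto
    have low: "\<beta> + t * \<gamma> - \<epsilon> \<le> norm (a + (t * \<gamma>) *\<^sub>R e)"
    proof -
      \<comment> \<open>The compression of \<open>a + (t * \<gamma>) e\<close> by \<open>e\<close>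
        is nearly this polynomial in \<open>e\<close>, whose value at the spectral point
        \<open>1\<close> is \<open>\<beta> + t * \<gamma>\<close>.\<close>
      define w where "w = \<beta> *\<^sub>R (e * e) + (t * \<gamma>) *\<^sub>R (e * e * e)"
      have "1 \<in> rspec e" using pos_norm_in_rspec[OF e(1)] e(3) by simp
      from rpoly_at_norm_ge[OF this, of "[:0, 0, \<beta>, t * \<gamma>:]"]
      have "\<beta> + t * \<gamma> \<le> norm w" by (simp add: w_def distrib_left mult.assoc)
      also have "w = e * (a + (t * \<gamma>) *\<^sub>R e) * e - (e * a * e - \<beta> *\<^sub>R (e * e))"
        unfolding w_def by (simp add: algebra_simps)
      also have "norm \<dots> \<le> norm (a + (t * \<gamma>) *\<^sub>R e) + \<epsilon>"
        by (intro order_trans[OF norm_triangle_ineq4 add_mono] norm_sandwich_le e e1)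
      finally show ?thesis by simp
    qed
    have "norm (a + (t * \<gamma>) *\<^sub>R e) \<le> norm (a + Y) + norm (Y - (t * \<gamma>) *\<^sub>R e)"
      using norm_triangle_ineq4[of "a + Y" "Y - (t * \<gamma>) *\<^sub>R e"] by (simp add: algebra_simps)
    with low Ye have "\<beta> + t * \<gamma> - \<epsilon> - t * \<epsilon> \<le> norm (a + Y)" by linarith
    also have "\<dots> = sqrt ((norm (a + Y))\<^sup>2)" by simp
    also have "(norm (a + Y))\<^sup>2 = norm Z" unfolding Z_def Y_def r_def eq[OF g] ..
    also have "sqrt (norm Z) \<le> sqrt (2 * (\<alpha> + \<epsilon>) + 2 * t + (t * \<gamma>)\<^sup>2 + t\<^sup>2 * \<epsilon>)"
    proof (rule real_sqrt_le_mono)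
      have "Z = (a * a + (2 * t) *\<^sub>R e + (t * \<gamma>)\<^sup>2 *\<^sub>R (e * e)) + t\<^sup>2 *\<^sub>R (e * r * e - \<gamma>\<^sup>2 *\<^sub>R (e * e))"
        unfolding Z_def g_def by (simp add: algebra_simps power2_eq_square)
      also have "norm \<dots> \<le> ((1 + 1) * (\<alpha> + \<epsilon>) + 2 * t + (t * \<gamma>)\<^sup>2) + t\<^sup>2 * \<epsilon>"
      proof (rule norm_triangle_mono)
        show "norm (a * a + (2 * t) *\<^sub>R e + (t * \<gamma>)\<^sup>2 *\<^sub>R (e * e)) \<le> (1 + 1) * (\<alpha> + \<epsilon>) + 2 * t + (t * \<gamma>)\<^sup>2"
          using \<alpha> t by (intro compression_upper_bound aa e e2) auto
        show "norm (t\<^sup>2 *\<^sub>R (e * r * e - \<gamma>\<^sup>2 *\<^sub>R (e * e))) \<le> t\<^sup>2 * \<epsilon>"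
          using e3' by (simp add: mult_left_mono)
      qed
      finally show "norm Z \<le> 2 * (\<alpha> + \<epsilon>) + 2 * t + (t * \<gamma>)\<^sup>2 + t\<^sup>2 * \<epsilon>" by simp
    qed
    finally show ?thesis .
  qed
  have "(\<lambda>n. \<beta> + t * \<gamma> - inverse (real (Suc n)) - t * inverse (real (Suc n))) \<longlonglongrightarrow> \<beta> + t * \<gamma> - 0 - t * 0"
    by (intro tendsto_intros LIMSEQ_inverse_real_of_nat)
  moreover have "(\<lambda>n. sqrt (2 * (\<alpha> + inverse (real (Suc n))) + 2 * t + (t * \<gamma>)\<^sup>2 + t\<^sup>2 * inverse (real (Suc n))))
      \<longlonglongrightarrow> sqrt (2 * (\<alpha> + 0) + 2 * t + (t * \<gamma>)\<^sup>2 + t\<^sup>2 * 0)"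
    by (intro tendsto_intros LIMSEQ_inverse_real_of_nat)
  ultimately have "\<beta> + t * \<gamma> - 0 - t * 0 \<le> sqrt (2 * (\<alpha> + 0) + 2 * t + (t * \<gamma>)\<^sup>2 + t\<^sup>2 * 0)"
    by (rule LIMSEQ_le) (intro exI[of _ 0] allI impI main; simp add: inverse_le_1_iff)
  then have "\<beta> + t * \<gamma> \<le> sqrt (2 * \<alpha> + 2 * t + (t * \<gamma>)\<^sup>2)" by simp
  then have "(\<beta> + t * \<gamma>)\<^sup>2 \<le> 2 * \<alpha> + 2 * t + (t * \<gamma>)\<^sup>2"
    using \<beta> \<gamma> t by (simp add: real_le_rsqrt sqrt_ge_absD)
  then have "2 * (t * (\<beta> * \<gamma> - 1)) + \<beta>\<^sup>2 \<le> 2 * \<alpha>" by (simp add: power2_eq_square algebra_simps)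
  moreover have "\<alpha> \<le> t * (\<beta> * \<gamma> - 1)" using t(3) \<beta>\<gamma> by (simp add: pos_divide_le_eq)
  ultimately show False using \<beta> zero_less_power[of \<beta> 2] by linarith
qed

section \<open>Geometric means and reduction of the norm equalities\<close>

lemma pos_inv_sqrt:
  assumes "A \<in> pos_inv"
  shows "cstar_positive (pos_sqrt A)" "alg_invertible (pos_sqrt A)" "pos_sqrt A * pos_sqrt A = A"
    "star (pos_sqrt A) = pos_sqrt A"
    "star (alg_inv (pos_sqrt A)) = alg_inv (pos_sqrt A)"
    "alg_inv A = alg_inv (pos_sqrt A) * alg_inv (pos_sqrt A)"
proof -
  have A: "cstar_positive A" "alg_invertible A" using assms by (auto simp: pos_inv_def)
  show s: "cstar_positive (pos_sqrt A)" and m: "pos_sqrt A * pos_sqrt A = A"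
    using A by (simp_all add: pos_sqrt_pos pos_sqrt_mult_self)
  show i: "alg_invertible (pos_sqrt A)"
    by (rule alg_invertible_factor_left[OF refl]) (simp add: m A)
  show ss: "star (pos_sqrt A) = pos_sqrt A" by (rule pos_sa[OF s])
  show "star (alg_inv (pos_sqrt A)) = alg_inv (pos_sqrt A)" by (simp add: star_alg_inv i ss)
  show "alg_inv A = alg_inv (pos_sqrt A) * alg_inv (pos_sqrt A)"
    using alg_inv_mult[OF i i] m by simp
qed

lemma alg_inv_pos_inv: assumes "A \<in> pos_inv" shows "alg_inv A \<in> pos_inv"
proof -
  have "cstar_positive (alg_inv A)" unfolding pos_inv_sqrt(6)[OF assms]
    by (rule pos_square[OF pos_inv_sqrt(5)[OF assms]])
  then show ?thesis using assms by (simp add: pos_inv_def alg_invertible_alg_inv)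
qed

text \<open>\<open>A # B\<close> is the positive solution \<open>g\<close> of the Riccati equation \<open>g A\<^sup>-\<^sup>1 g = B\<close>.\<close>

lemma geo_mean_riccati:
  assumes A: "A \<in> pos_inv" and g: "cstar_positive g"
  shows "geo_mean A (g * alg_inv A * g) = g"
proof -
  note a = pos_inv_sqrt[OF A]
  define b where "b = alg_inv (pos_sqrt A)"
  \<comment> \<open>Splitting \<open>alg_inv A\<close> as \<open>b * b\<close> exhibits a perfect
    square, so the inner root in \<open>geo_mean\<close> is \<open>b * g * b\<close>.\<close>
  have "b * (g * alg_inv A * g) * b = (b * g * b) * (b * g * b)"
    unfolding a(6) b_def by (simp add: mult.assoc)
  moreover have "cstar_positive (b * g * b)" by (rule pos_conj_sa[OF g]) (simp add: b_def a(5))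
  ultimately have "pos_sqrt (b * (g * alg_inv A * g) * b) = b * g * b" by (simp add: pos_sqrt_square)
  then show ?thesis unfolding geo_mean_def b_def
    by (simp add: mult.assoc alg_inv_cancel[OF a(2)] alg_inv[OF a(2)])
qed

lemma geo_mean_alg_inv_riccati:
  assumes A: "A \<in> pos_inv" and g: "cstar_positive g"
  shows "geo_mean (alg_inv A) (g * A * g) = g"
  using geo_mean_riccati[OF alg_inv_pos_inv[OF A] g] A by (simp add: alg_inv_alg_inv pos_inv_def)

lemma pos_inv_conj: assumes "B \<in> pos_inv" "g \<in> pos_inv" shows "g * B * g \<in> pos_inv"
  using assms by (auto simp: pos_inv_def intro!: pos_conj_sa alg_invertible_mult pos_sa)

lemma norm_conv_heron_mean:
  assumes "A \<in> pos_inv" "X \<in> pos_inv"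
  shows "norm (conv_heron_mean A X) = (norm (pos_sqrt A + pos_sqrt X))\<^sup>2 / 4"
proof -
  let ?s = "pos_sqrt A + pos_sqrt X"
  have "star ?s = ?s" using assms by (simp add: star_add pos_inv_sqrt)
  from norm_sa_square[OF this] show ?thesis
    unfolding conv_heron_mean_def by (simp add: power2_eq_square)
qed

text \<open>When \<open>u\<close> is central, the Riccati characterisation yields
  \<open>u * y\<close> and \<open>v * y\<close> as the two geometric means without evaluating the
  inner roots; all three means then expand to the same expression.\<close>

lemma central_means_eq:
  assumes A: "A \<in> pos_inv" and c: "central A" and X: "X \<in> pos_inv"
  shows "conv_heron_mean A X = ka_heron_mean A X" "conv_heron_mean A X = wasserstein_mean A X"
proof -
  note a = pos_inv_sqrt[OF A] and Y = pos_inv_sqrt[OF X]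
  define u where "u = pos_sqrt A"
  define v where "v = alg_inv u"
  define y where "y = pos_sqrt X"
  have pA: "cstar_positive A" using A by (simp add: pos_inv_def)
  have u: "z * u = u * z" for z
    using pos_sqrt_commute[OF pA, of z] c unfolding u_def central_def by simp
  have v: "v * z = z * v" for z
    unfolding v_def by (rule alg_inv_commute[OF _ u[symmetric]]) (simp add: u_def a(2))
  \<comment> \<open>Used with \<open>(p, q) = (u, v)\<close> and with \<open>(v, u)\<close>, to
    verify the two Riccati equations.\<close>
  have conj: "p * y * (q * q) * (p * y) = y * y" if "p * q = 1" "q * p = 1" "q * y = y * q" for p q
  proof -
    have "p * y * (q * q) = p * (y * q) * q" by (simp only: mult.assoc)
    also have "\<dots> = p * (q * y) * q" by (simp only: that(3))
    also have "\<dots> = (p * q) * (y * q)" by (simp only: mult.assoc)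
    finally have "p * y * (q * q) * (p * y) = y * (q * p) * y" by (simp add: that(1) mult.assoc)
    then show ?thesis by (simp add: that(2))
  qed
  have uv: "u * v = 1" "v * u = 1" using alg_inv[OF a(2)] unfolding u_def v_def by auto
  have A': "A = u * u" and iA: "alg_inv A = v * v" and X': "X = y * y"
    using a(3,6) Y(3) unfolding u_def v_def y_def by simp_all
  have pv: "cstar_positive v"
  proof -
    have "cstar_positive (v * u * v)"
      by (rule pos_conj_sa) (use a in \<open>simp_all add: u_def v_def\<close>)
    then show ?thesis using uv by simp
  qed
  have "cstar_positive (u * y)"     by (rule pos_mult_commute[OF _ _ u[symmetric]]) (simp_all add: u_def y_def a(1) Y(1))
  from geo_mean_riccati[OF A this]
  have "geo_mean A (u * y * (v * v) * (u * y)) = u * y" unfolding iA .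
  also have "u * y * (v * v) * (u * y) = X"
    unfolding X' by (rule conj[OF uv v])
  finally have g: "geo_mean A X = u * y" .
  show "conv_heron_mean A X = ka_heron_mean A X"
    unfolding conv_heron_mean_def ka_heron_mean_def g u_def[symmetric] y_def[symmetric]
    by (simp add: A' X' power2_eq_square algebra_simps scaleR_2 u[of y])
  have "cstar_positive (v * y)"     by (rule pos_mult_commute[OF pv _ v]) (simp add: y_def Y(1))
  from geo_mean_alg_inv_riccati[OF A this]
  have "geo_mean (alg_inv A) (v * y * A * (v * y)) = v * y" .
  also have "v * y * A * (v * y) = X"
    unfolding X' A' by (rule conj[OF uv(2,1) u[symmetric]])
  finally have w: "geo_mean (alg_inv A) X = v * y" .
  have "A * (v * y) = u * (u * v) * y" "v * y * A = (v * u) * (y * u)"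
    unfolding A' by (simp only: mult.assoc, simp only: mult.assoc[symmetric] u[symmetric, of y])
      (simp only: mult.assoc[of v] u[of y])
  then have "A * (v * y) = u * y" "v * y * A = u * y" using uv u[of y] by simp_all
  then show "conv_heron_mean A X = wasserstein_mean A X"
    unfolding conv_heron_mean_def wasserstein_mean_def w u_def[symmetric] y_def[symmetric]
    by (simp add: A' X' power2_eq_square algebra_simps u[of y])
qed

theorem theorem3p1:
  fixes A :: "'a::cstar_algebra"
  assumes "A \<in> pos_inv"
  shows "((\<forall>X\<in>pos_inv. norm (conv_heron_mean A X) = norm (ka_heron_mean A X)) \<or>
          (\<forall>X\<in>pos_inv. norm (conv_heron_mean A X) = norm (wasserstein_mean A X))
            \<longrightarrow> central A) \<and>
         (central A \<longrightarrow>
          (\<forall>X\<in>pos_inv. norm (conv_heron_mean A X) = norm (ka_heron_mean A X)) \<and>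
          (\<forall>X\<in>pos_inv. norm (conv_heron_mean A X) = norm (wasserstein_mean A X)))"
proof -
  note a = pos_inv_sqrt[OF assms]
  define u where "u = pos_sqrt A"
  have uu: "u * u = A" unfolding u_def by (rule a(3))
  have sqrt_central: "central u \<Longrightarrow> central A"
    unfolding uu[symmetric] central_def by (metis mult.assoc)
  have pu: "cstar_positive u" "alg_invertible u" using a unfolding u_def by simp_all
  have ka: "central A" if H: "\<forall>X\<in>pos_inv. norm (conv_heron_mean A X) = norm (ka_heron_mean A X)"
  proof (rule sqrt_central, rule central_if_kubo_ando_eq[OF pu])
    fix g :: 'a assume g: "g \<in> pos_inv"
    let ?X = "g * alg_inv A * g"
    have X: "?X \<in> pos_inv" by (rule pos_inv_conj[OF alg_inv_pos_inv[OF assms] g])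
    have "geo_mean A ?X = g" using geo_mean_riccati[OF assms] g by (simp add: pos_inv_def)
    then have "(norm (u + pos_sqrt ?X))\<^sup>2 / 4 = norm ((1/4) *\<^sub>R (A + ?X + 2 *\<^sub>R g))"
      using H[rule_format, OF X] norm_conv_heron_mean[OF assms X]
      unfolding ka_heron_mean_def u_def by simp
    then show "(norm (u + pos_sqrt (g * alg_inv (u * u) * g)))\<^sup>2 = norm (u * u + g * alg_inv (u * u) * g + 2 *\<^sub>R g)"
      unfolding uu by simp
  qed
  have w: "central A" if H: "\<forall>X\<in>pos_inv. norm (conv_heron_mean A X) = norm (wasserstein_mean A X)"
  proof (rule sqrt_central, rule central_if_wasserstein_eq[OF pu])
    fix g :: 'a assume g: "g \<in> pos_inv"
    let ?X = "g * A * g"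
    have X: "?X \<in> pos_inv" by (rule pos_inv_conj[OF assms g])
    have "geo_mean (alg_inv A) ?X = g"
      using geo_mean_alg_inv_riccati[OF assms] g by (simp add: pos_inv_def)
    then have "(norm (u + pos_sqrt ?X))\<^sup>2 / 4 = norm ((1/4) *\<^sub>R (A + ?X + A * g + g * A))"
      using H[rule_format, OF X] norm_conv_heron_mean[OF assms X]
      unfolding wasserstein_mean_def u_def by simp
    then show "(norm (u + pos_sqrt (g * (u * u) * g)))\<^sup>2
        = norm (u * u + g * (u * u) * g + u * u * g + g * (u * u))"
      unfolding uu by simp
  qed
  show ?thesis using ka w central_means_eq[OF assms] by metis
qed

end
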